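(* Let $n\in\mathbb{N}$, let $\mu$ be a finite Borel measure on $\mathbb{R}^n$, and assume that $\mu$ is not absolutely continuous with respect to the Lebesgue measure $\mathcal{L}_n$. Then there exists a sequence of continuously differentiable, $\sqrt2$-Lipschitz functions $g_k:\mathbb{R}^n\to\mathbb{R}^n$, $k\in\mathbb{N}$, converging pointwise to the identity, and such that $$\lim_{k\to\infty}\int_{\mathbb{R}^n}\det(\nabla g_k)\,d\mu<\mu(\mathbb{R}^n).$$
   Context: $\mathbb{R}^n$ carries the Euclidean norm; $\nabla g_k$ is the Jacobian matrix of $g_k$; $\sqrt2$-Lipschitz means $|g_k(y)-g_k(z)|\le\sqrt2|y-z|$ for all $y,z$. The conclusion includes that the limit exists. *)

theory Defs
  imports "HOL-Analysis.Analysis"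
begin

text \<open>
  \<^const>\<open>jacobian\<close> is built from a choice of derivative and is unspecified where \<open>f\<close> is
  not differentiable, so differentiability has to be required separately from continuity of the
  Jacobian.
\<close>

definition continuously_differentiable :: "(real ^ 'n \<Rightarrow> real ^ 'm) \<Rightarrow> bool" where
  "continuously_differentiable f \<longleftrightarrow>
     (\<forall>x. f differentiable (at x)) \<and> continuous_on UNIV (\<lambda>x. jacobian f (at x))"

end

theory Submission
  imports Defs
begin

text \<open>
  Perturb the identity by small gradients: for \<open>g = id + \<tau> \<nabla>F\<close> one has
  \<open>det \<nabla>g = 1 + \<tau> \<Delta>F + O(\<tau>\<^sup>2)\<close>, uniformly as long as the Hessian of \<open>F\<close> stays bounded. So it suffices
  to find \<open>F\<close> with bounded Hessian and arbitrarily small gradient for which \<open>\<integral> \<Delta>F d\<mu>\<close> is at most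
  a fixed negative constant.

  Since \<open>\<mu>\<close> charges a Lebesgue null set, a stopping-time argument yields finitely many disjoint balls of
  small total volume \<open>S\<close> on which \<open>\<mu>\<close> is comparable to a large multiple of Lebesgue measure, scale by
  scale. A potential \<open>p\<close> with \<open>- \<Delta>p \<ge> 1\<close> on these balls and \<open>\<Delta>p \<le> O(S)\<close> everywhere is uniformly small,
  but its Hessian is bounded only in mean square, by \<open>\<integral> |D\<^sup>2p|\<^sup>2 = \<integral> (\<Delta>p)\<^sup>2 = O(S)\<close>. By a
  Vitali covering argument, at most balls \<open>p\<close> is nevertheless touched from below by a paraboloid of
  fixed opening \<open>\<Lambda>\<close>. The largest minorant \<open>v\<close> of \<open>p\<close> with \<open>D\<^sup>2v \<ge> - \<Lambda>\<close> thus agrees with \<open>p\<close> on these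
  balls; it inherits \<open>\<Delta>v \<le> O(S)\<close> because averages of translates of minorants are almost minorants, and
  the two one-sided bounds together bound \<open>D\<^sup>2v\<close>. A mollification of \<open>v\<close> is the desired \<open>F\<close>.
\<close>

section \<open>Gradients and Hessians\<close>

text \<open>The obstacle is that \<open>\<tau>\<close> has to stay fixed along the sequence, since a
  gain of order \<open>\<tau>\<close> must survive in the limit. The Hessian bound must therefore
  not depend on how small the gradient is, and a bounded Laplacian alone does not bound the Hessian.
  This is what forces the passage from a mean-square bound to an envelope. Gain and cost are
  measured differently: the gain is collected on the balls, whose \<open>\<mu>\<close>-mass is at
  least a fixed multiple of \<open>lam * S\<close>, which is bounded below, whereas the error O(S)
  is integrated against all of \<open>\<mu>\<close>. Raising the density level \<open>lam\<close>
  makes S, and with it the error, arbitrarily small without touching the gain. The Newtonian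
  potential is replaced by finitely many dyadic dilates of one compactly supported nonnegative
  kernel. This treats all dimensions alike, leaves no boundary terms in integrations by parts, and
  the sign of the fine layers is what lets paraboloids touch from below. Bounding the determinant
  from above takes only an upper bound for the Laplacian. The constant sqrt 2 enters as 1 plus a
  positive margin, and convergence of the integrals comes from passing to a subsequence.\<close>

definition has_hessian ::
  "(real^'n \<Rightarrow> real) \<Rightarrow> (real^'n \<Rightarrow> real^'n) \<Rightarrow> (real^'n \<Rightarrow> real^'n^'n) \<Rightarrow> bool" where
  "has_hessian f G H \<longleftrightarrow>
     (\<forall>x. GDERIV f x :> G x) \<and> (\<forall>x i. GDERIV (\<lambda>x. G x $ i) x :> H x $ i)"

text \<open>Currying the two matrix indices makes \<open>T x i j\<close> an ordinary gradient, so
  the rules for \<open>GDERIV\<close> apply to one Hessian entry at a time. Symmetry in the indices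
  is not built in; it is supplied separately from explicit formulas.\<close>

definition has_third ::
  "(real^'n \<Rightarrow> real^'n^'n) \<Rightarrow> (real^'n \<Rightarrow> 'n \<Rightarrow> 'n \<Rightarrow> real^'n) \<Rightarrow> bool" where
  "has_third H T \<longleftrightarrow> (\<forall>x i j. GDERIV (\<lambda>x. H x $ i $ j) x :> T x i j)"

lemma has_hessianD:
  assumes "has_hessian f G H"
  shows "GDERIV f x :> G x" "GDERIV (\<lambda>x. G x $ i) x :> H x $ i"
  using assms by (auto simp: has_hessian_def)

lemma GDERIV_cmult: "GDERIV f x :> D \<Longrightarrow> GDERIV (\<lambda>x. c * f x) x :> c *\<^sub>R D"
  unfolding gderiv_def by (auto intro!: derivative_eq_intros)

lemma GDERIV_sum:
  "(\<And>j. j \<in> J \<Longrightarrow> GDERIV (f j) x :> D j) \<Longrightarrow> GDERIV (\<lambda>x. \<Sum>j\<in>J. f j x) x :> (\<Sum>j\<in>J. D j)"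
  unfolding gderiv_def by (auto intro!: derivative_eq_intros simp: inner_sum_right)

lemma GDERIV_dilation:
  assumes "GDERIV f (s *\<^sub>R (x - a)) :> D"
  shows "GDERIV (\<lambda>x. f (s *\<^sub>R (x - a))) x :> s *\<^sub>R D"
proof -
  have "((\<lambda>x. s *\<^sub>R (x - a)) has_derivative (\<lambda>h. s *\<^sub>R h)) (at x)"
    by (auto intro!: derivative_eq_intros)
  from has_derivative_compose[OF this assms[unfolded gderiv_def]]
  show ?thesis by (simp add: gderiv_def)
qed

lemma GDERIV_imp_continuous_on:
  assumes "\<And>x. GDERIV f x :> G x"
  shows "continuous_on UNIV f"
  by (intro continuous_at_imp_continuous_on ballI
      has_derivative_continuous[OF assms[unfolded gderiv_def]])

lemma GDERIV_imp_continuous_on_vec: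
  fixes G :: "'a::real_inner \<Rightarrow> real^'n"
  assumes "\<And>x i. GDERIV (\<lambda>x. G x $ i) x :> H x i"
  shows "continuous_on UNIV G"
proof -
  have "continuous_on UNIV (\<lambda>x. \<chi> i. G x $ i)"
    by (intro continuous_on_vec_lambda) (rule GDERIV_imp_continuous_on[OF assms])
  then show ?thesis by simp
qed

lemma has_hessian_continuous:
  assumes "has_hessian f G H"
  shows "continuous_on UNIV f" "continuous_on UNIV G"
  using GDERIV_imp_continuous_on[OF has_hessianD(1)[OF assms]]
    GDERIV_imp_continuous_on_vec[OF has_hessianD(2)[OF assms]] by auto

lemma has_third_continuous:
  assumes "has_third H T"
  shows "continuous_on UNIV H"
proof -
  have "continuous_on UNIV (\<lambda>x. H x $ i $ j)" for i j
    using assms unfolding has_third_def by (intro GDERIV_imp_continuous_on) blast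
  then have "continuous_on UNIV (\<lambda>x. \<chi> i j. H x $ i $ j)"
    by (intro continuous_on_vec_lambda)
  then show ?thesis by simp
qed

lemma has_hessian_sum:
  assumes "\<And>j. j \<in> J \<Longrightarrow> has_hessian (f j) (G j) (H j)"
  shows "has_hessian (\<lambda>x. \<Sum>j\<in>J. f j x) (\<lambda>x. \<Sum>j\<in>J. G j x) (\<lambda>x. \<Sum>j\<in>J. H j x)"
  using assms unfolding has_hessian_def by (auto intro!: GDERIV_sum)

lemma has_third_sum:
  assumes "\<And>j. j \<in> J \<Longrightarrow> has_third (H j) (T j)"
  shows "has_third (\<lambda>x. \<Sum>j\<in>J. H j x) (\<lambda>x a b. \<Sum>j\<in>J. T j x a b)"
  using assms unfolding has_third_def by (auto intro!: GDERIV_sum)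

lemma has_hessian_cmult:
  assumes "has_hessian f G H"
  shows "has_hessian (\<lambda>x. c * f x) (\<lambda>x. c *\<^sub>R G x) (\<lambda>x. c *\<^sub>R H x)"
  using assms unfolding has_hessian_def by (auto intro!: GDERIV_cmult)

lemma has_hessian_dilation:
  assumes "has_hessian f G H"
  shows "has_hessian (\<lambda>x. c * f (s *\<^sub>R (x - a))) (\<lambda>x. (c * s) *\<^sub>R G (s *\<^sub>R (x - a)))
     (\<lambda>x. (c * s^2) *\<^sub>R H (s *\<^sub>R (x - a)))"
proof -
  have 1: "GDERIV (\<lambda>x. c * f (s *\<^sub>R (x - a))) x :> (c * s) *\<^sub>R G (s *\<^sub>R (x - a))" for x
    using GDERIV_cmult[OF GDERIV_dilation[OF has_hessianD(1)[OF assms]], where c = c] by simp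
  have 2: "GDERIV (\<lambda>x. (c * s) * (G (s *\<^sub>R (x - a)) $ i)) x :> (c * s) *\<^sub>R s *\<^sub>R (H (s *\<^sub>R (x - a)) $ i)" for x i
    by (intro GDERIV_cmult GDERIV_dilation[where f = "\<lambda>x. G x $ i"] has_hessianD(2)[OF assms])
  show ?thesis using 1 2 by (auto simp: has_hessian_def power2_eq_square mult.assoc)
qed

lemma has_third_dilation:
  assumes "has_third H T"
  shows "has_third (\<lambda>x. c *\<^sub>R H (s *\<^sub>R (x - a))) (\<lambda>x i j. (c * s) *\<^sub>R T (s *\<^sub>R (x - a)) i j)"
proof -
  have "GDERIV (\<lambda>x. c * (H (s *\<^sub>R (x - a)) $ i $ j)) x :> c *\<^sub>R s *\<^sub>R (T (s *\<^sub>R (x - a)) i j)" for x i j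
    using assms unfolding has_third_def
    by (intro GDERIV_cmult GDERIV_dilation[where f = "\<lambda>x. H x $ i $ j"]) blast
  then show ?thesis by (simp add: has_third_def)
qed

section \<open>Restriction to lines, matrix norms and second-order Taylor estimates\<close>

lemma GDERIV_line:
  assumes "GDERIV f (x + s *\<^sub>R h) :> D"
  shows "((\<lambda>s. f (x + s *\<^sub>R h)) has_real_derivative (h \<bullet> D)) (at s)"
proof -
  have "((\<lambda>s. x + s *\<^sub>R h) has_derivative (\<lambda>t. t *\<^sub>R h)) (at s)"
    by (auto intro!: derivative_eq_intros)
  from has_derivative_compose[OF this assms[unfolded gderiv_def]]
  show ?thesis by (simp add: has_field_derivative_def mult_commute_abs)
qed

lemma has_hessian_line:
  assumes "has_hessian f G H"
  shows "((\<lambda>s. f (x + s *\<^sub>R h)) has_real_derivative (h \<bullet> G (x + s *\<^sub>R h))) (at s)"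
    "((\<lambda>s. h \<bullet> G (x + s *\<^sub>R h)) has_real_derivative (h \<bullet> (H (x + s *\<^sub>R h) *v h))) (at s)"
proof -
  show "((\<lambda>s. f (x + s *\<^sub>R h)) has_real_derivative (h \<bullet> G (x + s *\<^sub>R h))) (at s)"
    by (rule GDERIV_line[OF has_hessianD(1)[OF assms]])
  have "((\<lambda>s. \<Sum>i\<in>UNIV. h $ i * (G (x + s *\<^sub>R h) $ i)) has_real_derivative
      (\<Sum>i\<in>UNIV. h $ i * (h \<bullet> H (x + s *\<^sub>R h) $ i))) (at s)"
    by (intro DERIV_sum DERIV_cmult GDERIV_line[OF has_hessianD(2)[OF assms]])
  then show "((\<lambda>s. h \<bullet> G (x + s *\<^sub>R h)) has_real_derivative (h \<bullet> (H (x + s *\<^sub>R h) *v h))) (at s)"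
    by (simp add: inner_vec_def matrix_vector_mult_def mult.commute)
qed

lemma GDERIV_bound_imp_lipschitz:
  fixes f :: "'a::real_inner \<Rightarrow> real"
  assumes "\<And>x. GDERIV f x :> G x" "\<And>x. norm (G x) \<le> B"
  shows "\<bar>f y - f x\<bar> \<le> B * norm (y - x)"
proof -
  have "norm (f y - f x) \<le> B * norm (y - x)"
  proof (rule differentiable_bound[of UNIV f "\<lambda>x h. h \<bullet> G x"])
    show "\<And>x. x \<in> UNIV \<Longrightarrow> (f has_derivative (\<lambda>h. h \<bullet> G x)) (at x within UNIV)"
      using assms(1) by (auto simp: gderiv_def)
    show "onorm (\<lambda>h. h \<bullet> G x) \<le> B" for x
    proof (rule onorm_bound)
      show "0 \<le> B" using norm_ge_zero[of "G x"] assms(2)[of x] by linarith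
      fix h show "norm (h \<bullet> G x) \<le> B * norm h"
        using Cauchy_Schwarz_ineq2[of h "G x"] mult_right_mono[OF assms(2)[of x] norm_ge_zero[of h]]
        by (simp add: mult.commute)
    qed
  qed auto
  then show ?thesis by simp
qed

lemma norm_entries_le:
  fixes A :: "real^'n^'m"
  assumes "\<And>i j. \<bar>A $ i $ j\<bar> \<le> B"
  shows "norm A \<le> real (CARD('m) * CARD('n)) * B"
proof -
  have "norm A \<le> (\<Sum>i\<in>UNIV. norm (A $ i))"
    by (simp add: norm_vec_def L2_set_le_sum)
  also have "\<dots> \<le> (\<Sum>i\<in>(UNIV::'m set). real CARD('n) * B)"
  proof (rule sum_mono)
    fix i
    have "norm (A $ i) \<le> (\<Sum>j\<in>UNIV. \<bar>A $ i $ j\<bar>)" by (rule norm_le_l1_cart)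
    also have "\<dots> \<le> (\<Sum>j\<in>(UNIV::'n set). B)" by (intro sum_mono assms)
    finally show "norm (A $ i) \<le> real CARD('n) * B" by simp
  qed
  finally show ?thesis by simp
qed

lemma abs_entry_le_norm:
  fixes A :: "real^'n^'m"
  shows "\<bar>A $ i $ j\<bar> \<le> norm A"
  using component_le_norm_cart[of "A $ i" j] Finite_Cartesian_Product.norm_nth_le[of A i] by linarith

lemma norm_matrix_vector_le:
  fixes A :: "real^'n^'m"
  shows "norm (A *v h) \<le> norm A * norm h"
proof -
  have "\<bar>(A *v h) $ i\<bar> \<le> norm (A $ i) * norm h" for i
    using Cauchy_Schwarz_ineq2[of "A $ i" h] by (simp add: matrix_vector_mult_def inner_vec_def)
  then have "L2_set (\<lambda>i. norm ((A *v h) $ i)) UNIV \<le> L2_set (\<lambda>i. norm (A $ i) * norm h) UNIV"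
    by (intro L2_set_mono) auto
  also have "\<dots> = norm A * norm h"
    using L2_set_left_distrib[of "norm h" "\<lambda>i. norm (A $ i)" UNIV] by (simp add: norm_vec_def)
  finally show ?thesis by (simp add: norm_vec_def)
qed

lemma abs_quad_le:
  fixes A :: "real^'n^'n"
  shows "\<bar>h \<bullet> (A *v h)\<bar> \<le> norm A * (norm h)^2"
proof -
  have "\<bar>h \<bullet> (A *v h)\<bar> \<le> norm h * norm (A *v h)" by (rule Cauchy_Schwarz_ineq2)
  also have "\<dots> \<le> norm h * (norm A * norm h)"
    by (intro mult_left_mono norm_matrix_vector_le) auto
  finally show ?thesis by (simp add: power2_eq_square ac_simps)
qed

text \<open>Subtracting \<open>c / 2 * s^2\<close> reduces to \<open>c = 0\<close>, where
  \<open>\<phi>'\<close> is nondecreasing on the unit interval and the mean value theorem finishes.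
  No continuity of \<open>\<phi>''\<close> is assumed, so an integral remainder is avoided.\<close>

lemma taylor_lower_real:
  fixes \<phi> \<phi>' \<phi>'' :: "real \<Rightarrow> real"
  assumes "\<And>s. (\<phi> has_real_derivative \<phi>' s) (at s)" "\<And>s. (\<phi>' has_real_derivative \<phi>'' s) (at s)"
    and "\<And>s. 0 \<le> s \<Longrightarrow> s \<le> 1 \<Longrightarrow> c \<le> \<phi>'' s"
  shows "\<phi> 0 + \<phi>' 0 + c / 2 \<le> \<phi> 1"
proof -
  let ?g = "\<lambda>s. \<phi> s - c / 2 * s^2" and ?g' = "\<lambda>s. \<phi>' s - c * s"
  have d1: "(?g has_real_derivative ?g' s) (at s)" for s
    by (auto intro!: derivative_eq_intros assms)
  have d2: "(?g' has_real_derivative \<phi>'' s - c) (at s)" for s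
    by (auto intro!: derivative_eq_intros assms)
  obtain z where z: "0 < z" "z < 1" "?g 1 - ?g 0 = (1 - 0) * ?g' z"
    using MVT2[of 0 1 ?g ?g'] d1 by auto
  have "?g' 0 \<le> ?g' z"
  proof (rule DERIV_nonneg_imp_nondecreasing[of 0 z ?g'])
    show "0 \<le> z" using z by simp
    fix s assume s: "0 \<le> s" "s \<le> z"
    show "\<exists>y. DERIV ?g' s :> y \<and> 0 \<le> y"
      using d2[of s] assms(3)[of s] s z by (intro exI[of _ "\<phi>'' s - c"]) auto
  qed
  with z(3) show ?thesis by simp
qed

lemma has_hessian_taylor_lower:
  assumes "has_hessian f G H"
    and "\<And>s. 0 \<le> s \<Longrightarrow> s \<le> 1 \<Longrightarrow> c \<le> h \<bullet> (H (x + s *\<^sub>R h) *v h)"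
  shows "f x + h \<bullet> G x + c / 2 \<le> f (x + h)"
  using taylor_lower_real[OF has_hessian_line[OF assms(1), where x = x and h = h], of c] assms(2)
  by simp

lemma minus_matrix_vector_mult: "(- A) *v h = - (A *v h)" for A :: "real^'n^'m"
  by (simp add: vec_eq_iff matrix_vector_mult_def sum_negf)

lemma matrix_vector_mult_minus: "A *v (- h) = - (A *v h)" for A :: "real^'n^'m"
  by (simp add: vec_eq_iff matrix_vector_mult_def sum_negf)

lemma has_hessian_taylor_upper:
  assumes "has_hessian f G H"
    and "\<And>s. 0 \<le> s \<Longrightarrow> s \<le> 1 \<Longrightarrow> h \<bullet> (H (x + s *\<^sub>R h) *v h) \<le> c"
  shows "f (x + h) \<le> f x + h \<bullet> G x + c / 2"
proof -
  have "has_hessian (\<lambda>x. - 1 * f x) (\<lambda>x. - 1 *\<^sub>R G x) (\<lambda>x. - 1 *\<^sub>R H x)"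
    by (rule has_hessian_cmult[OF assms(1)])
  from has_hessian_taylor_lower[OF this, of "- c" h x] assms(2)
  show ?thesis by (simp add: minus_matrix_vector_mult)
qed

text \<open>The gradient terms cancel when the Taylor estimates for \<open>h\<close> and
  \<open>- h\<close> are added; the range [-1, 1] of \<open>s\<close> covers both half
  segments.\<close>

lemma second_difference_bounds:
  assumes "has_hessian f G H"
    and "\<And>s. \<bar>s\<bar> \<le> 1 \<Longrightarrow> a \<le> h \<bullet> (H (x + s *\<^sub>R h) *v h) \<and> h \<bullet> (H (x + s *\<^sub>R h) *v h) \<le> b"
  shows "a \<le> f (x + h) + f (x - h) - 2 * f x" "f (x + h) + f (x - h) - 2 * f x \<le> b"
proof -
  have neg: "(- h) \<bullet> (H (x + s *\<^sub>R (- h)) *v (- h)) = h \<bullet> (H (x + (- s) *\<^sub>R h) *v h)" for s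
    by (simp add: matrix_vector_mult_minus)
  have "f x + h \<bullet> G x + a / 2 \<le> f (x + h)"
    using assms(2) by (intro has_hessian_taylor_lower[OF assms(1)]) auto
  moreover have "f x + (-h) \<bullet> G x + a / 2 \<le> f (x + (- h))"
    by (intro has_hessian_taylor_lower[OF assms(1)], subst neg) (intro conjunct1[OF assms(2)], simp)
  ultimately show "a \<le> f (x + h) + f (x - h) - 2 * f x" by simp
  have "f (x + h) \<le> f x + h \<bullet> G x + b / 2"
    using assms(2) by (intro has_hessian_taylor_upper[OF assms(1)]) auto
  moreover have "f (x + (- h)) \<le> f x + (-h) \<bullet> G x + b / 2"
    by (intro has_hessian_taylor_upper[OF assms(1)], subst neg) (intro conjunct2[OF assms(2)], simp)
  ultimately show "f (x + h) + f (x - h) - 2 * f x \<le> b" by simp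
qed

section \<open>A compactly supported kernel with telescoping Laplacian\<close>

text \<open>A truncated polynomial in place of a smooth exponential bump: differentiation just
  lowers the exponent, so every derivative is again explicit and supported in the unit ball. Three
  derivatives of \<open>bump 5\<close> are used.\<close>

definition bump :: "nat \<Rightarrow> 'a::real_inner \<Rightarrow> real" where
  "bump a x = (max 0 (1 - x \<bullet> x)) ^ a"

text \<open>Away from 0 the function is locally a power or zero. At 0 an exponent of at least 2
  bounds the difference quotient by \<open>\<bar>h\<bar> ^ Suc a\<close>, which tends to 0.\<close>

lemma DERIV_max_power:
  "((\<lambda>u::real. (max 0 u) ^ (Suc (Suc a))) has_real_derivative
     real (Suc (Suc a)) * (max 0 u) ^ Suc a) (at u)"
proof -
  consider "u < 0" | "u > 0" | "u = 0" by linarith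
  then show ?thesis
  proof cases
    case 1
    have "((\<lambda>u::real. 0) has_real_derivative 0) (at u)" by simp
    moreover have "\<forall>\<^sub>F x in nhds u. 0 = (max 0 x) ^ (Suc (Suc a))"
      using eventually_nhds_in_open[of "{..<0}" u] 1 by (auto elim!: eventually_mono simp: max_def)
    ultimately have "((\<lambda>u::real. (max 0 u) ^ (Suc (Suc a))) has_real_derivative 0) (at u)"
      using DERIV_cong_ev[OF refl, of "\<lambda>u. 0" "\<lambda>u. (max 0 u) ^ (Suc (Suc a))" u 0 0] by simp
    then show ?thesis using 1 by (simp add: max_def)
  next
    case 2
    have "((\<lambda>u::real. u ^ (Suc (Suc a))) has_real_derivative real (Suc (Suc a)) * u ^ Suc a) (at u)"
      by (rule derivative_eq_intros | simp)+
    moreover have "\<forall>\<^sub>F x in nhds u. x ^ (Suc (Suc a)) = (max 0 x) ^ (Suc (Suc a))"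
      using eventually_nhds_in_open[of "{0<..}" u] 2 by (auto elim!: eventually_mono simp: max_def)
    ultimately have "((\<lambda>u::real. (max 0 u) ^ (Suc (Suc a))) has_real_derivative
         real (Suc (Suc a)) * u ^ Suc a) (at u)"
      using DERIV_cong_ev[OF refl, of "\<lambda>u. u ^ (Suc (Suc a))" "\<lambda>u. (max 0 u) ^ (Suc (Suc a))" u] by blast
    then show ?thesis using 2 by (simp add: max_def)
  next
    case 3
    have "((\<lambda>h::real. ((max 0 (0 + h)) ^ (Suc (Suc a)) - (max 0 0) ^ (Suc (Suc a))) / h) \<longlongrightarrow> 0) (at 0)"
    proof (rule Lim_null_comparison)
      show "\<forall>\<^sub>F h in at (0::real).
         norm (((max 0 (0 + h)) ^ (Suc (Suc a)) - (max 0 0) ^ (Suc (Suc a))) / h) \<le> \<bar>h\<bar> ^ Suc a"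
      proof (intro always_eventually allI)
        fix h :: real
        have "(max 0 h) ^ Suc (Suc a) \<le> \<bar>h\<bar> ^ Suc (Suc a)" by (intro power_mono) auto
        then show "norm (((max 0 (0 + h)) ^ (Suc (Suc a)) - (max 0 0) ^ (Suc (Suc a))) / h) \<le> \<bar>h\<bar> ^ Suc a"
          by (cases "h = 0") (auto simp: divide_simps abs_mult ac_simps)
      qed
      show "((\<lambda>h::real. \<bar>h\<bar> ^ Suc a) \<longlongrightarrow> 0) (at 0)"
        by (rule tendsto_eq_intros | simp)+
    qed
    then show ?thesis using 3 by (simp add: DERIV_def)
  qed
qed

lemma bump_props:
  shows bump_nonneg: "0 \<le> bump a x" and bump_le_1: "bump a x \<le> 1"
    and bump_eq_0: "1 \<le> norm x \<Longrightarrow> 0 < a \<Longrightarrow> bump a x = 0"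
    and bump_continuous: "continuous_on S (bump a)"
proof -
  show "0 \<le> bump a x" by (simp add: bump_def)
  have "(max 0 (1 - x \<bullet> x)) ^ a \<le> 1 ^ a" by (intro power_mono) auto
  then show "bump a x \<le> 1" by (simp add: bump_def)
  show "bump a x = 0" if "1 \<le> norm x" "0 < a"
    using that by (simp add: bump_def dot_square_norm max_def) (smt (verit) one_le_power)
  show "continuous_on S (bump a)" unfolding bump_def by (intro continuous_intros)
qed

lemma GDERIV_bump: "GDERIV (bump (Suc (Suc a))) x :> (- 2 * real (Suc (Suc a)) * bump (Suc a) x) *\<^sub>R x"
proof -
  have "((\<lambda>x. 1 - x \<bullet> x) has_derivative (\<lambda>h. - (2 * (h \<bullet> x)))) (at x)"
    by (auto intro!: derivative_eq_intros simp: inner_commute)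
  from has_derivative_compose[OF this DERIV_max_power[unfolded has_field_derivative_def]]
  show ?thesis
    by (simp add: gderiv_def bump_def[abs_def] algebra_simps)
qed

lemma GDERIV_component: "GDERIV (\<lambda>x::real^'n. x $ i) x :> axis i 1"
proof -
  have "((\<lambda>x::real^'n. x $ i) has_derivative (\<lambda>h. h $ i)) (at x)"
    by (intro bounded_linear.has_derivative[OF bounded_linear_vec_nth] has_derivative_ident)
  then show ?thesis by (simp add: gderiv_def inner_axis)
qed

text \<open>The coefficients of the three derivatives of \<open>bump 5\<close> are 10 = 2 * 5, 80 =
  10 * 2 * 4 and 480 = 80 * 2 * 3: each differentiation of \<open>bump a\<close> produces the factor
  \<open>- 2 * a\<close>.\<close>

definition bump_G :: "real^'n \<Rightarrow> real^'n" where
  "bump_G x = (- 10 * bump 4 x) *\<^sub>R x"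

definition bump_H :: "real^'n \<Rightarrow> real^'n^'n" where
  "bump_H x = (\<chi> i j. 80 * bump 3 x * x $ i * x $ j - 10 * bump 4 x * (if i = j then 1 else 0))"

definition bump_T :: "real^'n \<Rightarrow> 'n \<Rightarrow> 'n \<Rightarrow> real^'n" where
  "bump_T x i j = (\<chi> k. - 480 * bump 2 x * x $ i * x $ j * x $ k
      + 80 * bump 3 x * ((if i = k then x $ j else 0) + (if j = k then x $ i else 0)
         + (if i = j then x $ k else 0)))"

lemma has_hessian_bump: "has_hessian (bump 5) bump_G bump_H"
proof -
  have 1: "GDERIV (bump 5) x :> bump_G x" for x :: "real^'n"
    using GDERIV_bump[of 3 x] by (simp add: bump_G_def numeral_eq_Suc)
  have b4: "GDERIV (bump 4) x :> (- 8 * bump 3 x) *\<^sub>R x" for x :: "real^'n"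
    using GDERIV_bump[of 2 x] by (simp add: numeral_eq_Suc)
  have 2: "GDERIV (\<lambda>x. bump_G x $ i) x :> bump_H x $ i" for x :: "real^'n" and i
  proof -
    have "GDERIV (\<lambda>x. - 10 * (bump 4 x * x $ i)) x :>
        - 10 *\<^sub>R (bump 4 x *\<^sub>R axis i 1 + (x $ i) *\<^sub>R ((- 8 * bump 3 x) *\<^sub>R x))"
      by (intro GDERIV_cmult GDERIV_mult GDERIV_component b4)
    moreover have "- 10 *\<^sub>R (bump 4 x *\<^sub>R axis i 1 + (x $ i) *\<^sub>R ((- 8 * bump 3 x) *\<^sub>R x)) = bump_H x $ i"
      by (auto simp: bump_H_def vec_eq_iff axis_def algebra_simps)
    ultimately show ?thesis by (simp add: bump_G_def mult.assoc)
  qed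
  show ?thesis unfolding has_hessian_def using 1 2 by blast
qed

lemma has_third_bump: "has_third bump_H bump_T"
  unfolding has_third_def
proof (intro allI)
  fix x :: "real^'n" and i j :: 'n
  have b4: "GDERIV (bump 4) x :> (- 8 * bump 3 x) *\<^sub>R x"
    using GDERIV_bump[of 2 x] by (simp add: numeral_eq_Suc)
  have b3: "GDERIV (bump 3) x :> (- 6 * bump 2 x) *\<^sub>R x"
    using GDERIV_bump[of 1 x] by (simp add: numeral_eq_Suc)
  let ?d = "if i = j then 1 else 0 :: real"
  have "GDERIV (\<lambda>x. 80 * (bump 3 x * (x $ i * x $ j)) - (10 * ?d) * bump 4 x) x :>
      80 *\<^sub>R (bump 3 x *\<^sub>R ((x $ i) *\<^sub>R axis j 1 + (x $ j) *\<^sub>R axis i 1)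
         + (x $ i * x $ j) *\<^sub>R ((- 6 * bump 2 x) *\<^sub>R x)) - (10 * ?d) *\<^sub>R ((- 8 * bump 3 x) *\<^sub>R x)"
    by (intro GDERIV_cmult GDERIV_mult GDERIV_diff GDERIV_component b4 b3)
  moreover have "80 *\<^sub>R (bump 3 x *\<^sub>R ((x $ i) *\<^sub>R axis j 1 + (x $ j) *\<^sub>R axis i 1)
         + (x $ i * x $ j) *\<^sub>R ((- 6 * bump 2 x) *\<^sub>R x)) - (10 * ?d) *\<^sub>R ((- 8 * bump 3 x) *\<^sub>R x)
      = bump_T x i j"
    by (auto simp: bump_T_def vec_eq_iff axis_def algebra_simps)
  ultimately show "GDERIV (\<lambda>x. bump_H x $ i $ j) x :> bump_T x i j"
    by (simp add: bump_H_def ac_simps)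
qed

lemma bump_T_continuous: "continuous_on UNIV (\<lambda>x. bump_T x i j)" for i j :: "'n::finite"
proof -
  have e: "bump_T x i j = (\<chi> k. - 480 * bump 2 x * x $ i * x $ j * x $ k
      + 80 * bump 3 x * ((if i = k then 1 else 0) * x $ j + (if j = k then 1 else 0) * x $ i
         + (if i = j then 1 else 0) * x $ k))" for x :: "real^'n"
    by (simp add: bump_T_def vec_eq_iff)
  show ?thesis unfolding e by (intro continuous_intros bump_continuous)
qed

lemma bump_derivs_eq_0:
  assumes "1 \<le> norm x"
  shows "bump_G x = 0" "bump_H x = 0" "bump_T x i j = 0"
  using assms by (simp_all add: bump_G_def bump_H_def bump_T_def bump_eq_0 vec_eq_iff)

lemma bounded_of_compact_support:
  fixes g :: "'a::euclidean_space \<Rightarrow> real"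
  assumes "continuous_on UNIV g" "\<And>x. R \<le> norm x \<Longrightarrow> g x = 0"
  obtains K where "0 \<le> K" "\<And>x. \<bar>g x\<bar> \<le> K"
proof -
  have "compact (g ` cball 0 R)"
    by (intro compact_continuous_image continuous_on_subset[OF assms(1)]) auto
  then obtain K where K: "\<And>y. y \<in> g ` cball 0 R \<Longrightarrow> \<bar>y\<bar> \<le> K"
    using bounded_iff[of "g ` cball 0 R"] by (auto dest: compact_imp_bounded)
  have "\<bar>g x\<bar> \<le> max 0 K" for x
    using K[of "g x"] assms(2)[of x] by (cases "norm x \<le> R") auto
  then show ?thesis using that[of "max 0 K"] by auto
qed

lemma third_bounded_of_compact_support:
  fixes T :: "real^'n \<Rightarrow> 'm::finite \<Rightarrow> 'm \<Rightarrow> real^'n"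
  assumes "\<And>i j. continuous_on UNIV (\<lambda>x. T x i j)" "\<And>x i j. R \<le> norm x \<Longrightarrow> T x i j = 0"
  obtains M where "0 \<le> M" "\<And>x i j. norm (T x i j) \<le> M"
proof -
  have "\<exists>K. \<forall>x. norm (T x (fst q) (snd q)) \<le> K" for q
    by (rule bounded_of_compact_support[of "\<lambda>x. norm (T x (fst q) (snd q))" R])
      (use assms in \<open>auto intro!: continuous_intros\<close>)
  then obtain K where K: "\<And>q x. norm (T x (fst q) (snd q)) \<le> K q" by metis
  have K0: "0 \<le> K q" for q using order_trans[OF norm_ge_zero K] .
  have "norm (T x i j) \<le> (\<Sum>q\<in>UNIV. K q)" for x i j
    using K[of x "(i, j)"] member_le_sum[of "(i, j)" UNIV K] K0 by simp
  then show ?thesis using that[of "\<Sum>q\<in>UNIV. K q"] K0 by (simp add: sum_nonneg)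
qed

text \<open>With \<open>chi = 10 * bump 4\<close> below, \<open>- s ^ (n - 1)\<close> times the Laplacian of \<open>bump 5\<close> at \<open>s x\<close> is the
  \<open>s\<close>-derivative of \<open>s ^ n * chi (s x)\<close>. Integrating over the dilations \<open>1 \<le> s \<le> 2\<close> produces a kernel
  whose Laplacians at dyadic scales telescope.\<close>

definition scale_int :: "nat \<Rightarrow> (real^'n \<Rightarrow> real) \<Rightarrow> real^'n \<Rightarrow> real" where
  "scale_int m g x = integral {1..2} (\<lambda>s. s ^ CARD('n) * s ^ m / s ^ 3 * g (s *\<^sub>R x))"

lemma scale_int_integrand_continuous:
  fixes g :: "real^'n \<Rightarrow> real"
  assumes "continuous_on UNIV g"
  shows "continuous_on {1..2} (\<lambda>s. s ^ CARD('n) * s ^ m / s ^ 3 * g (s *\<^sub>R x))"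
  by (intro continuous_intros continuous_on_compose2[OF assms]) auto

text \<open>Differentiation under the integral sign. The chain rule produces one factor
  \<open>s\<close> per derivative, which the index \<open>m\<close> counts; the weight of exponent
  \<open>CARD('n) + m - 3\<close> is written as a quotient because that number may be
  negative.\<close>

lemma GDERIV_scale_int:
  fixes g :: "real^'n \<Rightarrow> real"
  assumes "\<And>x. GDERIV g x :> G x" "\<And>i. continuous_on UNIV (\<lambda>x. G x $ i)"
  shows "GDERIV (scale_int m g) x :> (\<chi> i. scale_int (Suc m) (\<lambda>x. G x $ i) x)"
proof -
  let ?w = "\<lambda>m s::real. s ^ CARD('n) * s ^ m / s ^ 3"
  have Gc: "continuous_on UNIV G"
    using continuous_on_vec_lambda[of UNIV "\<lambda>i x. G x $ i"] assms(2) by simp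
  have gc: "continuous_on UNIV g" by (rule GDERIV_imp_continuous_on[OF assms(1)])
  let ?D = "\<lambda>x s. (?w m s * s) *\<^sub>R G (s *\<^sub>R x)"
  let ?fx = "\<lambda>x s. blinfun_inner_left (?D x s)"
  have c: "continuous_on (UNIV \<times> {1..2}) (\<lambda>(x, s). ?D x s)"
    unfolding case_prod_beta by (intro continuous_intros continuous_on_compose2[OF Gc]) auto
  have leib: "((\<lambda>x. integral (cbox 1 2) (\<lambda>s. ?w m s * g (s *\<^sub>R x))) has_derivative
      integral (cbox 1 2) (?fx x)) (at x within UNIV)"
  proof (rule leibniz_rule)
    show "((\<lambda>x. ?w m s * g (s *\<^sub>R x)) has_derivative blinfun_apply (?fx x s)) (at x within UNIV)" for x s
      using GDERIV_cmult[OF GDERIV_dilation[where a = 0 and f = g and s = s and x = x, OF assms(1)], of "?w m s"]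
      by (simp add: gderiv_def blinfun_inner_left.rep_eq)
    show "(\<lambda>s. ?w m s * g (s *\<^sub>R x)) integrable_on cbox 1 2" for x
      using scale_int_integrand_continuous[OF gc] by (intro integrable_continuous) auto
    show "continuous_on (UNIV \<times> cbox 1 2) (\<lambda>(x, s). ?fx x s)"
      using c unfolding case_prod_beta
      by (intro bounded_linear.continuous_on[OF bounded_linear_blinfun_inner_left]) auto
  qed auto
  have "blinfun_apply (integral (cbox 1 2) (?fx x)) h =
      h \<bullet> (\<chi> i. scale_int (Suc m) (\<lambda>x. G x $ i) x)" for h
  proof -
    have cD: "continuous_on {1..2} (?D x)"
      by (intro continuous_intros continuous_on_compose2[OF Gc]) auto
    have cf: "continuous_on {1..2} (?fx x)"
      by (intro bounded_linear.continuous_on[OF bounded_linear_blinfun_inner_left] cD)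
    have "blinfun_apply (integral (cbox 1 2) (?fx x)) h = integral (cbox 1 2) (\<lambda>s. blinfun_apply (?fx x s) h)"
      using cf by (subst blinfun_apply_integral) (auto intro!: integrable_continuous_real)
    also have "\<dots> = integral {1..2} (\<lambda>s. \<Sum>i\<in>UNIV. h $ i * (?D x s $ i))"
      by (simp add: blinfun_inner_left.rep_eq inner_vec_def)
    also have "\<dots> = (\<Sum>i\<in>UNIV. integral {1..2} (\<lambda>s. h $ i * (?D x s $ i)))"
    proof (intro integral_sum)
      fix i :: 'n
      have "continuous_on {1..2} (\<lambda>s. ?D x s $ i)"
        by (intro continuous_on_component cD)
      then show "(\<lambda>s. h $ i * ?D x s $ i) integrable_on {1..2}"
        by (intro integrable_continuous_real continuous_on_mult continuous_on_const)
    qed auto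
    also have "\<dots> = (\<Sum>i\<in>UNIV. h $ i * integral {1..2} (\<lambda>s. ?D x s $ i))"
      by (simp only: integral_mult_right)
    also have "\<dots> = h \<bullet> (\<chi> i. scale_int (Suc m) (\<lambda>x. G x $ i) x)"
      by (simp add: inner_vec_def scale_int_def ac_simps)
    finally show ?thesis .
  qed
  then have "blinfun_apply (integral (cbox 1 2) (?fx x)) = (\<lambda>h. h \<bullet> (\<chi> i. scale_int (Suc m) (\<lambda>x. G x $ i) x))"
    by (rule ext)
  with leib show ?thesis
    unfolding gderiv_def scale_int_def[of m g, abs_def] by (simp only: interval_cbox)
qed

text \<open>The dilation factors are at least 1, so averaging over them does not enlarge the support
  beyond the unit ball.\<close>

lemma scale_int_eq_0:
  assumes "\<And>x. 1 \<le> norm x \<Longrightarrow> g x = 0" "1 \<le> norm x"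
  shows "scale_int m g x = 0"
proof -
  have "g (s *\<^sub>R x) = 0" if "s \<in> {1..2}" for s
    using that assms(2) mult_mono[of 1 s 1 "norm x"] by (intro assms(1)) auto
  then show ?thesis unfolding scale_int_def by (intro integral_unique has_integral_is_0) auto
qed

definition kern :: "real^'n \<Rightarrow> real" where
  "kern = scale_int 0 (bump 5)"

definition kern_G :: "real^'n \<Rightarrow> real^'n" where
  "kern_G x = (\<chi> i. scale_int 1 (\<lambda>x. bump_G x $ i) x)"

definition kern_H :: "real^'n \<Rightarrow> real^'n^'n" where
  "kern_H x = (\<chi> i j. scale_int 2 (\<lambda>x. bump_H x $ i $ j) x)"

definition kern_T :: "real^'n \<Rightarrow> 'n \<Rightarrow> 'n \<Rightarrow> real^'n" where
  "kern_T x i j = (\<chi> k. scale_int 3 (\<lambda>x. bump_T x i j $ k) x)"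

lemma bump_G_continuous: "continuous_on UNIV (\<lambda>x. bump_G x $ i)"
  by (rule GDERIV_imp_continuous_on[OF has_hessianD(2)[OF has_hessian_bump]])

lemma bump_H_continuous: "continuous_on UNIV (\<lambda>x. bump_H x $ i $ j)"
  by (rule GDERIV_imp_continuous_on[OF has_third_bump[unfolded has_third_def, rule_format]])

lemma has_hessian_kern: "has_hessian kern kern_G kern_H"
proof -
  have 1: "GDERIV kern x :> kern_G x" for x :: "real^'n"
    unfolding kern_def kern_G_def
    using GDERIV_scale_int[OF has_hessianD(1)[OF has_hessian_bump] bump_G_continuous, where m = 0 and x = x] by simp
  have 2: "GDERIV (\<lambda>x. kern_G x $ i) x :> kern_H x $ i" for x :: "real^'n" and i
  proof -
    have "GDERIV (scale_int 1 (\<lambda>x. bump_G x $ i)) x :> (\<chi> j. scale_int (Suc 1) (\<lambda>x. bump_H x $ i $ j) x)"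
      by (intro GDERIV_scale_int has_hessianD(2)[OF has_hessian_bump] bump_H_continuous)
    then show ?thesis by (simp add: kern_H_def kern_G_def numeral_2_eq_2)
  qed
  show ?thesis unfolding has_hessian_def using 1 2 by blast
qed

lemma has_third_kern: "has_third kern_H kern_T"
  unfolding has_third_def
proof (intro allI)
  fix x :: "real^'n" and i j :: 'n
  have "GDERIV (scale_int 2 (\<lambda>x. bump_H x $ i $ j)) x :>
      (\<chi> k. scale_int (Suc 2) (\<lambda>x. bump_T x i j $ k) x)"
    by (rule GDERIV_scale_int) (use has_third_bump in \<open>auto simp: has_third_def intro!: continuous_on_component bump_T_continuous\<close>)
  then show "GDERIV (\<lambda>x. kern_H x $ i $ j) x :> kern_T x i j"
    by (simp add: kern_H_def kern_T_def numeral_eq_Suc)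
qed

text \<open>Inherited from the visible symmetry of \<open>bump_H\<close>, with no appeal to equality
  of mixed partial derivatives. Together with \<open>kern_T_sym\<close> it feeds the integration by
  parts that compares Hessian and Laplacian.\<close>

lemma kern_H_sym: "kern_H x $ i $ j = kern_H x $ j $ i"
proof -
  have "(\<lambda>x. bump_H x $ i $ j) = (\<lambda>x. bump_H x $ j $ i)" by (auto simp: bump_H_def)
  then show ?thesis by (simp add: kern_H_def)
qed

lemma kern_T_sym: "kern_T x i j $ k = kern_T x i k $ j"
proof -
  have "(\<lambda>x. bump_T x i j $ k) = (\<lambda>x. bump_T x i k $ j)" by (auto simp: bump_T_def)
  then show ?thesis by (simp add: kern_T_def)
qed

lemma kern_eq_0:
  assumes "1 \<le> norm x"
  shows "kern x = 0" "kern_G x = 0" "kern_H x = 0" "kern_T x i j = 0"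
  unfolding kern_def kern_G_def kern_H_def kern_T_def
  using assms by (auto simp: vec_eq_iff bump_derivs_eq_0 bump_eq_0 intro!: scale_int_eq_0)

lemma kern_nonneg: "0 \<le> kern x"
  unfolding kern_def scale_int_def
  by (intro integral_nonneg integrable_continuous_real scale_int_integrand_continuous bump_continuous)
     (auto intro!: mult_nonneg_nonneg divide_nonneg_nonneg bump_nonneg)

lemma scale_int_continuous:
  fixes g :: "real^'n \<Rightarrow> real"
  assumes "continuous_on UNIV g"
  shows "continuous_on UNIV (scale_int m g)"
proof -
  have "continuous_on (UNIV \<times> cbox 1 2) (\<lambda>(x, s). s ^ CARD('n) * s ^ m / s ^ 3 * g (s *\<^sub>R x))"
    unfolding case_prod_beta by (intro continuous_intros continuous_on_compose2[OF assms]) auto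
  from integral_continuous_on_param[OF this] show ?thesis by (simp add: scale_int_def[abs_def])
qed

lemma kern_T_continuous: "continuous_on UNIV (\<lambda>x. kern_T x i j)"
  unfolding kern_T_def
  by (intro continuous_on_vec_lambda scale_int_continuous continuous_on_component bump_T_continuous)

lemma kern_bounds:
  obtains K where "0 \<le> K" "\<And>x::real^'n. \<bar>kern x\<bar> \<le> K" "\<And>x::real^'n. norm (kern_G x) \<le> K"
    "\<And>(x::real^'n) i j. norm (kern_T x i j) \<le> K"
proof -
  have bd: "\<exists>K. \<forall>x. norm (f x) \<le> K"
    if "\<And>x. 1 \<le> norm x \<Longrightarrow> f x = 0" "continuous_on UNIV f"
    for f :: "real^'n \<Rightarrow> 'b::real_normed_vector"
  proof -
    have "continuous_on UNIV (\<lambda>x. norm (f x))" by (intro continuous_intros that)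
    from bounded_of_compact_support[OF this, of 1] that(1) show ?thesis by (metis abs_norm_cancel norm_zero)
  qed
  from bd kern_eq_0 has_hessian_continuous[OF has_hessian_kern]
  obtain K0 K1 where K01: "\<And>x::real^'n. norm (kern x) \<le> K0" "\<And>x::real^'n. norm (kern_G x) \<le> K1"
    by metis
  obtain M where T: "\<And>(x::real^'n) i j. norm (kern_T x i j) \<le> M"
    by (rule third_bounded_of_compact_support[where T = kern_T and R = 1])
      (rule kern_T_continuous, rule kern_eq_0(4), assumption, rule that, assumption)
  let ?K = "Max {0, K0, K1, M}"
  show ?thesis
  proof (rule that[of ?K])
    show "0 \<le> ?K" by simp
  qed (use K01 T in \<open>fastforce simp: le_max_iff_disj\<close>)+
qed

definition chi :: "real^'n \<Rightarrow> real" where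
  "chi x = 10 * bump 4 x"

text \<open>The radius 3/5 is 1/2 + 1/10: half balls will carry the mass, and a tenth of the radius
  is left for mollification. On it \<open>1 - x \<bullet> x\<close> is at least 16/25, and 10 *
  (16/25)^4 exceeds 1. The factor 10 itself comes from the gradient of
  \<open>bump 5\<close>.\<close>

lemma chi_props:
  shows chi_nonneg: "0 \<le> chi x" and chi_le: "chi x \<le> 10" and chi_eq_0: "1 \<le> norm x \<Longrightarrow> chi x = 0"
    and chi_ge_1: "norm x \<le> 3/5 \<Longrightarrow> 1 \<le> chi x"
proof -
  show "0 \<le> chi x" "chi x \<le> 10" using bump_nonneg[of 4 x] bump_le_1[of 4 x] by (auto simp: chi_def)
  show "1 \<le> norm x \<Longrightarrow> chi x = 0" by (simp add: chi_def bump_eq_0)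
  assume "norm x \<le> 3/5"
  then have "(norm x)^2 \<le> (3/5)^2" by (intro power_mono) auto
  then have "16/25 \<le> 1 - x \<bullet> x" by (simp add: dot_square_norm power2_eq_square)
  then have "(16/25)^4 \<le> (max 0 (1 - x \<bullet> x))^4" by (intro power_mono) auto
  moreover have "(1::real) \<le> 10 * (16/25)^4" by (simp add: power_divide)
  ultimately show "1 \<le> chi x" unfolding chi_def bump_def by linarith
qed

lemma kern_laplacian: "trace (kern_H x) = chi x - 2 ^ CARD('n) * chi (2 *\<^sub>R x)" for x :: "real^'n"
proof -
  let ?n = "CARD('n)"
  let ?w = "\<lambda>s::real. s ^ ?n * s ^ 2 / s ^ 3"
  let ?F' = "\<lambda>s. ?w s * (\<Sum>i\<in>UNIV. bump_H (s *\<^sub>R x) $ i $ i)"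
  have tr: "(\<Sum>i\<in>UNIV. bump_H y $ i $ i) = 80 * bump 3 y * (y \<bullet> y) - 10 * real ?n * bump 4 y" for y :: "real^'n"
    by (simp add: bump_H_def sum_subtractf inner_vec_def sum_distrib_left mult.assoc)
  have b4: "GDERIV (bump 4) y :> (- 8 * bump 3 y) *\<^sub>R y" for y :: "real^'n"
    using GDERIV_bump[of 2 y] by (simp add: numeral_eq_Suc)
  have "trace (kern_H x) = (\<Sum>i\<in>UNIV. integral {1..2} (\<lambda>s. ?w s * bump_H (s *\<^sub>R x) $ i $ i))"
    by (simp add: trace_def kern_H_def scale_int_def)
  also have "\<dots> = integral {1..2} ?F'"
    unfolding sum_distrib_left
    by (rule integral_sum[symmetric])
      (auto intro!: integrable_continuous_real simp del: times_divide_eq_left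
        intro: scale_int_integrand_continuous[where g = "\<lambda>x. bump_H x $ i $ i" for i] bump_H_continuous)
  also have "\<dots> = - (2 ^ ?n * chi (2 *\<^sub>R x)) - (- (1 ^ ?n * chi (1 *\<^sub>R x)))"
  proof (intro integral_unique fundamental_theorem_of_calculus)
    fix s :: real assume s: "s \<in> {1..2}"
    have "((\<lambda>s. bump 4 (s *\<^sub>R x)) has_real_derivative x \<bullet> ((- 8 * bump 3 (s *\<^sub>R x)) *\<^sub>R (s *\<^sub>R x))) (at s)"
      using GDERIV_line[where f = "bump 4" and x = 0 and s = s and h = x, unfolded add_0, OF b4] .
    moreover have "x \<bullet> ((- 8 * bump 3 (s *\<^sub>R x)) *\<^sub>R (s *\<^sub>R x)) = - 8 * bump 3 (s *\<^sub>R x) * s * (x \<bullet> x)" by simp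
    ultimately have d: "((\<lambda>s. bump 4 (s *\<^sub>R x)) has_real_derivative - 8 * bump 3 (s *\<^sub>R x) * s * (x \<bullet> x)) (at s)"
      by metis
    have e: "?F' s = - (real ?n * s ^ (?n - 1) * (10 * bump 4 (s *\<^sub>R x)) + s ^ ?n * (10 * (- 8 * bump 3 (s *\<^sub>R x) * s * (x \<bullet> x))))"
    proof -
      obtain m where m: "?n = Suc m" using not0_implies_Suc[of ?n] by auto
      show ?thesis unfolding tr using s by (simp add: m field_simps power2_eq_square power3_eq_cube)
    qed
    have "((\<lambda>s. - (s ^ ?n * chi (s *\<^sub>R x))) has_real_derivative ?F' s) (at s)"
      unfolding chi_def e
      by (rule derivative_eq_intros d refl | simp)+
    then show "((\<lambda>s. - (s ^ ?n * chi (s *\<^sub>R x))) has_vector_derivative ?F' s) (at s within {1..2})"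
      by (simp add: has_real_derivative_iff_has_vector_derivative has_vector_derivative_at_within)
  qed auto
  finally show ?thesis by simp
qed

section \<open>Integration by parts\<close>

lemma compact_support_integrable:
  fixes f :: "'a::euclidean_space \<Rightarrow> 'b::{banach, second_countable_topology}"
  assumes "continuous_on UNIV f" "\<And>x. R \<le> norm x \<Longrightarrow> f x = 0"
  shows "integrable lborel f"
proof -
  have "integrable lborel (\<lambda>x. indicator (cball 0 R) x *\<^sub>R f x)"
    by (intro borel_integrable_compact continuous_on_subset[OF assms(1)]) auto
  moreover have "indicator (cball 0 R) x *\<^sub>R f x = f x" for x
    using assms(2)[of x] by (cases "norm x \<le> R") (auto simp: indicator_def)
  ultimately show ?thesis by simp
qed

lemma lborel_integral_translate:
  fixes f :: "'a::euclidean_space \<Rightarrow> real"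
  assumes "f \<in> borel_measurable borel"
  shows "(LBINT x. f (a + x)) = (LBINT x. f x)"
proof -
  have "(LBINT x. f x) = (\<integral>x. f x \<partial>(distr lborel borel ((+) a)))"
    by (simp add: lborel_distr_plus)
  also have "\<dots> = (LBINT x. f (a + x))"
    using assms by (subst integral_distr) auto
  finally show ?thesis by simp
qed

text \<open>Difference quotients integrate to zero by translation invariance of Lebesgue measure,
  and dominated convergence passes to the derivative. This needs neither iterated integrals nor a
  divergence theorem.\<close>

lemma integral_partial_derivative_eq_0:
  fixes w :: "real^'n \<Rightarrow> real"
  assumes W: "\<And>x. GDERIV w x :> W x" "continuous_on UNIV W"
    and supp: "\<And>x. R \<le> norm x \<Longrightarrow> w x = 0" "\<And>x. R \<le> norm x \<Longrightarrow> W x = 0"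
  shows "(LBINT x. W x $ i) = 0"
proof -
  have wc: "continuous_on UNIV w" by (rule GDERIV_imp_continuous_on[OF W(1)])
  have wm[measurable]: "w \<in> borel_measurable borel" by (rule borel_measurable_continuous_onI[OF wc])
  have wi: "integrable lborel w" by (rule compact_support_integrable[OF wc supp(1)])
  have "continuous_on UNIV (\<lambda>x. norm (W x))" by (intro continuous_intros W(2))
  then obtain K where "0 \<le> K" and K: "\<And>x. \<bar>norm (W x)\<bar> \<le> K"
    by (rule bounded_of_compact_support[where R = R]) (use supp(2) in auto)
  define e :: "real^'n" where "e = axis i 1"
  define h where "h k = 1 / real (Suc k)" for k
  have h: "0 < h k" "h k \<le> 1" for k by (auto simp: h_def)
  define F where "F k x = (w (h k *\<^sub>R e + x) - w x) / h k" for k x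
  have hw: "integrable lborel (\<lambda>x. w (h k *\<^sub>R e + x))" for k
    by (rule compact_support_integrable[where R = "R + 1"])
      (use h(2)[of k] h(1)[of k] in \<open>auto intro!: continuous_intros continuous_on_compose2[OF wc] supp(1)
         intro: order_trans[OF _ norm_diff_ineq] simp: e_def norm_axis_1 add.commute\<close>)
  have Fi: "(LBINT x. F k x) = 0" for k
    unfolding F_def using hw wi by (simp add: lborel_integral_translate)
  have "(\<lambda>k. LBINT x. F k x) \<longlonglongrightarrow> (LBINT x. W x $ i)"
  \<comment> \<open>The quotients are bounded by the gradient bound \<open>K\<close>; since all
    steps \<open>h k\<close> are at most 1, they vanish outside radius \<open>R + 1\<close>.\<close>
  proof (rule integral_dominated_convergence[where w = "\<lambda>x. K * indicat_real (cball 0 (R + 1)) x"])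
    show "(\<lambda>x. W x $ i) \<in> borel_measurable lborel"
      using borel_measurable_continuous_onI[of "\<lambda>x. W x $ i"] W(2)
      by (simp add: continuous_on_component)
    show "F k \<in> borel_measurable lborel" for k unfolding F_def by measurable
    show "integrable lborel (\<lambda>x::real^'n. K * indicat_real (cball 0 (R + 1)) x)"
      by (intro integrable_mult_right integrable_real_indicator) (use emeasure_bounded_finite[of "cball (0::real^'n) (R + 1)"] in auto)
    show "AE x in lborel. (\<lambda>k. F k x) \<longlonglongrightarrow> W x $ i"
    proof (intro always_eventually allI)
      fix x
      have "((\<lambda>s. w (x + s *\<^sub>R e)) has_real_derivative (e \<bullet> W x)) (at 0)"
        by (rule GDERIV_line) (simp add: W(1))
      then have "((\<lambda>s. (w (x + s *\<^sub>R e) - w x) / s) \<longlongrightarrow> W x $ i) (at 0)"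
        by (simp add: DERIV_def e_def inner_commute inner_axis)
      moreover have "filterlim h (at 0) sequentially"
        unfolding filterlim_at using h(1) LIMSEQ_inverse_real_of_nat
        by (auto simp: h_def[abs_def] inverse_eq_divide intro!: always_eventually)
      ultimately have "(\<lambda>k. (w (x + h k *\<^sub>R e) - w x) / h k) \<longlonglongrightarrow> W x $ i"
        by (rule filterlim_compose)
      then show "(\<lambda>k. F k x) \<longlonglongrightarrow> W x $ i" by (simp add: F_def add.commute)
    qed
    show "AE x in lborel. norm (F k x) \<le> K * indicat_real (cball 0 (R + 1)) x" for k
    proof (intro always_eventually allI)
      fix x
      have "\<bar>w (h k *\<^sub>R e + x) - w x\<bar> \<le> K * norm (h k *\<^sub>R e + x - x)"
        by (rule GDERIV_bound_imp_lipschitz[OF W(1)]) (use K in auto)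
      then have *: "norm (F k x) \<le> K"
        using h(1)[of k] by (simp add: F_def e_def norm_axis_1 divide_simps)
      show "norm (F k x) \<le> K * indicat_real (cball 0 (R + 1)) x"
      proof (cases "norm x \<le> R + 1")
        case False
        have "norm (h k *\<^sub>R e) \<le> 1" using h[of k] by (simp add: e_def norm_axis_1)
        then have "R \<le> norm (h k *\<^sub>R e + x)"
          using norm_triangle_ineq2[of x "- (h k *\<^sub>R e)"] False by (simp add: add.commute)
        then show ?thesis using False supp(1) by (simp add: F_def)
      qed (use * in auto)
    qed
  qed
  with Fi show ?thesis by (simp add: LIMSEQ_const_iff)
qed

lemma integral_by_parts_partial:
  fixes f g :: "real^'n \<Rightarrow> real"
  assumes F: "\<And>x. GDERIV f x :> F x" "continuous_on UNIV F"
    and G: "\<And>x. GDERIV g x :> G x" "continuous_on UNIV G"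
    and supp: "\<And>x. R \<le> norm x \<Longrightarrow> f x = 0" "\<And>x. R \<le> norm x \<Longrightarrow> F x = 0"
  shows "(LBINT x. f x * G x $ i) = - (LBINT x. F x $ i * g x)"
proof -
  have fc: "continuous_on UNIV f" "continuous_on UNIV g"
    using GDERIV_imp_continuous_on F(1) G(1) by blast+
  have "(LBINT x. (f x *\<^sub>R G x + g x *\<^sub>R F x) $ i) = 0"
    by (rule integral_partial_derivative_eq_0[where w = "\<lambda>x. f x * g x" and R = R])
      (use supp in \<open>auto intro!: GDERIV_mult F G continuous_intros fc\<close>)
  moreover have "integrable lborel (\<lambda>x. f x * G x $ i)" "integrable lborel (\<lambda>x. F x $ i * g x)"
    by (rule compact_support_integrable[where R = R];
      use supp in \<open>auto intro!: continuous_intros fc F G continuous_on_component\<close>)+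
  ultimately show ?thesis by (simp add: mult.commute)
qed

text \<open>Integrating by parts in direction \<open>j\<close> turns \<open>H_ii * H_jj\<close> into
  minus \<open>G_j\<close> times the third derivative \<open>iij\<close>; by symmetry of that
  derivative, integrating back in direction \<open>i\<close> gives \<open>H_ij * H_ij\<close>. This
  is how control of the Laplacian yields mean-square control of the full Hessian.\<close>

lemma integral_hessian_square:
  fixes p :: "real^'n \<Rightarrow> real"
  assumes hess: "has_hessian p G H" and third: "has_third H T"
    and Tc: "\<And>i j. continuous_on UNIV (\<lambda>x. T x i j)"
    and sym: "\<And>x i j k. T x i j $ k = T x i k $ j" "\<And>x i j. H x $ i $ j = H x $ j $ i"
    and supp: "\<And>x. R \<le> norm x \<Longrightarrow> G x = 0" "\<And>x. R \<le> norm x \<Longrightarrow> H x = 0"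
  shows "(LBINT x. (\<Sum>i\<in>UNIV. \<Sum>j\<in>UNIV. (H x $ i $ j)^2)) = (LBINT x. (trace (H x))^2)"
proof -
  have Hc: "continuous_on UNIV (\<lambda>x. H x $ i $ j)" "continuous_on UNIV (\<lambda>x. H x $ i)" for i j
    by (intro continuous_on_component has_third_continuous[OF third])+
  have int: "integrable lborel (\<lambda>x. H x $ i $ j * H x $ k $ l)" for i j k l
    by (rule compact_support_integrable[where R = R]) (use supp in \<open>auto intro!: continuous_intros Hc\<close>)
  have eq: "(LBINT x. H x $ i $ i * H x $ j $ j) = (LBINT x. H x $ i $ j * H x $ i $ j)" for i j
  proof -
    have bp: "(LBINT x. G x $ j * T x i k $ l) = - (LBINT x. H x $ j $ l * H x $ i $ k)" for k l
      by (rule integral_by_parts_partial[where R = R])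
        (use third supp in \<open>auto simp: has_third_def intro!: has_hessianD(2)[OF hess] Hc Tc\<close>)
    have "(LBINT x. H x $ j $ j * H x $ i $ i) = (LBINT x. H x $ j $ i * H x $ i $ j)"
      using bp[of i j] bp[of j i] by (simp add: sym(1)[of _ i i j])
    then show ?thesis by (simp add: sym(2)[of _ j i] mult.commute)
  qed
  have "(LBINT x. (trace (H x))^2) = (LBINT x. (\<Sum>i\<in>UNIV. \<Sum>j\<in>UNIV. H x $ i $ i * H x $ j $ j))"
    by (simp add: trace_def power2_eq_square sum_product)
  also have "\<dots> = (\<Sum>i\<in>UNIV. \<Sum>j\<in>UNIV. (LBINT x. H x $ i $ i * H x $ j $ j))"
    by (simp add: Bochner_Integration.integral_sum Bochner_Integration.integrable_sum int)
  also have "\<dots> = (\<Sum>i\<in>UNIV. \<Sum>j\<in>UNIV. (LBINT x. H x $ i $ j * H x $ i $ j))"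
    by (intro sum.cong refl eq)
  also have "\<dots> = (LBINT x. (\<Sum>i\<in>UNIV. \<Sum>j\<in>UNIV. H x $ i $ j * H x $ i $ j))"
    by (simp add: Bochner_Integration.integral_sum Bochner_Integration.integrable_sum int)
  finally show ?thesis by (simp add: power2_eq_square)
qed

section \<open>The multiscale potential of a family of balls\<close>

lemma hessian_entry_lipschitz:
  assumes "has_third H T" "\<And>x i j. norm (T x i j) \<le> B"
  shows "\<bar>H y $ i $ j - H x $ i $ j\<bar> \<le> B * norm (y - x)"
  using assms by (intro GDERIV_bound_imp_lipschitz[where f = "\<lambda>x. H x $ i $ j" and G = "\<lambda>x. T x i j"])
    (auto simp: has_third_def)

lemma hessian_lipschitz:
  fixes H :: "real^'n \<Rightarrow> real^'n^'n"
  assumes "has_third H T" "\<And>x i j. norm (T x i j) \<le> B"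
  shows "norm (H y - H x) \<le> real (CARD('n) * CARD('n)) * (B * norm (y - x))"
  using hessian_entry_lipschitz[OF assms] by (intro norm_entries_le) auto

lemma geometric_tail_le:
  fixes q :: real
  assumes "0 \<le> q" "q \<le> 1/2" "m \<le> N"
  shows "(\<Sum>k=m..<N. q ^ k) \<le> 2 * q ^ m"
proof -
  have "(\<Sum>k=m..<N. q ^ k) = (\<Sum>k<N - m. q ^ (k + m))"
    using assms(3) by (intro sum.reindex_bij_witness[of _ "\<lambda>k. k + m" "\<lambda>k. k - m"]) auto
  also have "\<dots> = q ^ m * (\<Sum>k<N - m. q ^ k)" by (simp add: power_add sum_distrib_left mult.commute)
  also have "q ^ m * (\<Sum>k<N - m. q ^ k) \<le> q ^ m * 2"
  proof (intro mult_left_mono)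
    have "(\<Sum>k<N - m. q ^ k) = (1 - q ^ (N - m)) / (1 - q)"
      using assms sum_gp_strict[of q "N - m"] by auto
    also have "\<dots> \<le> 1 / (1/2)" using assms by (intro frac_le) auto
    finally show "(\<Sum>k<N - m. q ^ k) \<le> 2" by simp
  qed (use assms in auto)
  finally show ?thesis by simp
qed

lemma geometric_two_le: "(\<Sum>k<m. (2::real) ^ k) \<le> 2 ^ m"
  by (induction m) auto

text \<open>Split the layers at the scale where (1/2)^m is comparable to \<open>norm h\<close>. The
  Hessian of the coarse sum is bounded by \<open>\<Lambda>\<close> at \<open>x0\<close> and varies
  by at most \<open>A\<close> per entry over the distance \<open>norm h\<close>, so Taylor applies.
  The fine layers are nonnegative at \<open>x0 + h\<close> and may be dropped there, while at
  \<open>x0\<close> their values and gradients cost at most 8 A and 4 A times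
  \<open>(norm h)^2\<close>, whence 24 A / 2. Dropping the fine layers at \<open>x0 + h\<close> is
  what makes the estimate one-sided.\<close>

lemma multiscale_touch:
  fixes u :: "nat \<Rightarrow> real^'n \<Rightarrow> real"
  assumes hess: "\<And>k. has_hessian (u k) (G k) (H k)" and third: "\<And>k. has_third (H k) (T k)"
    and A: "0 \<le> A" "\<And>k x. 0 \<le> u k x" "\<And>k x. u k x \<le> A * (1/4) ^ k"
      "\<And>k x. norm (G k x) \<le> A * (1/2) ^ k" "\<And>k x i j. norm (T k x i j) \<le> A * 2 ^ k"
    and Lam: "\<And>m. m \<le> N \<Longrightarrow> norm (\<Sum>k<m. H k x0) \<le> \<Lambda>"
  shows "(\<Sum>k<N. u k x0) + h \<bullet> (\<Sum>k<N. G k x0)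
      - (24 * A + \<Lambda> + real (CARD('n) * CARD('n)) * A) / 2 * (norm h)^2 \<le> (\<Sum>k<N. u k (x0 + h))"
proof -
  let ?n2 = "real (CARD('n) * CARD('n))"
  obtain m where m: "m \<le> N" "m = 0 \<or> norm h \<le> (1/2) ^ m" "m = N \<or> (1/2) ^ m \<le> 2 * norm h"
  proof (cases "norm h \<le> (1/2) ^ N")
    case True then show ?thesis using that[of N] by auto
  next
    case False
    define P where "P = (\<lambda>m. (1/2) ^ Suc m < norm h)"
    have N: "N = 0 \<or> P (N - 1)" using False by (cases N) (auto simp: P_def)
    show ?thesis
    proof (cases "N = 0")
      case True then show ?thesis using that[of 0] by auto
    next
      case N0: False
      then have PN: "P (N - 1)" using N by auto
      define m where "m = (LEAST m. P m)"
      have "P m" unfolding m_def by (rule LeastI[of P, OF PN])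
      moreover have "m \<le> N - 1" unfolding m_def by (rule Least_le[of P, OF PN])
      moreover have "m = 0 \<or> \<not> P (m - 1)"
        using not_less_Least[of "m - 1" P] by (cases m) (auto simp: m_def)
      ultimately show ?thesis using that[of m] by (cases m) (auto simp: P_def)
    qed
  qed
  have \<Lambda>0: "0 \<le> \<Lambda>" using Lam[of 0] by simp
  let ?L = "\<Lambda> + ?n2 * A"
  have q: "(\<Sum>k<m. u k x0) + h \<bullet> (\<Sum>k<m. G k x0) - ?L / 2 * (norm h)^2 \<le> (\<Sum>k<m. u k (x0 + h))"
  proof (cases "m = 0")
    case True then show ?thesis using \<Lambda>0 A(1) by simp
  next
    case False
    then have hm: "norm h \<le> (1/2) ^ m" using m(2) by auto
    have th: "has_third (\<lambda>x. \<Sum>k<m. H k x) (\<lambda>x i j. \<Sum>k<m. T k x i j)"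
      by (rule has_third_sum) (rule third)
    have Tb: "norm (\<Sum>k<m. T k x i j) \<le> A * 2 ^ m" for x i j
    proof -
      have "norm (\<Sum>k<m. T k x i j) \<le> (\<Sum>k<m. A * 2 ^ k)" by (intro sum_norm_le A(5))
      also have "\<dots> \<le> A * 2 ^ m"
        unfolding sum_distrib_left[symmetric] by (intro mult_left_mono geometric_two_le A(1))
      finally show ?thesis .
    qed
    have "- ?L * (norm h)^2 \<le> h \<bullet> ((\<Sum>k<m. H k (x0 + s *\<^sub>R h)) *v h)" if s: "0 \<le> s" "s \<le> 1" for s
    proof -
      have "norm ((\<Sum>k<m. H k (x0 + s *\<^sub>R h)) - (\<Sum>k<m. H k x0)) \<le> ?n2 * (A * 2 ^ m * norm (s *\<^sub>R h))"
        using hessian_lipschitz[OF th Tb, of "x0 + s *\<^sub>R h" x0] by simp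
      also have "\<dots> \<le> ?n2 * (A * 2 ^ m * (1/2) ^ m)"
      proof (intro mult_left_mono)
        show "norm (s *\<^sub>R h) \<le> (1/2) ^ m"
          using s hm mult_mono[of "\<bar>s\<bar>" 1 "norm h" "(1/2) ^ m"] by simp
      qed (use A(1) in auto)
      also have "\<dots> = ?n2 * A" by (simp add: power_divide)
      finally have "norm (\<Sum>k<m. H k (x0 + s *\<^sub>R h)) \<le> ?L"
        using Lam[OF m(1)] norm_triangle_ineq2[of "\<Sum>k<m. H k (x0 + s *\<^sub>R h)" "\<Sum>k<m. H k x0"] by linarith
      from mult_right_mono[OF this zero_le_power2, of "norm h"] abs_quad_le[of h "\<Sum>k<m. H k (x0 + s *\<^sub>R h)"]
      show ?thesis unfolding mult_minus_left by linarith
    qed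
    from has_hessian_taylor_lower[OF has_hessian_sum[OF hess], where x = x0 and h = h and c = "- ?L * (norm h)^2", OF this]
    show ?thesis by (simp add: field_simps)
  qed
  have split: "(\<Sum>k<N. f k) = (\<Sum>k<m. f k) + (\<Sum>k=m..<N. f k)" for f :: "nat \<Rightarrow> 'b::real_normed_vector"
    using sum.atLeastLessThan_concat[of 0 m N f] m(1) by (simp add: atLeast0LessThan)
  have geo: "m < N \<longrightarrow> (1/2) ^ m \<le> 2 * norm h" using m(3) by auto
  have t0: "(\<Sum>k=m..<N. u k x0) \<le> 8 * A * (norm h)^2"
  proof (cases "m < N")
    case True
    have "(\<Sum>k=m..<N. u k x0) \<le> A * (\<Sum>k=m..<N. (1/4) ^ k)"
      unfolding sum_distrib_left by (intro sum_mono A(3))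
    also have "\<dots> \<le> A * (2 * (1/4) ^ m)"
      using m(1) by (intro mult_left_mono geometric_tail_le A(1)) auto
    also have "(1/4::real) ^ m = ((1/2) ^ m)^2" by (simp add: power_mult[symmetric] power2_eq_square power_mult_distrib[symmetric])
    also have "A * (2 * ((1/2) ^ m)^2) \<le> A * (2 * (2 * norm h)^2)"
      using geo True by (intro mult_left_mono power_mono A(1)) auto
    finally show ?thesis by (simp add: power_mult_distrib)
  qed (use m(1) A(1) in auto)
  have t1: "h \<bullet> (\<Sum>k=m..<N. G k x0) \<le> 4 * A * (norm h)^2"
  proof (cases "m < N")
    case True
    have "norm (\<Sum>k=m..<N. G k x0) \<le> (\<Sum>k=m..<N. A * (1/2) ^ k)" by (intro sum_norm_le A(4))
    also have "\<dots> = A * (\<Sum>k=m..<N. (1/2) ^ k)" by (simp add: sum_distrib_left)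
    also have "\<dots> \<le> A * (2 * (1/2) ^ m)"
      using m(1) by (intro mult_left_mono geometric_tail_le A(1)) auto
    also have "\<dots> \<le> A * (2 * (2 * norm h))"
      using geo True by (intro mult_left_mono A(1)) auto
    finally have "norm h * norm (\<Sum>k=m..<N. G k x0) \<le> norm h * (A * (2 * (2 * norm h)))"
      by (intro mult_left_mono) auto
    then show ?thesis using norm_cauchy_schwarz[of h "\<Sum>k=m..<N. G k x0"]
      by (simp add: power2_eq_square ac_simps)
  qed (use m(1) A(1) in auto)
  have t2: "0 \<le> (\<Sum>k=m..<N. u k (x0 + h))" by (intro sum_nonneg A(2))
  show ?thesis
    unfolding split inner_add_right using q t0 t1 t2 by (simp add: field_simps)
qed

lemma ball_fmeasurable: "ball z r \<in> fmeasurable lborel" for z :: "'a::euclidean_space"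
  by (intro fmeasurableI) (use emeasure_bounded_finite[of "ball z r"] in auto)

lemma norm_scaleR_simps:
  fixes v :: "'a::real_normed_vector"
  shows one_le_norm_pow2: "1 \<le> norm (2 ^ k *\<^sub>R v) \<longleftrightarrow> (1/2) ^ k \<le> norm v"
    and norm_pow2_le: "norm (2 ^ k *\<^sub>R v) \<le> c \<longleftrightarrow> norm v \<le> c * (1/2) ^ k"
    and one_le_norm_inverse: "0 < r \<Longrightarrow> 1 \<le> norm ((1 / r) *\<^sub>R v) \<longleftrightarrow> r \<le> norm v"
    and norm_inverse_le: "0 < r \<Longrightarrow> norm ((1 / r) *\<^sub>R v) \<le> c \<longleftrightarrow> norm v \<le> c * r"
  by (simp_all add: field_simps)

text \<open>A packing argument. Only centres within (1/2)^k of \<open>x\<close> contribute, their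
  disjoint balls have radius at most (1/2)^k and so lie in a ball of twice that radius. The sum of
  \<open>r ^ n\<close> is thus at most \<open>2 ^ n\<close> times the volume factor that
  \<open>2 ^ (k * CARD('n))\<close> cancels.\<close>

lemma kern_bound_scaled:
  fixes \<phi> :: "real^'n \<Rightarrow> 'b::real_normed_vector" and J :: "(real^'n) set"
  assumes "finite J" and sep: "\<And>x y. x \<in> J \<Longrightarrow> y \<in> J \<Longrightarrow> x \<noteq> y \<Longrightarrow> 2 * (1/2) ^ \<kappa> x + 2 * (1/2) ^ \<kappa> y \<le> dist x y"
    and \<phi>: "\<And>y. norm (\<phi> y) \<le> K" "\<And>y. 1 \<le> norm y \<Longrightarrow> \<phi> y = 0"
  shows "norm (\<Sum>j\<in>{j\<in>J. k \<le> \<kappa> j}. (((1/2) ^ \<kappa> j) ^ CARD('n) * 2 ^ (k * CARD('n))) *\<^sub>R \<phi> (2 ^ k *\<^sub>R (x - j))) \<le> 2 ^ CARD('n) * K"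
proof -
  let ?n = "CARD('n)" and ?\<omega> = "unit_ball_vol CARD('n)"
  let ?r = "\<lambda>j. (1/2::real) ^ \<kappa> j"
  have K: "0 \<le> K" using \<phi>(1)[of 0] norm_ge_zero order_trans by blast
  let ?I = "{j\<in>J. k \<le> \<kappa> j \<and> norm (x - j) < (1/2) ^ k}"
  have fin: "finite ?I" using assms(1) by auto
  have "(\<Sum>j\<in>?I. ?\<omega> * ?r j ^ ?n) = (\<Sum>j\<in>?I. measure lborel (ball j (?r j)))"
    by (simp add: content_ball)
  also have "\<dots> = measure lborel (\<Union>j\<in>?I. ball j (?r j))"
  proof (rule measure_finite_Union[symmetric])
    show "disjoint_family_on (\<lambda>j. ball j (?r j)) ?I"
      unfolding disjoint_family_on_def
    proof (intro ballI impI)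
      fix a b assume "a \<in> ?I" "b \<in> ?I" "a \<noteq> b"
      then have "2 * ?r a + 2 * ?r b \<le> dist a b" by (auto intro: sep)
      moreover have "0 < ?r a" "0 < ?r b" by auto
      ultimately show "ball a (?r a) \<inter> ball b (?r b) = {}"
        by (intro disjoint_ballI) linarith
    qed
    show "finite ?I" by (rule fin)
  qed (auto intro!: less_imp_neq[OF emeasure_bounded_finite] simp flip: infinity_ennreal_def)
  also have "\<dots> \<le> measure lborel (ball x (2 * (1/2) ^ k))"
  proof (rule measure_mono_fmeasurable)
    show "(\<Union>j\<in>?I. ball j (?r j)) \<subseteq> ball x (2 * (1/2) ^ k)"
    proof
      fix y assume "y \<in> (\<Union>j\<in>?I. ball j (?r j))"
      then obtain j where j: "k \<le> \<kappa> j" "norm (x - j) < (1/2) ^ k" "dist j y < ?r j" by auto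
      have "?r j \<le> (1/2) ^ k" using j(1) by (intro power_decreasing) auto
      then show "y \<in> ball x (2 * (1/2) ^ k)"
        using j dist_triangle[of x y j] unfolding mem_ball dist_norm by linarith
    qed
  qed (use fin in \<open>auto intro: ball_fmeasurable\<close>)
  also have "\<dots> = ?\<omega> * (2 * (1/2) ^ k) ^ ?n" by (simp add: content_ball)
  finally have "?\<omega> * (\<Sum>j\<in>?I. ?r j ^ ?n) \<le> ?\<omega> * (2 * (1/2) ^ k) ^ ?n"
    by (simp add: sum_distrib_left)
  then have cnt: "(\<Sum>j\<in>?I. ?r j ^ ?n) \<le> (2 * (1/2) ^ k) ^ ?n"
    by simp
  have zero: "\<phi> (2 ^ k *\<^sub>R (x - j)) = 0" if "\<not> norm (x - j) < (1/2) ^ k" for j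
    using that by (intro \<phi>(2)) (simp only: one_le_norm_pow2 not_less)
  have "(\<Sum>j\<in>{j\<in>J. k \<le> \<kappa> j}. (?r j ^ ?n * 2 ^ (k * ?n)) *\<^sub>R \<phi> (2 ^ k *\<^sub>R (x - j)))
     = (\<Sum>j\<in>?I. (?r j ^ ?n * 2 ^ (k * ?n)) *\<^sub>R \<phi> (2 ^ k *\<^sub>R (x - j)))"
    using assms(1) by (intro sum.mono_neutral_right) (auto simp: zero)
  also have "norm \<dots> \<le> (\<Sum>j\<in>?I. (?r j ^ ?n * 2 ^ (k * ?n)) * K)"
    by (intro sum_norm_le) (auto intro!: mult_left_mono \<phi>(1))
  also have "\<dots> = 2 ^ (k * ?n) * K * (\<Sum>j\<in>?I. ?r j ^ ?n)"
    by (simp add: sum_distrib_left sum_distrib_right ac_simps)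
  also have "\<dots> \<le> 2 ^ (k * ?n) * K * (2 * (1/2) ^ k) ^ ?n"
    using K by (intro mult_left_mono cnt) auto
  also have "\<dots> = 2 ^ ?n * K"
    by (simp add: power_mult power_mult_distrib power_divide)
  finally show ?thesis .
qed

lemma sum_indicator_disjoint_le_1:
  assumes "finite I" "disjoint_family_on B I"
  shows "(\<Sum>i\<in>I. indicat_real (B i) x) \<le> 1"
proof (cases "\<exists>i\<in>I. x \<in> B i")
  case True
  then obtain i where i: "i \<in> I" "x \<in> B i" by auto
  have "(\<Sum>j\<in>I. indicat_real (B j) x) = (\<Sum>j\<in>{i}. indicat_real (B j) x)"
  proof (rule sum.mono_neutral_right[OF assms(1)])
    show "\<forall>j\<in>I - {i}. indicat_real (B j) x = 0"
    proof
      fix j assume "j \<in> I - {i}"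
      then have "B i \<inter> B j = {}" using assms(2) i(1) unfolding disjoint_family_on_def by blast
      then show "indicat_real (B j) x = 0" using i(2) by (auto simp: indicator_def)
    qed
  qed (use i in auto)
  also have "\<dots> = 1" using i(2) by simp
  finally show ?thesis by simp
next
  case False
  then have "(\<Sum>i\<in>I. indicat_real (B i) x) = 0" by (intro sum.neutral) (auto simp: indicator_def)
  then show ?thesis by simp
qed

text \<open>Balls of dyadic radii \<open>(1/2) ^ \<kappa> j\<close> whose doubles do not overlap.
  \<open>N\<close> bounds all exponents, so summing over \<open>k < N\<close> sees every relevant
  scale. \<open>K\<close> bounds the kernel and its derivatives as well as the Hessian of the bump
  later used as a test function.\<close>

locale ball_family =
  fixes J :: "(real^'n) set" and \<kappa> :: "real^'n \<Rightarrow> nat" and N :: nat and K :: real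
  assumes fin: "finite J" and \<kappa>N: "\<And>j. j \<in> J \<Longrightarrow> \<kappa> j \<le> N"
    and sep: "\<And>x y. x \<in> J \<Longrightarrow> y \<in> J \<Longrightarrow> x \<noteq> y \<Longrightarrow> 2 * (1/2) ^ \<kappa> x + 2 * (1/2) ^ \<kappa> y \<le> dist x y"
    and K: "0 \<le> K" "\<And>x::real^'n. \<bar>kern x\<bar> \<le> K" "\<And>x::real^'n. norm (kern_G x) \<le> K"
    "\<And>(x::real^'n) i j. norm (kern_T x i j) \<le> K"
    "\<And>x::real^'n. norm (bump_H x) \<le> K"
begin

definition rad :: "real^'n \<Rightarrow> real" where "rad j = (1/2) ^ \<kappa> j"

definition A :: real where "A = 2 ^ CARD('n) * K"

definition S :: real where "S = (\<Sum>j\<in>J. rad j ^ CARD('n))"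

definition active :: "nat \<Rightarrow> (real^'n) set" where "active k = {j\<in>J. k < \<kappa> j}"

definition wt :: "nat \<Rightarrow> real^'n \<Rightarrow> real" where "wt k j = rad j ^ CARD('n) * 2 ^ (k * CARD('n))"

text \<open>One dyadic layer of a finite-range substitute for the Newtonian potential of the balls.
  Ball \<open>j\<close> contributes at scales coarser than its radius, weighted by its volume
  relative to a cell of size (1/2)^k; the factors \<open>(1/4) ^ k\<close>,
  \<open>(1/2) ^ k\<close>, 1 and \<open>2 ^ k\<close> record successive differentiation.\<close>

definition u :: "nat \<Rightarrow> real^'n \<Rightarrow> real" where
  "u k x = (\<Sum>j\<in>active k. wt k j * (1/4) ^ k * kern (2 ^ k *\<^sub>R (x - j)))"

definition uG :: "nat \<Rightarrow> real^'n \<Rightarrow> real^'n" where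
  "uG k x = (\<Sum>j\<in>active k. (wt k j * (1/2) ^ k) *\<^sub>R kern_G (2 ^ k *\<^sub>R (x - j)))"

definition uH :: "nat \<Rightarrow> real^'n \<Rightarrow> real^'n^'n" where
  "uH k x = (\<Sum>j\<in>active k. wt k j *\<^sub>R kern_H (2 ^ k *\<^sub>R (x - j)))"

definition uT :: "nat \<Rightarrow> real^'n \<Rightarrow> 'n \<Rightarrow> 'n \<Rightarrow> real^'n" where
  "uT k x a b = (\<Sum>j\<in>active k. (wt k j * 2 ^ k) *\<^sub>R kern_T (2 ^ k *\<^sub>R (x - j)) a b)"

lemma finite_active [simp]: "finite (active k)" using fin by (simp add: active_def)

lemma rad_pos: "0 < rad j" by (simp add: rad_def)
lemma wt_nonneg: "0 \<le> wt k j" using rad_pos[of j] by (simp add: wt_def)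
lemma A_nonneg: "0 \<le> A" using K(1) by (simp add: A_def)
lemma S_nonneg: "0 \<le> S" unfolding S_def using rad_pos by (intro sum_nonneg) (simp add: less_imp_le)

lemma has_hessian_u: "has_hessian (u k) (uG k) (uH k)"
proof -
  have a: "(1/4::real) ^ k * 2 ^ k = (1/2) ^ k" "(1/4::real) ^ k * (2 ^ k)^2 = 1"
    by (simp_all add: power2_eq_square power_mult_distrib[symmetric])
  have "has_hessian (\<lambda>x. wt k j * (1/4) ^ k * kern (2 ^ k *\<^sub>R (x - j)))
      (\<lambda>x. (wt k j * (1/2) ^ k) *\<^sub>R kern_G (2 ^ k *\<^sub>R (x - j)))
      (\<lambda>x. wt k j *\<^sub>R kern_H (2 ^ k *\<^sub>R (x - j)))" for j
    using has_hessian_dilation[OF has_hessian_kern, of "wt k j * (1/4) ^ k" "2 ^ k" j]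
    by (simp only: mult.assoc a mult_1_right)
  then show ?thesis
    unfolding u_def[abs_def] uG_def[abs_def] uH_def[abs_def] by (intro has_hessian_sum)
qed

lemma has_third_u: "has_third (uH k) (uT k)"
  unfolding uT_def[abs_def] uH_def[abs_def]
  by (intro has_third_sum has_third_dilation has_third_kern)

lemma scaled_bound:
  fixes \<phi> :: "real^'n \<Rightarrow> 'b::real_normed_vector"
  assumes "\<And>y. norm (\<phi> y) \<le> K" "\<And>y. 1 \<le> norm y \<Longrightarrow> \<phi> y = 0" "0 \<le> c"
  shows "norm (\<Sum>j\<in>active k. (wt k j * c) *\<^sub>R \<phi> (2 ^ k *\<^sub>R (x - j))) \<le> A * c"
proof -
  \<comment> \<open>The packing bound allows \<open>k \<le> \<kappa> j\<close> while
    \<open>active\<close> is strict; applying it to this subfamily makes the two index sets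
    agree.\<close>
  define J' where "J' = {j\<in>J. k < \<kappa> j}"
  have "{j\<in>J'. k \<le> \<kappa> j} = active k" by (auto simp: active_def J'_def)
  then have "norm (\<Sum>j\<in>active k. wt k j *\<^sub>R \<phi> (2 ^ k *\<^sub>R (x - j))) \<le> A"
    unfolding A_def wt_def rad_def
    using kern_bound_scaled[of J' \<kappa> \<phi> K k x] fin sep assms(1,2) by (auto simp: J'_def)
  moreover have "(\<Sum>j\<in>active k. (wt k j * c) *\<^sub>R \<phi> (2 ^ k *\<^sub>R (x - j)))
     = c *\<^sub>R (\<Sum>j\<in>active k. wt k j *\<^sub>R \<phi> (2 ^ k *\<^sub>R (x - j)))"
    by (simp add: scaleR_sum_right mult.commute)
  ultimately show ?thesis using assms(3) by (simp add: mult.commute mult_left_mono)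
qed

lemma u_bounds:
  shows "0 \<le> u k x" "u k x \<le> A * (1/4) ^ k" "norm (uG k x) \<le> A * (1/2) ^ k"
    "norm (uT k x a b) \<le> A * 2 ^ k"
proof -
  show "0 \<le> u k x" unfolding u_def by (intro sum_nonneg mult_nonneg_nonneg wt_nonneg kern_nonneg) auto
  have "norm (u k x) \<le> A * (1/4) ^ k"
    unfolding u_def
    using scaled_bound[of kern "(1/4) ^ k" k x, OF _ kern_eq_0(1)] K(2) by simp
  then show "u k x \<le> A * (1/4) ^ k" by simp
  show "norm (uG k x) \<le> A * (1/2) ^ k"
    unfolding uG_def by (rule scaled_bound) (auto simp: K kern_eq_0)
  show "norm (uT k x a b) \<le> A * 2 ^ k"
    unfolding uT_def by (rule scaled_bound) (auto simp: K kern_eq_0)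
qed

definition p :: "nat \<Rightarrow> real^'n \<Rightarrow> real" where "p m x = (\<Sum>k<m. u k x)"
definition pG :: "nat \<Rightarrow> real^'n \<Rightarrow> real^'n" where "pG m x = (\<Sum>k<m. uG k x)"
definition pH :: "nat \<Rightarrow> real^'n \<Rightarrow> real^'n^'n" where "pH m x = (\<Sum>k<m. uH k x)"
definition pT :: "nat \<Rightarrow> real^'n \<Rightarrow> 'n \<Rightarrow> 'n \<Rightarrow> real^'n" where "pT m x a b = (\<Sum>k<m. uT k x a b)"

lemma has_hessian_p: "has_hessian (p m) (pG m) (pH m)"
  unfolding p_def[abs_def] pG_def[abs_def] pH_def[abs_def] by (intro has_hessian_sum has_hessian_u)

lemma has_third_p: "has_third (pH m) (pT m)"
  unfolding pT_def[abs_def] pH_def[abs_def] by (intro has_third_sum has_third_u)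

lemma pT_continuous: "continuous_on UNIV (\<lambda>x. pT m x a b)"
  unfolding pT_def uT_def
  by (intro continuous_intros continuous_on_compose2[OF kern_T_continuous]) auto

lemma pT_bound: "norm (pT m x a b) \<le> A * 2 ^ m"
proof -
  have "norm (pT m x a b) \<le> (\<Sum>k<m. A * 2 ^ k)" unfolding pT_def by (intro sum_norm_le u_bounds)
  also have "\<dots> \<le> A * 2 ^ m"
    unfolding sum_distrib_left[symmetric] by (intro mult_left_mono geometric_two_le A_nonneg)
  finally show ?thesis .
qed

lemma p_sym: "pT m x a b $ c = pT m x a c $ b" "pH m x $ a $ b = pH m x $ b $ a"
  unfolding pT_def uT_def pH_def uH_def
  by (simp_all add: kern_T_sym[of _ a b c] kern_H_sym[of _ a b])

lemma p_nonneg: "0 \<le> p m x" unfolding p_def by (intro sum_nonneg u_bounds)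

lemma p_diff_bounds:
  assumes "m \<le> M"
  shows "0 \<le> p M x - p m x" "p M x - p m x \<le> 2 * A * (1/4) ^ m"
proof -
  have e: "p M x - p m x = (\<Sum>k=m..<M. u k x)"
    using sum.atLeastLessThan_concat[of 0 m M "\<lambda>k. u k x"] assms by (simp add: p_def atLeast0LessThan)
  show "0 \<le> p M x - p m x" unfolding e by (intro sum_nonneg u_bounds)
  have "(\<Sum>k=m..<M. u k x) \<le> A * (\<Sum>k=m..<M. (1/4) ^ k)"
    unfolding sum_distrib_left by (intro sum_mono u_bounds)
  also have "\<dots> \<le> A * (2 * (1/4) ^ m)"
    by (intro mult_left_mono geometric_tail_le A_nonneg assms) auto
  finally show "p M x - p m x \<le> 2 * A * (1/4) ^ m" unfolding e by simp
qed

lemma p_support: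
  obtains R where "\<And>m x. R \<le> norm x \<Longrightarrow> p m x = 0" "\<And>m x. R \<le> norm x \<Longrightarrow> pG m x = 0"
    "\<And>m x. R \<le> norm x \<Longrightarrow> pH m x = 0"
proof -
  obtain R where R: "\<And>j. j \<in> J \<Longrightarrow> norm j \<le> R"
    using finite_imp_bounded[OF fin] by (auto simp: bounded_iff)
  have *: "1 \<le> norm (2 ^ k *\<^sub>R (x - j))" if "R + 1 \<le> norm x" "j \<in> active k" for x j k
  proof -
    have "1 \<le> norm (x - j)"
      using that R[of j] norm_triangle_ineq2[of x j] by (auto simp: active_def)
    then show ?thesis
      unfolding one_le_norm_pow2 using power_le_one[of "1/2::real" k] by linarith
  qed
  show ?thesis
    by (rule that[of "R + 1"])
      (auto simp: p_def pG_def pH_def u_def uG_def uH_def kern_eq_0[OF *] intro!: sum.neutral)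
qed

text \<open>The first \<open>M\<close> layers are each O(S) with a constant depending on
  \<open>M\<close>, and the remaining layers form a geometric tail independent of S. Because
  \<open>M\<close> is free, one fixes it first to shrink the tail and only then asks for small
  S.\<close>

lemma p_small: "p N x \<le> real M * K * 2 ^ (M * CARD('n)) * S + 2 * A * (1/4) ^ M"
proof -
  have uk: "u k x \<le> K * 2 ^ (M * CARD('n)) * S" if "k < M" for k
  proof -
    have "u k x \<le> (\<Sum>j\<in>active k. rad j ^ CARD('n) * 2 ^ (M * CARD('n)) * 1 * K)"
      unfolding u_def wt_def
    proof (intro sum_mono mult_mono)
      show "kern (2 ^ k *\<^sub>R (x - j)) \<le> K" for j using K(2)[of "2 ^ k *\<^sub>R (x - j)"] by linarith
      show "(2::real) ^ (k * CARD('n)) \<le> 2 ^ (M * CARD('n))" using that by (intro power_increasing mult_right_mono) auto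
    qed (use rad_pos in \<open>auto intro: power_le_one kern_nonneg less_imp_le\<close>)
    also have "\<dots> \<le> (\<Sum>j\<in>J. rad j ^ CARD('n) * 2 ^ (M * CARD('n)) * 1 * K)"
      by (rule sum_mono2) (use fin K(1) rad_pos in \<open>auto simp: active_def less_imp_le\<close>)
    finally show ?thesis by (simp add: S_def sum_distrib_left ac_simps)
  qed
  have pM: "p M x \<le> real M * (K * 2 ^ (M * CARD('n)) * S)"
    unfolding p_def using sum_bounded_above[of "{..<M}" "\<lambda>k. u k x", OF uk] by simp
  show ?thesis
  proof (cases "M \<le> N")
    case True then show ?thesis using pM p_diff_bounds(2)[OF True, of x] by simp
  next
    case False
    then have "p N x \<le> p M x" using p_diff_bounds(1)[of N M x] by auto
    moreover have "0 \<le> 2 * A * (1/4) ^ M" using A_nonneg by simp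
    ultimately show ?thesis using pM by simp
  qed
qed

text \<open>The layers of each ball telescope from unit scale down to its own radius, where the
  weight \<open>rad j ^ n * 2 ^ (\<kappa> j * n)\<close> has become 1. What remains is a negative
  bump on the ball, compensated by the same total mass spread thinly over unit distance.\<close>

lemma p_laplacian: "trace (pH N x) = (\<Sum>j\<in>J. rad j ^ CARD('n) * chi (x - j)) - (\<Sum>j\<in>J. chi ((1 / rad j) *\<^sub>R (x - j)))"
proof -
  let ?a = "\<lambda>j k. rad j ^ CARD('n) * 2 ^ (k * CARD('n)) * chi (2 ^ k *\<^sub>R (x - j))"
  have tr_sum: "trace (\<Sum>k\<in>I. f k) = (\<Sum>k\<in>I. trace (f k))" for I and f :: "'c \<Rightarrow> real^'n^'n"
    by (simp add: trace_def sum_component) (rule sum.swap)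
  have tr_scale: "trace (c *\<^sub>R B) = c * trace B" for c and B :: "real^'n^'n"
    by (simp add: trace_def sum_distrib_left)
  have t: "wt k j * trace (kern_H (2 ^ k *\<^sub>R (x - j))) = ?a j k - ?a j (Suc k)" for j k
    by (simp add: kern_laplacian wt_def algebra_simps power_add)
  have "trace (pH N x) = (\<Sum>k<N. \<Sum>j\<in>J. if k < \<kappa> j then ?a j k - ?a j (Suc k) else 0)"
    unfolding pH_def uH_def tr_sum tr_scale t active_def using fin by (intro sum.cong sum.inter_filter refl)
  also have "\<dots> = (\<Sum>j\<in>J. \<Sum>k<N. if k < \<kappa> j then ?a j k - ?a j (Suc k) else 0)"
    by (rule sum.swap)
  also have "\<dots> = (\<Sum>j\<in>J. rad j ^ CARD('n) * chi (x - j) - chi ((1 / rad j) *\<^sub>R (x - j)))"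
  proof (rule sum.cong[OF refl])
    fix j assume j: "j \<in> J"
    have "(\<Sum>k<N. if k < \<kappa> j then ?a j k - ?a j (Suc k) else 0) = (\<Sum>k\<in>{k\<in>{..<N}. k < \<kappa> j}. ?a j k - ?a j (Suc k))"
      by (intro sum.inter_filter[symmetric]) auto
    also have "{k\<in>{..<N}. k < \<kappa> j} = {..<\<kappa> j}" using \<kappa>N[OF j] by auto
    also have "(\<Sum>k<\<kappa> j. ?a j k - ?a j (Suc k)) = ?a j 0 - ?a j (\<kappa> j)"
      by (rule sum_lessThan_telescope')
    also have "rad j ^ CARD('n) * 2 ^ (\<kappa> j * CARD('n)) = 1"
      by (simp add: rad_def power_mult[symmetric] power_mult_distrib[symmetric])
    also have "(2::real) ^ \<kappa> j = 1 / rad j" by (simp add: rad_def power_divide)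
    finally show "(\<Sum>k<N. if k < \<kappa> j then ?a j k - ?a j (Suc k) else 0)
       = rad j ^ CARD('n) * chi (x - j) - chi ((1 / rad j) *\<^sub>R (x - j))" by simp
  qed
  finally show ?thesis by (simp add: sum_subtractf)
qed

lemma chi_scaled_le_indicator: "chi ((1 / rad j) *\<^sub>R (x - j)) \<le> 10 * indicat_real (ball j (rad j)) x"
proof (cases "x \<in> ball j (rad j)")
  case False
  then have "1 \<le> norm ((1 / rad j) *\<^sub>R (x - j))"
    unfolding one_le_norm_inverse[OF rad_pos] by (simp add: dist_norm norm_minus_commute)
  then show ?thesis by (simp add: chi_eq_0)
qed (simp add: chi_le)

lemma balls_disjoint: "disjoint_family_on (\<lambda>j. ball j (rad j)) J"
  unfolding disjoint_family_on_def
proof (intro ballI impI)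
  fix a b assume "a \<in> J" "b \<in> J" "a \<noteq> b"
  then have "2 * rad a + 2 * rad b \<le> dist a b" unfolding rad_def by (auto intro: sep)
  then show "ball a (rad a) \<inter> ball b (rad b) = {}"
    using rad_pos[of a] rad_pos[of b] by (intro disjoint_ballI) linarith
qed

text \<open>The spread-out part is at most \<open>10 * S\<close>, and the concentrated part at most
  10 because the balls are disjoint; both constants are the maximum of \<open>chi\<close>. Within
  3/5 of a radius the concentrated part is at least 1.\<close>

lemma p_laplacian_bounds:
  shows "trace (pH N x) \<le> 10 * S"
    and "S \<le> 1 \<Longrightarrow> \<bar>trace (pH N x)\<bar> \<le> 20"
    and "j \<in> J \<Longrightarrow> dist j x \<le> 3/5 * rad j \<Longrightarrow> trace (pH N x) \<le> 10 * S - 1"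
proof -
  let ?s = "(\<Sum>j\<in>J. chi ((1 / rad j) *\<^sub>R (x - j)))"
  have 1: "(\<Sum>j\<in>J. rad j ^ CARD('n) * chi (x - j)) \<le> 10 * S"
    unfolding S_def sum_distrib_left
    by (intro sum_mono) (use rad_pos in \<open>auto simp: chi_le less_imp_le mult.commute[of 10] intro!: mult_left_mono\<close>)
  have 0: "0 \<le> (\<Sum>j\<in>J. rad j ^ CARD('n) * chi (x - j))"
    using rad_pos by (intro sum_nonneg) (auto simp: chi_nonneg less_imp_le)
  have 2: "0 \<le> ?s" by (intro sum_nonneg chi_nonneg)
  have "?s \<le> 10 * (\<Sum>j\<in>J. indicat_real (ball j (rad j)) x)"
    unfolding sum_distrib_left by (intro sum_mono chi_scaled_le_indicator)
  then have 3: "?s \<le> 10"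
    using sum_indicator_disjoint_le_1[OF fin balls_disjoint, of x] by linarith
  show "trace (pH N x) \<le> 10 * S" using 1 2 by (simp add: p_laplacian)
  show "\<bar>trace (pH N x)\<bar> \<le> 20" if "S \<le> 1" using 0 1 2 3 that by (simp add: p_laplacian abs_le_iff)
  assume j: "j \<in> J" "dist j x \<le> 3/5 * rad j"
  have "1 \<le> chi ((1 / rad j) *\<^sub>R (x - j))"
    using j(2) by (intro chi_ge_1) (unfold norm_inverse_le[OF rad_pos], simp add: dist_norm norm_minus_commute)
  also have "\<dots> \<le> ?s" by (rule member_le_sum[OF j(1)]) (auto simp: chi_nonneg fin)
  finally show "trace (pH N x) \<le> 10 * S - 1" using 1 by (simp add: p_laplacian)
qed

end

lemma has_hessian_diff:
  assumes "has_hessian f G H" "has_hessian f' G' H'"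
  shows "has_hessian (\<lambda>x. f x - f' x) (\<lambda>x. G x - G' x) (\<lambda>x. H x - H' x)"
  using assms unfolding has_hessian_def by (auto intro!: GDERIV_diff)

lemma integral_indicator_ball:
  fixes z :: "'a::euclidean_space"
  assumes "0 \<le> r"
  shows "integrable lborel (indicat_real (ball z r))"
    and "(LBINT x. indicat_real (ball z r) x) = unit_ball_vol (real DIM('a)) * r ^ DIM('a)"
proof -
  show "integrable lborel (indicat_real (ball z r))"
    using emeasure_bounded_finite[of "ball z r"] by (intro integrable_real_indicator) auto
  show "(LBINT x. indicat_real (ball z r) x) = unit_ball_vol (real DIM('a)) * r ^ DIM('a)"
    using content_ball[OF assms, of z] by simp
qed

lemma integrable_indicator_ball_mult:
  fixes f :: "'a::euclidean_space \<Rightarrow> real"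
  assumes "continuous_on UNIV f"
  shows "integrable lborel (\<lambda>x. indicat_real (ball z r) x * f x)"
proof -
  have i: "integrable lborel (\<lambda>x. indicat_real (cball z r) x *\<^sub>R f x)"
    by (intro borel_integrable_compact continuous_on_subset[OF assms]) auto
  have m: "f \<in> borel_measurable borel" by (rule borel_measurable_continuous_onI[OF assms])
  show ?thesis
  proof (rule Bochner_Integration.integrable_bound)
    show "integrable lborel (\<lambda>x. indicat_real (cball z r) x *\<^sub>R f x)" by (rule i)
    show "(\<lambda>x. indicat_real (ball z r) x * f x) \<in> borel_measurable lborel"
      using m by (intro borel_measurable_times borel_measurable_indicator) auto
    show "AE x in lborel. norm (indicat_real (ball z r) x * f x) \<le> norm (indicat_real (cball z r) x *\<^sub>R f x)"
      by (intro always_eventually allI) (auto simp: indicator_def)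
  qed
qed

lemma abs_integral_le:
  fixes f g :: "'a \<Rightarrow> real"
  assumes "integrable M f" "integrable M g" "\<And>x. \<bar>f x\<bar> \<le> g x"
  shows "\<bar>\<integral>x. f x \<partial>M\<bar> \<le> (\<integral>x. g x \<partial>M)"
  by (rule order_trans[OF integral_abs_bound integral_mono]) (use assms in auto)

section \<open>Mean-square Hessian bounds and the exceptional balls\<close>

context ball_family
begin

lemma pH_continuous: "continuous_on UNIV (\<lambda>x. pH m x $ a $ b)"
  by (intro continuous_on_component has_third_continuous[OF has_third_p])

text \<open>After replacing the Hessian by the Laplacian, one factor is bounded by 20, and the
  integral of the absolute value of the other by 20 times the unit ball volume times S, namely 10
  from each of the two parts; hence 400.\<close>

lemma pH_l2_bound:
  assumes "S \<le> 1"
  shows "(LBINT x. (\<Sum>a\<in>UNIV. \<Sum>b\<in>UNIV. (pH N x $ a $ b)^2)) \<le> 400 * unit_ball_vol CARD('n) * S"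
proof -
  obtain R where R: "\<And>m x. R \<le> norm x \<Longrightarrow> p m x = 0" "\<And>m x. R \<le> norm x \<Longrightarrow> pG m x = 0"
    "\<And>m x. R \<le> norm x \<Longrightarrow> pH m x = 0" by (rule p_support) (rule that)
  let ?g = "\<lambda>x. 20 * ((\<Sum>j\<in>J. rad j ^ CARD('n) * 10 * indicat_real (ball j 1) x)
      + (\<Sum>j\<in>J. 10 * indicat_real (ball j (rad j)) x))"
  have chi1: "chi (x - j) \<le> 10 * indicat_real (ball j 1) x" for x j :: "real^'n"
    by (cases "x \<in> ball j 1") (auto simp: chi_le chi_eq_0 dist_norm norm_minus_commute)
  have "(LBINT x. (\<Sum>a\<in>UNIV. \<Sum>b\<in>UNIV. (pH N x $ a $ b)^2)) = (LBINT x. (trace (pH N x))^2)"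
    by (rule integral_hessian_square[OF has_hessian_p has_third_p pT_continuous, where R = R])
      (use R p_sym in auto)
  also have "\<dots> \<le> (LBINT x. ?g x)"
  proof (rule integral_mono)
    show "integrable lborel (\<lambda>x. (trace (pH N x))^2)"
      by (rule compact_support_integrable[where R = R])
        (use R in \<open>auto simp: trace_def intro!: continuous_intros pH_continuous\<close>)
    show "integrable lborel ?g"
      by (intro integrable_mult_right Bochner_Integration.integrable_add Bochner_Integration.integrable_sum
          integral_indicator_ball) (auto simp: rad_pos less_imp_le)
    fix x
    have "(trace (pH N x))^2 = \<bar>trace (pH N x)\<bar> * \<bar>trace (pH N x)\<bar>" by (simp add: power2_eq_square)
    also have "\<dots> \<le> 20 * \<bar>trace (pH N x)\<bar>"
      using p_laplacian_bounds(2)[OF assms] by (intro mult_right_mono) auto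
    also have "\<dots> \<le> 20 * ((\<Sum>j\<in>J. rad j ^ CARD('n) * chi (x - j)) + (\<Sum>j\<in>J. chi ((1 / rad j) *\<^sub>R (x - j))))"
    proof (intro mult_left_mono)
      have "0 \<le> (\<Sum>j\<in>J. rad j ^ CARD('n) * chi (x - j))" "0 \<le> (\<Sum>j\<in>J. chi ((1 / rad j) *\<^sub>R (x - j)))"
        by (auto intro!: sum_nonneg mult_nonneg_nonneg chi_nonneg simp: rad_pos less_imp_le)
      then show "\<bar>trace (pH N x)\<bar> \<le> (\<Sum>j\<in>J. rad j ^ CARD('n) * chi (x - j)) + (\<Sum>j\<in>J. chi ((1 / rad j) *\<^sub>R (x - j)))"
        by (simp add: p_laplacian)
    qed simp
    also have "\<dots> \<le> ?g x"
      by (intro mult_left_mono add_mono sum_mono chi_scaled_le_indicator)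
        (use chi1 rad_pos in \<open>auto simp: mult.assoc less_imp_le intro!: mult_left_mono\<close>)
    finally show "(trace (pH N x))^2 \<le> ?g x" .
  qed
  also have "\<dots> = 400 * unit_ball_vol CARD('n) * S"
  proof -
    have i: "integrable lborel (\<lambda>x. c * indicat_real (ball j r) x)"
      "(LBINT x. c * indicat_real (ball j r) x) = c * (unit_ball_vol CARD('n) * r ^ CARD('n))"
      if "0 \<le> r" for c r and j :: "real^'n"
      using integral_indicator_ball[OF that, of j] by (auto simp del: integral_indicator)
    have r0: "0 \<le> rad j" for j using rad_pos[of j] by simp
    have g1: "integrable lborel (\<lambda>x. \<Sum>j\<in>J. rad j ^ CARD('n) * 10 * indicat_real (ball j 1) x)"
      "(LBINT x. (\<Sum>j\<in>J. rad j ^ CARD('n) * 10 * indicat_real (ball j 1) x))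
        = (\<Sum>j\<in>J. rad j ^ CARD('n) * 10 * (unit_ball_vol CARD('n) * 1 ^ CARD('n)))"
      by (rule Bochner_Integration.integrable_sum, rule i(1), simp)
        (subst Bochner_Integration.integral_sum, rule i(1), simp, intro sum.cong refl i(2) zero_le_one)
    have g2: "integrable lborel (\<lambda>x. \<Sum>j\<in>J. 10 * indicat_real (ball j (rad j)) x)"
      "(LBINT x. (\<Sum>j\<in>J. 10 * indicat_real (ball j (rad j)) x))
        = (\<Sum>j\<in>J. 10 * (unit_ball_vol CARD('n) * rad j ^ CARD('n)))"
      by (rule Bochner_Integration.integrable_sum, rule i(1), rule r0)
        (subst Bochner_Integration.integral_sum, rule i(1), rule r0, intro sum.cong refl i(2) r0)
    have "(LBINT x. ?g x) = 20 * ((\<Sum>j\<in>J. rad j ^ CARD('n) * 10 * (unit_ball_vol CARD('n) * 1 ^ CARD('n)))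
        + (\<Sum>j\<in>J. 10 * (unit_ball_vol CARD('n) * rad j ^ CARD('n))))"
      by (simp only: integral_mult_right_zero Bochner_Integration.integral_add[OF g1(1) g2(1)] g1(2) g2(2))
    also have "\<dots> = 400 * unit_ball_vol CARD('n) * S"
      by (simp add: S_def sum_distrib_left[symmetric] sum_distrib_right[symmetric])
    finally show ?thesis .
  qed
  finally show ?thesis .
qed

text \<open>A large entry of a partial sum at a point is turned into Hessian energy of the full
  potential on a ball of the matching scale. Testing with a bump of that scale works because the
  partial sum changes by at most \<open>A\<close> on the ball, while the omitted fine layers are
  O(4^-m) and contribute only a bounded average once both derivatives are moved onto the bump, whose
  Hessian is O(4^m).\<close>

lemma large_hessian_l2:
  fixes z :: "real^'n"
  assumes m: "m \<le> N" and Q: "0 < Q" "Q + 2 * A * K \<le> (\<Lambda> - A) * ((3/4) ^ 5 / 2 ^ CARD('n))"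
    and big: "\<Lambda> \<le> \<bar>pH m z $ a $ b\<bar>"
  shows "Q^2 * unit_ball_vol CARD('n) * ((1/2) ^ m) ^ CARD('n) \<le> (LBINT x. indicat_real (ball z ((1/2) ^ m)) x * (pH N x $ a $ b)^2)"
proof -
  let ?\<rho> = "(1/2::real) ^ m"
  let ?B = "indicat_real (ball z ?\<rho>)"
  let ?h = "\<lambda>x. pH N x $ a $ b"
  define V where "V = unit_ball_vol CARD('n) * ?\<rho> ^ CARD('n)"
  have V: "0 < V" by (simp add: V_def)
  have intB: "integrable lborel ?B" "(LBINT x. ?B x) = V"
    using integral_indicator_ball[of ?\<rho> z] by (auto simp: V_def)
  define \<beta> where "\<beta> x = bump 5 (2 ^ m *\<^sub>R (x - z))" for x
  define \<beta>G where "\<beta>G x = 2 ^ m *\<^sub>R bump_G (2 ^ m *\<^sub>R (x - z))" for x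
  define \<beta>H where "\<beta>H x = (2 ^ m)^2 *\<^sub>R bump_H (2 ^ m *\<^sub>R (x - z))" for x
  have hb: "has_hessian \<beta> \<beta>G \<beta>H"
    using has_hessian_dilation[OF has_hessian_bump, of 1 "2 ^ m" z]
    by (simp add: \<beta>_def[abs_def] \<beta>G_def[abs_def] \<beta>H_def[abs_def])
  have out: "1 \<le> norm (2 ^ m *\<^sub>R (x - z))" if "x \<notin> ball z ?\<rho>" for x
    unfolding one_le_norm_pow2 using that by (simp add: dist_norm norm_minus_commute)
  have \<beta>0: "\<beta> x = 0" "\<beta>G x = 0" "\<beta>H x = 0" if "x \<notin> ball z ?\<rho>" for x
    using out[OF that] by (auto simp: \<beta>_def \<beta>G_def \<beta>H_def bump_eq_0 bump_derivs_eq_0)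
  have far: "x \<notin> ball z ?\<rho>" if "norm z + 1 \<le> norm x" for x
    using that norm_triangle_ineq2[of x z] power_le_one[of "1/2::real" m]
    by (auto simp: dist_norm norm_minus_commute)
  have \<beta>1: "0 \<le> \<beta> x" "\<beta> x \<le> ?B x" for x
    using \<beta>0(1)[of x] by (auto simp: \<beta>_def bump_nonneg bump_le_1 indicator_def)
  have \<beta>c: "continuous_on UNIV \<beta>" "continuous_on UNIV \<beta>G" using has_hessian_continuous[OF hb] by auto
  have \<beta>Hc: "continuous_on UNIV (\<lambda>x. \<beta>H x $ i $ j)" for i j
    unfolding \<beta>H_def by (simp) (intro continuous_intros continuous_on_compose2[OF bump_H_continuous], auto)
  have \<beta>Hc': "continuous_on UNIV (\<lambda>x. \<beta>H x $ i)" for i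
    using continuous_on_vec_lambda[of UNIV "\<lambda>j x. \<beta>H x $ i $ j", OF \<beta>Hc] by simp
  have \<beta>i: "integrable lborel (\<lambda>x. \<beta> x * f x)" if "continuous_on UNIV f" for f
    by (rule compact_support_integrable[where R = "norm z + 1"]) (use \<beta>0 far in \<open>auto intro!: continuous_intros \<beta>c that\<close>)
  have intB_mult: "integrable lborel (\<lambda>x. ?B x * f x)" if "continuous_on UNIV f" for f
    by (rule integrable_indicator_ball_mult[OF that])
  \<comment> \<open>On the half ball, which has the fraction \<open>1 / 2 ^ n\<close> of the volume,
    \<open>1 - x \<bullet> x\<close> is at least 3/4 after rescaling.\<close>
  have I\<beta>: "(3/4) ^ 5 / 2 ^ CARD('n) * V \<le> (LBINT x. \<beta> x)"
  proof -
    have "(3/4) ^ 5 / 2 ^ CARD('n) * V = (LBINT x. (3/4) ^ 5 * indicat_real (ball z (?\<rho> / 2)) x)"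
      by (simp add: content_ball V_def power_divide)
    also have "\<dots> \<le> (LBINT x. \<beta> x)"
    proof (rule integral_mono)
      show "integrable lborel (\<lambda>x. (3/4) ^ 5 * indicat_real (ball z (?\<rho> / 2)) x)"
        by (intro integrable_mult_right integral_indicator_ball) auto
      show "integrable lborel \<beta>" using \<beta>i[of "\<lambda>_. 1"] by auto
      fix x show "(3/4) ^ 5 * indicat_real (ball z (?\<rho> / 2)) x \<le> \<beta> x"
      proof (cases "x \<in> ball z (?\<rho> / 2)")
        case True
        then have "norm (2 ^ m *\<^sub>R (x - z)) \<le> 1/2"
          unfolding norm_pow2_le by (simp add: dist_norm norm_minus_commute)
        then have "(norm (2 ^ m *\<^sub>R (x - z)))^2 \<le> (1/2)^2" by (intro power_mono) auto
        then have "3/4 \<le> 1 - (2 ^ m *\<^sub>R (x - z)) \<bullet> (2 ^ m *\<^sub>R (x - z))"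
          unfolding dot_square_norm by (simp add: power2_eq_square)
        then have "3/4 \<le> max 0 (1 - (2 ^ m *\<^sub>R (x - z)) \<bullet> (2 ^ m *\<^sub>R (x - z)))" by linarith
        then have "(3/4) ^ 5 \<le> (max 0 (1 - (2 ^ m *\<^sub>R (x - z)) \<bullet> (2 ^ m *\<^sub>R (x - z)))) ^ 5"
          by (rule power_mono) simp
        then show ?thesis using True unfolding \<beta>_def bump_def by (simp only: indicator_simps mult_1_right)
      qed (use \<beta>1 in auto)
    qed
    finally show ?thesis .
  qed
  have Lam: "0 \<le> \<Lambda> - A"
  proof (rule ccontr)
    assume "\<not> 0 \<le> \<Lambda> - A"
    then have "(\<Lambda> - A) * ((3/4) ^ 5 / 2 ^ CARD('n)) < 0" by (intro mult_neg_pos) auto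
    moreover have "0 < Q + 2 * A * K" using Q(1) A_nonneg K(1) by (intro add_pos_nonneg) auto
    ultimately show False using Q(2) by linarith
  qed
  have main1: "(\<Lambda> - A) * ((3/4) ^ 5 / 2 ^ CARD('n)) * V \<le> \<bar>LBINT x. \<beta> x * pH m x $ a $ b\<bar>"
  proof -
    let ?h0 = "pH m z $ a $ b"
    have "\<bar>(LBINT x. \<beta> x * pH m x $ a $ b) - ?h0 * (LBINT x. \<beta> x)\<bar>
       = \<bar>LBINT x. \<beta> x * (pH m x $ a $ b - ?h0)\<bar>"
      using \<beta>i[OF pH_continuous] \<beta>i[of "\<lambda>_. ?h0"] \<beta>i[of "\<lambda>_. 1"]
      by (simp add: right_diff_distrib mult.commute[of ?h0] )
    also have "\<dots> \<le> (LBINT x. A * \<beta> x)"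
    proof (rule abs_integral_le)
      show "integrable lborel (\<lambda>x. \<beta> x * (pH m x $ a $ b - ?h0))"
        by (intro \<beta>i continuous_intros pH_continuous)
      show "integrable lborel (\<lambda>x. A * \<beta> x)" using \<beta>i[of "\<lambda>_. A"] by (simp add: mult.commute)
      fix x
      show "\<bar>\<beta> x * (pH m x $ a $ b - ?h0)\<bar> \<le> A * \<beta> x"
      proof (cases "x \<in> ball z ?\<rho>")
        case True
        have "\<bar>pH m x $ a $ b - ?h0\<bar> \<le> A * 2 ^ m * norm (x - z)"
          by (rule hessian_entry_lipschitz[OF has_third_p pT_bound])
        also have "\<dots> \<le> A * 2 ^ m * ?\<rho>"
          using True A_nonneg by (intro mult_left_mono) (auto simp: dist_norm norm_minus_commute)
        finally show ?thesis using \<beta>1(1)[of x]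
          by (simp add: abs_mult power_divide mult.commute mult_left_mono)
      qed (use \<beta>0 in auto)
    qed
    also have "\<dots> = A * (LBINT x. \<beta> x)" by simp
    finally have d: "\<bar>(LBINT x. \<beta> x * pH m x $ a $ b) - ?h0 * (LBINT x. \<beta> x)\<bar> \<le> A * (LBINT x. \<beta> x)" .
    have b0: "0 \<le> (LBINT x. \<beta> x)" using \<beta>1(1) by (intro integral_nonneg_AE) auto
    have "(\<Lambda> - A) * ((3/4) ^ 5 / 2 ^ CARD('n) * V) \<le> (\<Lambda> - A) * (LBINT x. \<beta> x)"
      by (intro mult_left_mono I\<beta> Lam)
    also have "\<dots> \<le> (\<bar>?h0\<bar> - A) * (LBINT x. \<beta> x)" using big b0 by (intro mult_right_mono) auto
    also have "\<dots> = \<bar>?h0 * (LBINT x. \<beta> x)\<bar> - A * (LBINT x. \<beta> x)"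
      using b0 by (simp add: abs_mult left_diff_distrib)
    also have "\<dots> \<le> \<bar>LBINT x. \<beta> x * pH m x $ a $ b\<bar>" using d by linarith
    finally show ?thesis by (simp add: mult.assoc)
  qed
  define t tG tH where "t = (\<lambda>x. p N x - p m x)" and "tG = (\<lambda>x. pG N x - pG m x)"
    and "tH = (\<lambda>x. pH N x - pH m x)"
  have ht: "has_hessian t tG tH" unfolding t_def tG_def tH_def by (intro has_hessian_diff has_hessian_p)
  have tHc: "continuous_on UNIV (\<lambda>x. tH x $ i)" for i
    unfolding tH_def by (intro continuous_on_component continuous_intros
        has_third_continuous[OF has_third_p])
  \<comment> \<open>No sup bound on the Hessian of the fine layers is available, only on their
    values; two integrations by parts therefore trade it for the Hessian of
    \<open>\<beta>\<close>.\<close>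
  have bp: "(LBINT x. \<beta> x * tH x $ a $ b) = (LBINT x. \<beta>H x $ b $ a * t x)"
  proof -
    have "(LBINT x. \<beta> x * tH x $ a $ b) = - (LBINT x. \<beta>G x $ b * tG x $ a)"
      by (rule integral_by_parts_partial[where R = "norm z + 1", OF has_hessianD(1)[OF hb] _ has_hessianD(2)[OF ht] tHc])
        (use \<beta>0 far \<beta>c in auto)
    also have "(LBINT x. \<beta>G x $ b * tG x $ a) = - (LBINT x. \<beta>H x $ b $ a * t x)"
      by (rule integral_by_parts_partial[where R = "norm z + 1", OF has_hessianD(2)[OF hb] \<beta>Hc' has_hessianD(1)[OF ht]])
        (use \<beta>0 far has_hessian_continuous[OF ht] in auto)
    finally show ?thesis by simp
  qed
  have main2: "\<bar>LBINT x. \<beta> x * tH x $ a $ b\<bar> \<le> 2 * A * K * V"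
  proof -
    have "\<bar>LBINT x. \<beta>H x $ b $ a * t x\<bar> \<le> (LBINT x. 2 * A * K * ?B x)"
    proof (rule abs_integral_le)
      show "integrable lborel (\<lambda>x. \<beta>H x $ b $ a * t x)"
        by (rule compact_support_integrable[where R = "norm z + 1"])
          (use \<beta>0 far in \<open>auto intro!: continuous_intros \<beta>Hc has_hessian_continuous(1)[OF ht]\<close>)
      show "integrable lborel (\<lambda>x. 2 * A * K * ?B x)" by (intro integrable_mult_right intB)
      fix x
      show "\<bar>\<beta>H x $ b $ a * t x\<bar> \<le> 2 * A * K * ?B x"
      proof (cases "x \<in> ball z ?\<rho>")
        case True
        have "\<bar>\<beta>H x $ b $ a\<bar> \<le> (2 ^ m)^2 * K"
          using abs_entry_le_norm[of "bump_H (2 ^ m *\<^sub>R (x - z))" b a] K(5)[of "2 ^ m *\<^sub>R (x - z)"]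
          by (auto simp: \<beta>H_def abs_mult intro!: mult_left_mono)
        moreover have "\<bar>t x\<bar> \<le> 2 * A * (1/4) ^ m" using p_diff_bounds[OF m, of x] by (simp add: t_def)
        ultimately have "\<bar>\<beta>H x $ b $ a\<bar> * \<bar>t x\<bar> \<le> ((2 ^ m)^2 * K) * (2 * A * (1/4) ^ m)"
          using K(1) by (intro mult_mono) auto
        also have "\<dots> = 2 * A * K * ((2 ^ m)^2 * (1/4) ^ m)" by simp
        also have "(2 ^ m)^2 * (1/4::real) ^ m = 1"
          by (simp add: power2_eq_square power_mult_distrib[symmetric])
        finally show ?thesis using True by (simp add: abs_mult)
      qed (use \<beta>0 in auto)
    qed
    then show ?thesis unfolding bp using intB(2) by simp
  qed
  have sp: "(LBINT x. \<beta> x * ?h x) = (LBINT x. \<beta> x * pH m x $ a $ b) + (LBINT x. \<beta> x * tH x $ a $ b)"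
    using \<beta>i[OF pH_continuous[of m a b]] \<beta>i[OF pH_continuous[of N a b]]
    by (simp add: tH_def right_diff_distrib)
  have I1: "Q * V \<le> (LBINT x. ?B x * \<bar>?h x\<bar>)"
  proof -
    have "Q * V + 2 * A * K * V \<le> (\<Lambda> - A) * ((3/4) ^ 5 / 2 ^ CARD('n)) * V"
      using mult_right_mono[OF Q(2), of V] V by (simp add: distrib_right)
    then have "Q * V \<le> \<bar>LBINT x. \<beta> x * ?h x\<bar>" using main1 main2 sp by linarith
    also have "\<dots> \<le> (LBINT x. ?B x * \<bar>?h x\<bar>)"
    proof (rule abs_integral_le)
      show "integrable lborel (\<lambda>x. \<beta> x * ?h x)" by (rule \<beta>i[OF pH_continuous])
      show "integrable lborel (\<lambda>x. ?B x * \<bar>?h x\<bar>)" by (intro intB_mult continuous_intros pH_continuous)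
      show "\<bar>\<beta> x * ?h x\<bar> \<le> ?B x * \<bar>?h x\<bar>" for x
        using \<beta>1[of x] by (simp add: abs_mult mult_right_mono)
    qed
    finally show ?thesis .
  qed
  \<comment> \<open>The Cauchy-Schwarz step from mean to mean square, carried out pointwise through
    \<open>2 * Q * t \<le> t^2 + Q^2\<close>.\<close>
  have "2 * Q * (LBINT x. ?B x * \<bar>?h x\<bar>) = (LBINT x. ?B x * (2 * Q * \<bar>?h x\<bar>))"
    by (simp only: integral_mult_right_zero[symmetric] ac_simps)
  also have "\<dots> \<le> (LBINT x. ?B x * (?h x)^2 + Q^2 * ?B x)"
  proof (rule integral_mono)
    show "integrable lborel (\<lambda>x. ?B x * (2 * Q * \<bar>?h x\<bar>))" by (intro intB_mult continuous_intros pH_continuous)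
    show "integrable lborel (\<lambda>x. ?B x * (?h x)^2 + Q^2 * ?B x)"
      by (intro Bochner_Integration.integrable_add intB_mult integrable_mult_right intB continuous_intros pH_continuous)
    fix x
    have "0 \<le> (\<bar>?h x\<bar> - Q)^2" by simp
    then have "2 * Q * \<bar>?h x\<bar> \<le> (?h x)^2 + Q^2" by (simp add: power2_diff mult.commute mult.left_commute)
    then have "?B x * (2 * Q * \<bar>?h x\<bar>) \<le> ?B x * ((?h x)^2 + Q^2)" by (intro mult_left_mono) auto
    then show "?B x * (2 * Q * \<bar>?h x\<bar>) \<le> ?B x * (?h x)^2 + Q^2 * ?B x" by (simp add: algebra_simps)
  qed
  also have "\<dots> = (LBINT x. ?B x * (?h x)^2) + Q^2 * V"
  proof -
    have "integrable lborel (\<lambda>x. ?B x * (?h x)^2)" by (intro intB_mult continuous_intros pH_continuous)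
    then show ?thesis using intB
      by (subst Bochner_Integration.integral_add) (auto simp del: integral_indicator)
  qed
  finally have "2 * Q * (LBINT x. ?B x * \<bar>?h x\<bar>) \<le> (LBINT x. ?B x * (?h x)^2) + Q^2 * V" .
  moreover have "2 * Q * (Q * V) \<le> 2 * Q * (LBINT x. ?B x * \<bar>?h x\<bar>)"
    using Q(1) by (intro mult_left_mono I1) auto
  ultimately show ?thesis by (simp add: V_def power2_eq_square mult.assoc)
qed

text \<open>The centres where a maximal function of the truncated Hessian exceeds the threshold.
  Truncations stop at the radius of the ball itself, since finer layers do not reach into
  it.\<close>

definition bad :: "real \<Rightarrow> (real^'n) set" where
  "bad \<Lambda> = {j\<in>J. \<exists>m\<le>\<kappa> j. \<exists>a b. \<Lambda> < \<bar>pH m j $ a $ b\<bar>}"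

text \<open>A weak-type estimate. Each bad centre has a scale, no smaller than its own radius, on
  which the Hessian has energy at least \<open>Q^2\<close> times the volume. Disjoint Vitali balls
  at these scales share the total energy 400 times the unit ball volume times S, and their five-fold
  enlargements cover the bad balls; \<open>800 * 5 ^ n \<le> Q^2\<close> then leaves at most half of
  S.\<close>

lemma bad_small:
  assumes "S \<le> 1" and Q: "0 < Q" "Q + 2 * A * K \<le> (\<Lambda> - A) * ((3/4) ^ 5 / 2 ^ CARD('n))" "800 * 5 ^ CARD('n) \<le> Q^2"
  shows "(\<Sum>j\<in>bad \<Lambda>. rad j ^ CARD('n)) \<le> S / 2"
proof -
  have "\<forall>j\<in>bad \<Lambda>. \<exists>m a b. m \<le> \<kappa> j \<and> \<Lambda> < \<bar>pH m j $ a $ b\<bar>" by (auto simp: bad_def)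
  then obtain m a b where mab: "\<And>j. j \<in> bad \<Lambda> \<Longrightarrow> m j \<le> \<kappa> j" "\<And>j. j \<in> bad \<Lambda> \<Longrightarrow> \<Lambda> < \<bar>pH (m j) j $ a j $ b j\<bar>"
    by metis
  define \<rho> where "\<rho> j = (1/2::real) ^ m j" for j
  have \<rho>: "0 < \<rho> j" "\<rho> j \<le> 1" for j by (auto simp: \<rho>_def power_le_one)
  have bJ: "bad \<Lambda> \<subseteq> J" by (auto simp: bad_def)
  have \<rho>r: "rad j \<le> \<rho> j" if "j \<in> bad \<Lambda>" for j
    unfolding rad_def \<rho>_def using mab(1)[OF that] by (intro power_decreasing) auto
  obtain C where C: "countable C" "C \<subseteq> bad \<Lambda>"
    "pairwise (\<lambda>i j. disjnt (cball i (\<rho> i)) (cball j (\<rho> j))) C"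
    and cov: "\<And>i. i \<in> bad \<Lambda> \<Longrightarrow> \<exists>j. j \<in> C \<and> \<not> disjnt (cball i (\<rho> i)) (cball j (\<rho> j)) \<and> cball i (\<rho> i) \<subseteq> ball j (5 * \<rho> j)"
    by (rule Vitali_covering_lemma_cballs_balls[of "bad \<Lambda>" \<rho> 1 "\<lambda>j. j"]) (use \<rho> in blast)+
  have finb: "finite (bad \<Lambda>)" using bJ fin finite_subset by blast
  have finC: "finite C" using C(2) finb finite_subset by blast
  have fm: "emeasure lborel (ball (j::real^'n) s) \<noteq> \<infinity>" for j s
    using emeasure_bounded_finite[of "ball j s"] by auto
  have "unit_ball_vol CARD('n) * (\<Sum>j\<in>bad \<Lambda>. rad j ^ CARD('n)) = (\<Sum>j\<in>bad \<Lambda>. measure lborel (ball j (rad j)))"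
    by (simp add: content_ball rad_pos less_imp_le sum_distrib_left)
  also have "\<dots> = measure lborel (\<Union>j\<in>bad \<Lambda>. ball j (rad j))"
    using balls_disjoint bJ finb fm
    by (intro measure_finite_Union[symmetric]) (auto simp: disjoint_family_on_def)
  also have "\<dots> \<le> measure lborel (\<Union>j\<in>C. ball j (5 * \<rho> j))"
  proof (rule measure_mono_fmeasurable)
    show "(\<Union>j\<in>bad \<Lambda>. ball j (rad j)) \<subseteq> (\<Union>j\<in>C. ball j (5 * \<rho> j))"
    proof (intro UN_least)
      fix i assume i: "i \<in> bad \<Lambda>"
      then obtain j where "j \<in> C" "cball i (\<rho> i) \<subseteq> ball j (5 * \<rho> j)" using cov by blast
      moreover have "ball i (rad i) \<subseteq> cball i (\<rho> i)" using \<rho>r[OF i] by auto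
      ultimately show "ball i (rad i) \<subseteq> (\<Union>j\<in>C. ball j (5 * \<rho> j))" by blast
    qed
    show "(\<Union>j\<in>bad \<Lambda>. ball j (rad j)) \<in> sets lborel" by (intro sets.finite_UN finb) auto
    show "(\<Union>j\<in>C. ball j (5 * \<rho> j)) \<in> fmeasurable lborel"
      by (intro fmeasurable.finite_UN finC ball_fmeasurable)
  qed
  also have "\<dots> \<le> (\<Sum>j\<in>C. measure lborel (ball j (5 * \<rho> j)))"
    by (rule measure_UNION_le[OF finC]) auto
  also have "\<dots> = 5 ^ CARD('n) * (\<Sum>j\<in>C. unit_ball_vol CARD('n) * \<rho> j ^ CARD('n))"
    using \<rho> unfolding sum_distrib_left
    by (intro sum.cong refl) (simp add: content_ball less_imp_le power_mult_distrib)
  also have "\<dots> \<le> 5 ^ CARD('n) * ((400 * unit_ball_vol CARD('n) * S) / Q^2)"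
  proof (intro mult_left_mono)
    let ?f = "\<lambda>x. \<Sum>a\<in>UNIV. \<Sum>b\<in>UNIV. (pH N x $ a $ b)^2"
    have fc: "continuous_on UNIV ?f" by (intro continuous_intros pH_continuous)
    obtain R where R: "\<And>m x. R \<le> norm x \<Longrightarrow> pH m x = 0" by (rule p_support) (rule that)
    have fi: "integrable lborel ?f"
      by (rule compact_support_integrable[OF fc, where R = R]) (simp add: R)
    have f0: "0 \<le> ?f x" for x by (intro sum_nonneg) auto
    have "Q^2 * (\<Sum>j\<in>C. unit_ball_vol CARD('n) * \<rho> j ^ CARD('n)) = (\<Sum>j\<in>C. Q^2 * unit_ball_vol CARD('n) * \<rho> j ^ CARD('n))" by (simp add: sum_distrib_left mult.assoc)
    also have "\<dots> \<le> (\<Sum>j\<in>C. (LBINT x. indicat_real (ball j (\<rho> j)) x * ?f x))"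
    proof (rule sum_mono)
      fix j assume "j \<in> C"
      then have j: "j \<in> bad \<Lambda>" using C(2) by auto
      have "m j \<le> N" using mab(1)[OF j] \<kappa>N[of j] j bJ by auto
      then have "Q^2 * unit_ball_vol CARD('n) * \<rho> j ^ CARD('n) \<le> (LBINT x. indicat_real (ball j (\<rho> j)) x * (pH N x $ a j $ b j)^2)"
        unfolding \<rho>_def by (rule large_hessian_l2[OF _ Q(1,2)]) (use mab(2)[OF j] in simp)
      also have "\<dots> \<le> (LBINT x. indicat_real (ball j (\<rho> j)) x * ?f x)"
      proof (intro integral_mono integrable_indicator_ball_mult fc mult_left_mono)
        fix x
        have "(pH N x $ a j $ b j)^2 \<le> (\<Sum>b\<in>UNIV. (pH N x $ a j $ b)^2)"
          by (rule member_le_sum) auto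
        also have "\<dots> \<le> ?f x" by (rule member_le_sum) (auto intro!: sum_nonneg)
        finally show "(pH N x $ a j $ b j)^2 \<le> ?f x" .
      qed (auto intro!: continuous_intros pH_continuous)
      finally show "Q^2 * unit_ball_vol CARD('n) * \<rho> j ^ CARD('n) \<le> (LBINT x. indicat_real (ball j (\<rho> j)) x * ?f x)" .
    qed
    also have "\<dots> = (LBINT x. (\<Sum>j\<in>C. indicat_real (ball j (\<rho> j)) x) * ?f x)"
      unfolding sum_distrib_right
      by (rule Bochner_Integration.integral_sum[symmetric]) (rule integrable_indicator_ball_mult[OF fc])
    also have "\<dots> \<le> (LBINT x. ?f x)"
    proof (rule integral_mono)
      show "integrable lborel (\<lambda>x. (\<Sum>j\<in>C. indicat_real (ball j (\<rho> j)) x) * ?f x)"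
        unfolding sum_distrib_right by (rule Bochner_Integration.integrable_sum) (rule integrable_indicator_ball_mult[OF fc])
      fix x
      have "disjoint_family_on (\<lambda>j. ball j (\<rho> j)) C"
        unfolding disjoint_family_on_def
      proof (intro ballI impI)
        fix i j assume "i \<in> C" "j \<in> C" "i \<noteq> j"
        then have "disjnt (cball i (\<rho> i)) (cball j (\<rho> j))" using C(3) by (auto simp: pairwise_def)
        then show "ball i (\<rho> i) \<inter> ball j (\<rho> j) = {}"
          using ball_subset_cball[of i "\<rho> i"] ball_subset_cball[of j "\<rho> j"] unfolding disjnt_def by blast
      qed
      from mult_right_mono[OF sum_indicator_disjoint_le_1[OF finC this, of x] f0[of x]]
      show "(\<Sum>j\<in>C. indicat_real (ball j (\<rho> j)) x) * ?f x \<le> ?f x" by simp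
    qed (rule fi)
    also have "\<dots> \<le> 400 * unit_ball_vol CARD('n) * S" by (rule pH_l2_bound[OF assms(1)])
    finally show "(\<Sum>j\<in>C. unit_ball_vol CARD('n) * \<rho> j ^ CARD('n)) \<le> 400 * unit_ball_vol CARD('n) * S / Q^2"
      using Q(1) by (subst pos_le_divide_eq) (simp_all only: mult.commute zero_less_power)
  qed simp
  also have "\<dots> \<le> unit_ball_vol CARD('n) * (S / 2)"
  proof -
    have "5 ^ CARD('n) * (400 * unit_ball_vol CARD('n) * S) * 2 = (800 * 5 ^ CARD('n)) * (unit_ball_vol CARD('n) * S)" by simp
    also have "\<dots> \<le> Q^2 * (unit_ball_vol CARD('n) * S)" using Q(3) S_nonneg by (intro mult_right_mono) auto
    finally have "5 ^ CARD('n) * (400 * unit_ball_vol CARD('n) * S) * 2 \<le> Q^2 * (unit_ball_vol CARD('n) * S)" .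
    moreover have "(unit_ball_vol CARD('n) * (S / 2)) * Q^2 = Q^2 * (unit_ball_vol CARD('n) * S) / 2" by simp
    ultimately have "5 ^ CARD('n) * (400 * unit_ball_vol CARD('n) * S) \<le> (unit_ball_vol CARD('n) * (S / 2)) * Q^2"
      by linarith
    then show ?thesis using Q(1) unfolding times_divide_eq_right[of "5 ^ CARD('n)"]
      by (subst pos_divide_le_eq) (simp_all only: zero_less_power)
  qed
  finally show ?thesis by (rule mult_left_le_imp_le) simp
qed

text \<open>At a good centre all truncations down to the radius have entries at most
  \<open>\<Lambda>\<close>; across the ball they change by at most \<open>A\<close>, and further
  layers have zero Hessian there. So every partial sum is bounded at \<open>x\<close>, as
  \<open>multiscale_touch\<close> requires.\<close>

lemma good_touch:
  assumes j: "j \<in> J - bad \<Lambda>" and x: "x \<in> ball j (rad j)" and "0 \<le> \<Lambda>"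
  shows "p N x + h \<bullet> pG N x - (24 * A + real (CARD('n) * CARD('n)) * (\<Lambda> + 2 * A)) / 2 * (norm h)^2 \<le> p N (x + h)"
proof -
  have pHb: "norm (pH m x) \<le> real (CARD('n) * CARD('n)) * (\<Lambda> + A)" if m: "m \<le> N" for m
  proof -
    have le: "norm (pH m x) \<le> real (CARD('n) * CARD('n)) * (\<Lambda> + A)" if m: "m \<le> \<kappa> j" for m
    proof -
      have Lj: "\<bar>pH m j $ a $ b\<bar> \<le> \<Lambda>" for a b
        using j m unfolding bad_def by (auto simp: not_less)
      have "\<bar>pH m x $ a $ b\<bar> \<le> \<Lambda> + A" for a b
      proof -
        have "\<bar>pH m x $ a $ b - pH m j $ a $ b\<bar> \<le> A * 2 ^ m * norm (x - j)"
          by (rule hessian_entry_lipschitz[OF has_third_p pT_bound])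
        also have "\<dots> \<le> A * 2 ^ m * (1/2) ^ m"
        proof (rule mult_left_mono)
          have "norm (x - j) \<le> rad j" using x by (simp add: dist_norm norm_minus_commute)
          also have "\<dots> \<le> (1/2) ^ m" unfolding rad_def using m by (intro power_decreasing) auto
          finally show "norm (x - j) \<le> (1/2) ^ m" .
        qed (use A_nonneg in auto)
        also have "\<dots> = A" by (simp add: power_divide)
        finally show ?thesis using Lj[of a b] by linarith
      qed
      then show ?thesis by (rule norm_entries_le)
    qed
    show ?thesis
    proof (cases "m \<le> \<kappa> j")
      case False
      \<comment> \<open>At these scales ball \<open>j\<close> is no longer active, and the
        doubled-ball separation keeps every other active centre at distance at least (1/2)^k from
        \<open>x\<close>, outside the support of the kernel.\<close>
      have uH0: "uH k x = 0" if k: "\<kappa> j \<le> k" for k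
        unfolding uH_def
      proof (intro sum.neutral ballI)
        fix i assume "i \<in> active k"
        then have i: "i \<in> J" "i \<noteq> j" using k by (auto simp: active_def)
        have "2 * rad j + 2 * rad i \<le> dist j i" using sep[of j i] i j by (auto simp: rad_def)
        moreover have "dist j i \<le> dist j x + dist x i" by (rule dist_triangle)
        moreover have "(1/2) ^ k \<le> rad j" unfolding rad_def using k by (intro power_decreasing) auto
        moreover have "dist j x < rad j" using x by simp
        ultimately have "(1/2) ^ k \<le> dist x i" using rad_pos[of i] by linarith
        then have "1 \<le> norm (2 ^ k *\<^sub>R (x - i))" by (simp only: one_le_norm_pow2 dist_norm)
        then show "wt k i *\<^sub>R kern_H (2 ^ k *\<^sub>R (x - i)) = 0" by (simp add: kern_eq_0)
      qed
      have "pH m x = pH (\<kappa> j) x" unfolding pH_def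
        using False by (intro sum.mono_neutral_right) (auto simp: uH0)
      then show ?thesis using le[of "\<kappa> j"] by simp
    qed (rule le)
  qed
  have touch: "(\<Sum>k<N. u k x) + h \<bullet> (\<Sum>k<N. uG k x)
      - (24 * A + real (CARD('n) * CARD('n)) * (\<Lambda> + A) + real (CARD('n) * CARD('n)) * A) / 2 * (norm h)^2 \<le> (\<Sum>k<N. u k (x + h))"
    by (rule multiscale_touch[OF has_hessian_u has_third_u A_nonneg u_bounds])
      (rule pHb[unfolded pH_def])
  have eq: "24 * A + real (CARD('n) * CARD('n)) * (\<Lambda> + A) + real (CARD('n) * CARD('n)) * A
     = 24 * A + real (CARD('n) * CARD('n)) * (\<Lambda> + 2 * A)" by (simp add: distrib_left)
  show ?thesis using touch unfolding eq p_def pG_def .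
qed

end

section \<open>Semiconvex envelopes\<close>

lemma quad_axis: "(r *\<^sub>R axis i 1) \<bullet> (A *v (r *\<^sub>R axis i 1)) = r^2 * A $ i $ i" for A :: "real^'n^'n"
  by (simp add: inner_axis' matrix_vector_mult_basis column_def power2_eq_square
      matrix_vector_mult_scaleR matrix_vector_mul_component inner_axis)

text \<open>Axis differences see only the diagonal entries, which are \<open>B\<close>-Lipschitz;
  this is the cubic error. The finite-difference form is what can be transferred to an envelope that
  need not be differentiable.\<close>

lemma discrete_laplacian_upper:
  fixes p :: "real^'n \<Rightarrow> real"
  assumes hess: "has_hessian p G H" and third: "has_third H T" "\<And>x i j. norm (T x i j) \<le> B"
    and r: "0 \<le> r"
  shows "(\<Sum>i\<in>UNIV. p (x + r *\<^sub>R axis i 1) + p (x - r *\<^sub>R axis i 1) - 2 * p x)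
     \<le> trace (H x) * r^2 + real CARD('n) * B * r^3"
proof -
  have B: "0 \<le> B" using order_trans[OF norm_ge_zero third(2)] .
  have "p (x + r *\<^sub>R axis i 1) + p (x - r *\<^sub>R axis i 1) - 2 * p x \<le> r^2 * (H x $ i $ i + B * r)" for i
  proof -
    have b: "r^2 * (H x $ i $ i - B * r) \<le> (r *\<^sub>R axis i 1) \<bullet> (H (x + s *\<^sub>R (r *\<^sub>R axis i 1)) *v (r *\<^sub>R axis i 1)) \<and>
       (r *\<^sub>R axis i 1) \<bullet> (H (x + s *\<^sub>R (r *\<^sub>R axis i 1)) *v (r *\<^sub>R axis i 1)) \<le> r^2 * (H x $ i $ i + B * r)"
      if s: "\<bar>s\<bar> \<le> 1" for s
    proof -
      let ?y = "x + s *\<^sub>R (r *\<^sub>R axis i 1)"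
      have "\<bar>H ?y $ i $ i - H x $ i $ i\<bar> \<le> B * norm (?y - x)"
        using third by (intro GDERIV_bound_imp_lipschitz[where f = "\<lambda>x. H x $ i $ i" and G = "\<lambda>x. T x i i"])
          (auto simp: has_third_def)
      also have "\<dots> = B * (\<bar>s\<bar> * r)" using r by (simp add: norm_axis_1 abs_mult)
      also have "\<dots> \<le> B * (1 * r)" using s r B by (intro mult_left_mono mult_right_mono)
      finally have "\<bar>H ?y $ i $ i - H x $ i $ i\<bar> \<le> B * r" by simp
      then show ?thesis unfolding quad_axis by (intro conjI mult_left_mono) auto
    qed
    show ?thesis by (rule second_difference_bounds(2)[OF hess b])
  qed
  then have "(\<Sum>i\<in>UNIV. p (x + r *\<^sub>R axis i 1) + p (x - r *\<^sub>R axis i 1) - 2 * p x)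
     \<le> (\<Sum>i\<in>UNIV. r^2 * (H x $ i $ i + B * r))" by (intro sum_mono)
  also have "\<dots> = trace (H x) * r^2 + real CARD('n) * B * r^3"
    by (simp add: trace_def sum_distrib_left[symmetric] sum.distrib power3_eq_cube power2_eq_square algebra_simps)
  finally show ?thesis .
qed

text \<open>A Perron-type construction: \<open>v\<close> is the supremum of all minorants of
  \<open>p\<close> that become convex after adding \<open>\<Lambda> / 2 * (x \<bullet> x)\<close>.
  The class is stable under averaging translates, which gives the discrete upper bound, and it
  contains the touching paraboloids, which gives \<open>v x = p x\<close>.\<close>

lemma semiconvex_envelope:
  fixes p :: "real^'n \<Rightarrow> real"
  assumes hess: "has_hessian p G H" and third: "has_third H T" "\<And>x i j. norm (T x i j) \<le> B"
    and p0: "\<And>x. 0 \<le> p x" and \<Lambda>: "0 \<le> \<Lambda>" and tr: "\<And>x. trace (H x) \<le> \<delta>"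
  obtains v where "continuous_on UNIV v" "\<And>x. 0 \<le> v x" "\<And>x. v x \<le> p x"
    "convex_on UNIV (\<lambda>x. v x + \<Lambda> / 2 * (x \<bullet> x))"
    "\<And>x r. 0 \<le> r \<Longrightarrow> (\<Sum>i\<in>UNIV. v (x + r *\<^sub>R axis i 1) + v (x - r *\<^sub>R axis i 1) - 2 * v x)
       \<le> \<delta> * r^2 + real CARD('n) * B * r^3"
    "\<And>x. (\<forall>h. p x + h \<bullet> G x - \<Lambda> / 2 * (norm h)^2 \<le> p (x + h)) \<Longrightarrow> v x = p x"
proof -
  define q where "q x = \<Lambda> / 2 * (x \<bullet> x)" for x :: "real^'n"
  define W where "W = {w. convex_on UNIV (\<lambda>x. w x + q x) \<and> (\<forall>x. w x \<le> p x)}"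
  define v where "v x = (SUP w\<in>W. w x)" for x
  have "convex_on UNIV (\<lambda>x::real^'n. x \<bullet> x)"
  proof (rule convex_onI)
    fix t :: real and x y :: "real^'n" assume t: "0 < t" "t < 1"
    have "(1 - t) * (x \<bullet> x) + t * (y \<bullet> y) - ((1 - t) *\<^sub>R x + t *\<^sub>R y) \<bullet> ((1 - t) *\<^sub>R x + t *\<^sub>R y)
       = t * (1 - t) * ((x - y) \<bullet> (x - y))"
      by (simp add: inner_simps inner_commute algebra_simps power2_eq_square)
    also have "\<dots> \<ge> 0" using t by (intro mult_nonneg_nonneg) auto
    finally show "((1 - t) *\<^sub>R x + t *\<^sub>R y) \<bullet> ((1 - t) *\<^sub>R x + t *\<^sub>R y) \<le> (1 - t) * (x \<bullet> x) + t * (y \<bullet> y)" by simp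
  qed simp
  then have qc: "convex_on UNIV q" unfolding q_def using \<Lambda> by (intro convex_on_cmul) auto
  \<comment> \<open>Nonnegativity of \<open>p\<close> makes zero a competitor, so the supremum is
    over a nonempty set and \<open>v\<close> is nonnegative.\<close>
  have W0: "(\<lambda>x. 0) \<in> W" using qc p0 by (simp add: W_def)
  have Wp: "w x \<le> p x" if "w \<in> W" for w x using that by (auto simp: W_def)
  have bdd: "bdd_above ((\<lambda>w. w x) ` W)" for x using Wp by (intro bdd_aboveI2) auto
  have le_v: "w x \<le> v x" if "w \<in> W" for w x unfolding v_def by (rule cSUP_upper[OF that bdd])
  have v_le: "v x \<le> c" if "\<And>w. w \<in> W \<Longrightarrow> w x \<le> c" for x c
    unfolding v_def using W0 that by (intro cSUP_least) auto
  have vp: "v x \<le> p x" for x by (rule v_le) (rule Wp)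
  have vconv: "convex_on UNIV (\<lambda>x. v x + q x)"
  proof (rule convex_onI)
    fix t :: real and x y :: "real^'n" assume t: "0 < t" "t < 1"
    let ?z = "(1 - t) *\<^sub>R x + t *\<^sub>R y"
    have "v ?z \<le> (1 - t) * (v x + q x) + t * (v y + q y) - q ?z"
    proof (rule v_le)
      fix w assume w: "w \<in> W"
      then have "w ?z + q ?z \<le> (1 - t) * (w x + q x) + t * (w y + q y)"
        using t by (intro convex_onD[where f = "\<lambda>x. w x + q x" and A = UNIV]) (auto simp: W_def)
      also have "\<dots> \<le> (1 - t) * (v x + q x) + t * (v y + q y)"
        using t le_v[OF w] by (intro add_mono mult_left_mono) auto
      finally show "w ?z \<le> (1 - t) * (v x + q x) + t * (v y + q y) - q ?z" by simp
    qed
    then show "v ?z + q ?z \<le> (1 - t) * (v x + q x) + t * (v y + q y)" by simp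
  qed simp
  show ?thesis
  proof (rule that[of v])
    have "continuous_on UNIV (\<lambda>x. v x + q x)" by (rule convex_on_continuous[OF open_UNIV vconv])
    moreover have "continuous_on UNIV q" unfolding q_def by (intro continuous_intros)
    ultimately have "continuous_on UNIV (\<lambda>x. (v x + q x) - q x)" by (intro continuous_on_diff)
    then show "continuous_on UNIV v" by simp
    show "0 \<le> v x" for x using le_v[OF W0] by simp
    show "v x \<le> p x" for x by (rule vp)
    show "convex_on UNIV (\<lambda>x. v x + \<Lambda> / 2 * (x \<bullet> x))" using vconv by (simp add: q_def)
  next
    fix x and r :: real assume r: "0 \<le> r"
    let ?n = "real CARD('n)"
    let ?c = "\<delta> * r^2 + ?n * B * r^3"
    \<comment> \<open>The mean of the 2 n axis translates of \<open>v\<close>, lowered by just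
      enough to stay below \<open>p\<close>. Being a competitor, it lies below \<open>v\<close>, and
      this is the claim after clearing denominators.\<close>
    let ?w = "\<lambda>x. 1 / (2 * ?n) * ((\<Sum>i\<in>UNIV. v (x + r *\<^sub>R axis i 1) + v (x - r *\<^sub>R axis i 1)) - ?c)"
    have n0: "0 < ?n" by simp
    have "?w \<in> W"
      unfolding W_def
    proof (intro CollectI conjI allI)
      fix x
      have "(\<Sum>i\<in>UNIV. v (x + r *\<^sub>R axis i 1) + v (x - r *\<^sub>R axis i 1))
         \<le> (\<Sum>i\<in>UNIV. p (x + r *\<^sub>R axis i 1) + p (x - r *\<^sub>R axis i 1))"
        by (intro sum_mono add_mono vp)
      also have "\<dots> = (\<Sum>i\<in>UNIV. p (x + r *\<^sub>R axis i 1) + p (x - r *\<^sub>R axis i 1) - 2 * p x) + 2 * ?n * p x"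
        by (simp add: sum_subtractf)
      also have "\<dots> \<le> ?c + 2 * ?n * p x"
        using discrete_laplacian_upper[OF hess third r, of x] mult_right_mono[OF tr[of x], of "r^2"] by simp
      finally show "?w x \<le> p x" using n0 by (simp add: field_simps)
    next
      define V where "V x = v x + q x" for x
      have Vc: "convex_on UNIV V" unfolding V_def by (rule vconv)
      have sh: "convex_on UNIV (\<lambda>x. V (x + a))" for a
      proof (rule convex_onI)
        fix t :: real and x y :: "real^'n" assume t: "0 < t" "t < 1"
        have "(1 - t) *\<^sub>R x + t *\<^sub>R y + a = (1 - t) *\<^sub>R (x + a) + t *\<^sub>R (y + a)" by (simp add: algebra_simps)
        then show "V ((1 - t) *\<^sub>R x + t *\<^sub>R y + a) \<le> (1 - t) * V (x + a) + t * V (y + a)"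
          using convex_onD[OF Vc, of t "x + a" "y + a"] t by simp
      qed simp
      \<comment> \<open>The second differences of the quadratic \<open>q\<close> are constant, so up
        to an additive constant \<open>?w + q\<close> is an average of translates of the convex
        function \<open>V\<close>.\<close>
      have e: "?w x + q x = 1 / (2 * ?n) * (\<Sum>i\<in>UNIV. V (x + r *\<^sub>R axis i 1) + V (x + (- r *\<^sub>R axis i 1)))
          + (- (1 / (2 * ?n) * (?c + ?n * \<Lambda> * r^2)))" for x
      proof -
        have "q (x + r *\<^sub>R axis i 1) + q (x + (- r *\<^sub>R axis i 1)) = 2 * q x + \<Lambda> * r^2" for i
          by (simp add: q_def inner_simps inner_axis_axis power2_eq_square algebra_simps inner_commute)
        then have "V (x + r *\<^sub>R axis i 1) + V (x + (- r *\<^sub>R axis i 1))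
           = (v (x + r *\<^sub>R axis i 1) + v (x - r *\<^sub>R axis i 1)) + (2 * q x + \<Lambda> * r^2)" for i
          unfolding V_def by (simp add: add.assoc)
        then have "(\<Sum>i\<in>UNIV. V (x + r *\<^sub>R axis i 1) + V (x + (- r *\<^sub>R axis i 1)))
          = (\<Sum>i\<in>UNIV. v (x + r *\<^sub>R axis i 1) + v (x - r *\<^sub>R axis i 1)) + ?n * (2 * q x + \<Lambda> * r^2)"
          by (simp add: sum.distrib)
        then show ?thesis using n0 by (simp add: field_simps)
      qed
      have sc: "convex_on UNIV (\<lambda>x. \<Sum>i\<in>I. V (x + r *\<^sub>R axis i 1) + V (x + (- r *\<^sub>R axis i 1)))"
        if "finite I" for I :: "'n set"
        using that
      proof (induction I rule: finite_induct)
        case empty then show ?case by (simp add: convex_on_const)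
      next
        case (insert i I) then show ?case
          using sh[of "r *\<^sub>R axis i 1"] sh[of "- r *\<^sub>R axis i 1"]
          unfolding sum.insert[OF insert.hyps] by (intro convex_on_add)
      qed
      show "convex_on UNIV (\<lambda>x. ?w x + q x)"
        unfolding e by (intro convex_on_add convex_on_cmul sc) (auto simp: convex_on_const)
    qed
    from le_v[OF this, of x] n0
    show "(\<Sum>i\<in>UNIV. v (x + r *\<^sub>R axis i 1) + v (x - r *\<^sub>R axis i 1) - 2 * v x) \<le> ?c"
      by (simp add: sum_subtractf field_simps)
  next
    fix x assume touch: "\<forall>h. p x + h \<bullet> G x - \<Lambda> / 2 * (norm h)^2 \<le> p (x + h)"
    \<comment> \<open>The touching paraboloid is itself a competitor: adding \<open>q\<close>
      cancels its quadratic part and leaves an affine function.\<close>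
    let ?w = "\<lambda>y. p x + (y - x) \<bullet> G x - \<Lambda> / 2 * (norm (y - x))^2"
    have aff: "?w y + q y = p x - x \<bullet> G x - \<Lambda> / 2 * (x \<bullet> x) + y \<bullet> (G x + \<Lambda> *\<^sub>R x)" for y
      unfolding q_def dot_square_norm[symmetric] by (simp add: inner_simps inner_commute algebra_simps)
    have "convex_on UNIV (\<lambda>y. c + y \<bullet> D)" for c and D :: "real^'n"
      by (rule convex_onI) (simp_all add: inner_simps algebra_simps)
    then have "convex_on UNIV (\<lambda>y. ?w y + q y)" unfolding aff .
    moreover have "?w y \<le> p y" for y using spec[OF touch, of "y - x"] by simp
    ultimately have "?w \<in> W" by (simp add: W_def)
    from le_v[OF this, of x] vp[of x] show "v x = p x" by simp
  qed
qed

section \<open>Mollification\<close>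

lemma GDERIV_quadratic_remainder:
  assumes "\<And>h. norm h \<le> 1 \<Longrightarrow> \<bar>f (x + h) - f x - h \<bullet> D\<bar> \<le> C * (norm h)^2"
  shows "GDERIV f x :> D"
  unfolding gderiv_def
proof (rule has_derivativeI_sandwich[where e = 1 and H = "\<lambda>y. C * norm (y - x)"])
  show "bounded_linear (\<lambda>h. h \<bullet> D)" by (rule bounded_linear_inner_left)
  show "((\<lambda>y. C * norm (y - x)) \<longlongrightarrow> 0) (at x within UNIV)"
    by (rule tendsto_eq_intros | simp)+
  fix y assume y: "y \<noteq> x" "dist y x < 1"
  have "\<bar>f y - f x - (y - x) \<bullet> D\<bar> \<le> C * (norm (y - x))^2"
    using assms[of "y - x"] y by (simp add: dist_norm)
  then show "norm (f y - f x - (y - x) \<bullet> D) / norm (y - x) \<le> C * norm (y - x)"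
    using y by (simp add: divide_simps power2_eq_square mult.assoc)
qed simp

lemma lipschitz_gradient_remainder:
  fixes f :: "'a::real_inner \<Rightarrow> real"
  assumes "\<And>x. GDERIV f x :> F x" "\<And>x y. norm (F y - F x) \<le> L * norm (y - x)" "0 \<le> L"
  shows "\<bar>f (z + h) - f z - h \<bullet> F z\<bar> \<le> L * (norm h)^2"
proof -
  obtain s where s: "0 < s" "s < 1" "f (z + 1 *\<^sub>R h) - f (z + 0 *\<^sub>R h) = (1 - 0) * (h \<bullet> F (z + s *\<^sub>R h))"
    using MVT2[of 0 1 "\<lambda>s. f (z + s *\<^sub>R h)" "\<lambda>s. h \<bullet> F (z + s *\<^sub>R h)"] GDERIV_line[OF assms(1)] by auto
  then have "\<bar>f (z + h) - f z - h \<bullet> F z\<bar> = \<bar>h \<bullet> (F (z + s *\<^sub>R h) - F z)\<bar>" by (simp add: inner_diff_right)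
  also have "\<dots> \<le> norm h * norm (F (z + s *\<^sub>R h) - F z)" by (rule Cauchy_Schwarz_ineq2)
  also have "\<dots> \<le> norm h * (L * norm (s *\<^sub>R h))"
    using assms(2)[of "z + s *\<^sub>R h" z] by (intro mult_left_mono) auto
  also have "\<dots> \<le> norm h * (L * (1 * norm h))"
    using s assms(3) unfolding norm_scaleR by (intro mult_left_mono mult_right_mono) auto
  finally show ?thesis by (simp add: power2_eq_square ac_simps)
qed

lemma lipschitz_vec:
  fixes G :: "'a::real_inner \<Rightarrow> real^'n"
  assumes "\<And>x i. GDERIV (\<lambda>x. G x $ i) x :> H x i" "\<And>x i. norm (H x i) \<le> B"
  shows "norm (G y - G x) \<le> real CARD('n) * B * norm (y - x)"
proof -
  have "norm (G y - G x) \<le> (\<Sum>i\<in>UNIV. \<bar>(G y - G x) $ i\<bar>)" by (rule norm_le_l1_cart)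
  also have "\<dots> \<le> (\<Sum>i\<in>(UNIV::'n set). B * norm (y - x))"
    unfolding vector_minus_component by (rule sum_mono) (rule GDERIV_bound_imp_lipschitz[OF assms])
  finally show ?thesis by simp
qed

definition conv :: "('a::euclidean_space \<Rightarrow> real) \<Rightarrow> ('a \<Rightarrow> real) \<Rightarrow> 'a \<Rightarrow> real" where
  "conv v \<phi> x = (LBINT y. v y * \<phi> (x - y))"

lemma conv_integrable:
  fixes v \<phi> :: "'a::euclidean_space \<Rightarrow> real"
  assumes "continuous_on UNIV v" "continuous_on UNIV \<phi>" "\<And>z. R \<le> norm z \<Longrightarrow> \<phi> z = 0"
  shows "integrable lborel (\<lambda>y. v y * \<phi> (x - y))"
proof (rule compact_support_integrable[where R = "norm x + R"])
  show "continuous_on UNIV (\<lambda>y. v y * \<phi> (x - y))"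
    by (intro continuous_intros assms(1) continuous_on_compose2[OF assms(2)]) auto
  fix y :: 'a assume "norm x + R \<le> norm y"
  then have "R \<le> norm (x - y)" using norm_triangle_ineq2[of y x] by (simp add: norm_minus_commute)
  then show "v y * \<phi> (x - y) = 0" using assms(3) by simp
qed

lemma abs_integral_local_le:
  fixes v \<psi> :: "'a::euclidean_space \<Rightarrow> real"
  assumes "continuous_on UNIV v" "continuous_on UNIV \<psi>" "\<And>y. \<bar>v y\<bar> \<le> V"
    and "\<And>y. \<bar>\<psi> y\<bar> \<le> c" "\<And>y. y \<notin> ball x R \<Longrightarrow> \<psi> y = 0" "0 \<le> R"
  shows "\<bar>LBINT y. v y * \<psi> y\<bar> \<le> V * c * (unit_ball_vol (real DIM('a)) * R ^ DIM('a))"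
proof -
  have V: "0 \<le> V" "0 \<le> c" using assms(3,4)[of x] by linarith+
  have far: "y \<notin> ball x R" if "norm x + R \<le> norm y" for y
    using that norm_triangle_ineq2[of y x] by (simp add: dist_norm norm_minus_commute)
  have i: "integrable lborel (\<lambda>y. v y * \<psi> y)"
    by (rule compact_support_integrable[where R = "norm x + R"]) (use far assms in \<open>auto intro!: continuous_intros\<close>)
  have "integrable lborel (indicat_real (ball x R))"
    using emeasure_bounded_finite[of "ball x R"] by (intro integrable_real_indicator) auto
  then have j: "integrable lborel (\<lambda>y. V * c * indicat_real (ball x R) y)" by (rule integrable_mult_right)
  have "\<bar>LBINT y. v y * \<psi> y\<bar> \<le> (LBINT y. V * c * indicat_real (ball x R) y)"
  proof (rule order_trans[OF integral_abs_bound integral_mono])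
    fix y show "\<bar>v y * \<psi> y\<bar> \<le> V * c * indicat_real (ball x R) y"
      using assms(3,4)[of y] assms(5)[of y] V
      by (cases "y \<in> ball x R") (auto simp: abs_mult simp del: mem_ball intro!: mult_mono)
  qed (use i j in auto)
  then show ?thesis using content_ball[OF assms(6), of x] by simp
qed

text \<open>All differentiability sits in \<open>\<phi>\<close>. A Lipschitz gradient makes the
  Taylor remainder of \<open>\<phi>\<close> quadratic uniformly, and integrating it against the
  bounded \<open>v\<close> over a fixed ball keeps it quadratic.\<close>

lemma GDERIV_conv:
  fixes v \<phi> :: "real^'n \<Rightarrow> real"
  assumes v: "continuous_on UNIV v" "\<And>y. \<bar>v y\<bar> \<le> V"
    and \<phi>: "\<And>z. GDERIV \<phi> z :> \<Phi> z" "\<And>y z. norm (\<Phi> y - \<Phi> z) \<le> L * norm (y - z)" "0 \<le> L"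
    and supp: "\<And>z. R \<le> norm z \<Longrightarrow> \<phi> z = 0" "\<And>z. R \<le> norm z \<Longrightarrow> \<Phi> z = 0"
  shows "GDERIV (conv v \<phi>) x :> (\<chi> i. conv v (\<lambda>z. \<Phi> z $ i) x)"
proof (rule GDERIV_quadratic_remainder)
  have \<phi>c: "continuous_on UNIV \<phi>" by (rule GDERIV_imp_continuous_on[OF \<phi>(1)])
  have \<Phi>c: "continuous_on UNIV \<Phi>"
    using \<phi>(2,3) by (intro lipschitz_on_continuous_on[of L]) (auto simp: lipschitz_on_def dist_norm)
  have \<Phi>ci: "continuous_on UNIV (\<lambda>z. \<Phi> z $ i)" for i
    by (intro continuous_on_component \<Phi>c)
  fix h :: "real^'n" assume h: "norm h \<le> 1"
  have i1: "integrable lborel (\<lambda>y. v y * \<phi> (x + h - y))" "integrable lborel (\<lambda>y. v y * \<phi> (x - y))"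
    by (rule conv_integrable[OF v(1) \<phi>c supp(1)], assumption)+
  have i2: "integrable lborel (\<lambda>y. v y * \<Phi> (x - y) $ i)" for i
    by (rule conv_integrable[OF v(1) \<Phi>ci, where R = R]) (simp add: supp)
  have i3: "integrable lborel (\<lambda>y. v y * (h \<bullet> \<Phi> (x - y)))"
    by (rule conv_integrable[OF v(1), where R = R]) (auto intro!: continuous_intros \<Phi>c simp: supp)
  have "h \<bullet> (\<chi> i. conv v (\<lambda>z. \<Phi> z $ i) x) = (\<Sum>i\<in>UNIV. h $ i * (LBINT y. v y * \<Phi> (x - y) $ i))"
    by (simp add: inner_vec_def conv_def)
  also have "\<dots> = (LBINT y. (\<Sum>i\<in>UNIV. h $ i * (v y * \<Phi> (x - y) $ i)))"
    by (subst Bochner_Integration.integral_sum) (auto intro!: integrable_mult_right i2)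
  also have "\<dots> = (LBINT y. v y * (h \<bullet> \<Phi> (x - y)))"
    by (simp add: inner_vec_def sum_distrib_left mult.left_commute)
  finally have e: "conv v \<phi> (x + h) - conv v \<phi> x - h \<bullet> (\<chi> i. conv v (\<lambda>z. \<Phi> z $ i) x)
      = (LBINT y. v y * (\<phi> (x + h - y) - \<phi> (x - y) - h \<bullet> \<Phi> (x - y)))"
    using i1 i3 by (simp add: conv_def right_diff_distrib)
  \<comment> \<open>Shifts of norm at most 1 keep both supports within radius
    \<open>\<bar>R\<bar> + 1\<close>; the absolute value is there because the sign of
    \<open>R\<close> is unspecified.\<close>
  have R0: "0 \<le> \<bar>R\<bar> + 1" by simp
  have "\<bar>LBINT y. v y * (\<phi> (x + h - y) - \<phi> (x - y) - h \<bullet> \<Phi> (x - y))\<bar>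
     \<le> V * (L * (norm h)^2) * (unit_ball_vol (real DIM(real^'n)) * (\<bar>R\<bar> + 1) ^ DIM(real^'n))"
  proof (rule abs_integral_local_le[OF v(1) _ v(2) _ _ R0])
    show "continuous_on UNIV (\<lambda>y. \<phi> (x + h - y) - \<phi> (x - y) - h \<bullet> \<Phi> (x - y))"
      by (intro continuous_intros continuous_on_compose2[OF \<phi>c] continuous_on_compose2[OF \<Phi>c]) auto
    show "\<bar>\<phi> (x + h - y) - \<phi> (x - y) - h \<bullet> \<Phi> (x - y)\<bar> \<le> L * (norm h)^2" for y
      using lipschitz_gradient_remainder[OF \<phi>, of "x - y" h] by (simp add: algebra_simps)
    fix y assume "y \<notin> ball x (\<bar>R\<bar> + 1)"
    then have "\<bar>R\<bar> + 1 \<le> norm (x - y)" by (simp add: dist_norm)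
    moreover have "norm (x - y) - norm h \<le> norm (x + h - y)"
      using norm_triangle_ineq2[of "x - y" "- h"] by (simp add: algebra_simps)
    ultimately have "R \<le> norm (x - y)" "R \<le> norm (x + h - y)" using h by auto
    then show "\<phi> (x + h - y) - \<phi> (x - y) - h \<bullet> \<Phi> (x - y) = 0" by (simp add: supp)
  qed
  then show "\<bar>conv v \<phi> (x + h) - conv v \<phi> x - h \<bullet> (\<chi> i. conv v (\<lambda>z. \<Phi> z $ i) x)\<bar>
      \<le> V * L * (unit_ball_vol (real DIM(real^'n)) * (\<bar>R\<bar> + 1) ^ DIM(real^'n)) * (norm h)^2"
    unfolding e by (simp add: ac_simps)
qed

lemma conv_continuous:
  fixes v \<phi> :: "'a::euclidean_space \<Rightarrow> real"
  assumes v: "continuous_on UNIV v" "\<And>y. \<bar>v y\<bar> \<le> V"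
    and \<phi>: "continuous_on UNIV \<phi>" "\<And>y z. \<bar>\<phi> y - \<phi> z\<bar> \<le> L * norm (y - z)" "\<And>z. R \<le> norm z \<Longrightarrow> \<phi> z = 0"
  shows "continuous_on UNIV (conv v \<phi>)"
proof -
  let ?C = "unit_ball_vol (real DIM('a)) * (\<bar>R\<bar> + 1) ^ DIM('a)"
  have "isCont (conv v \<phi>) x" for x
    unfolding isCont_def
  proof (rule LIM_offset_zero_cancel, rule Lim_null[THEN iffD2], rule Lim_null_comparison)
    show "\<forall>\<^sub>F h in at 0. norm (conv v \<phi> (x + h) - conv v \<phi> x) \<le> V * (L * norm h) * ?C"
      unfolding eventually_at
    proof (intro exI[of _ 1] conjI ballI impI)
      fix h :: 'a assume "h \<noteq> 0 \<and> dist h 0 < 1"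
      then have h: "norm h < 1" by simp
      have i1: "integrable lborel (\<lambda>y. v y * \<phi> (x + h - y))" "integrable lborel (\<lambda>y. v y * \<phi> (x - y))"
        by (rule conv_integrable[OF v(1) \<phi>(1) \<phi>(3)], assumption)+
      have "\<bar>LBINT y. v y * (\<phi> (x + h - y) - \<phi> (x - y))\<bar> \<le> V * (L * norm h) * ?C"
      proof (rule abs_integral_local_le[OF v(1) _ v(2), where x = x])
        show "continuous_on UNIV (\<lambda>y. \<phi> (x + h - y) - \<phi> (x - y))"
          by (intro continuous_intros continuous_on_compose2[OF \<phi>(1)]) auto
        show "\<bar>\<phi> (x + h - y) - \<phi> (x - y)\<bar> \<le> L * norm h" for y using \<phi>(2)[of "x + h - y" "x - y"] by simp
        fix y assume "y \<notin> ball x (\<bar>R\<bar> + 1)"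
        then have "\<bar>R\<bar> + 1 \<le> norm (x - y)" by (simp add: dist_norm)
        moreover have "norm (x - y) - norm h \<le> norm (x + h - y)"
          using norm_triangle_ineq2[of "x - y" "- h"] by (simp add: algebra_simps)
        ultimately have "R \<le> norm (x - y)" "R \<le> norm (x + h - y)" using h by auto
        then show "\<phi> (x + h - y) - \<phi> (x - y) = 0" by (simp add: \<phi>(3))
      qed simp
      then show "norm (conv v \<phi> (x + h) - conv v \<phi> x) \<le> V * (L * norm h) * ?C"
        using i1 by (simp add: conv_def right_diff_distrib)
    qed simp
    show "((\<lambda>h. V * (L * norm h) * ?C) \<longlongrightarrow> 0) (at 0)"
      by (rule tendsto_eq_intros | simp)+
  qed
  then show ?thesis by (simp add: continuous_at_imp_continuous_on)
qed

text \<open>Evenness of \<open>\<phi>\<close> turns the convolution into a weighted mean of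
  translates of \<open>v\<close>, the form in which inequalities for second differences pass from
  \<open>v\<close> to its mollification.\<close>

lemma conv_eq_average:
  fixes v \<phi> :: "'a::euclidean_space \<Rightarrow> real"
  assumes "continuous_on UNIV v" "continuous_on UNIV \<phi>" "\<And>z. \<phi> (- z) = \<phi> z"
  shows "conv v \<phi> x = (LBINT z. \<phi> z * v (x + z))"
proof -
  have "continuous_on UNIV (\<lambda>y. v y * \<phi> (x - y))"
    by (intro continuous_intros assms(1) continuous_on_compose2[OF assms(2)]) auto
  then have "(\<lambda>y. v y * \<phi> (x - y)) \<in> borel_measurable borel" by (rule borel_measurable_continuous_onI)
  from lborel_integral_translate[OF this, of x] show ?thesis
    by (simp add: conv_def assms(3) mult.commute)
qed

lemma mollification:
  fixes v :: "real^'n \<Rightarrow> real"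
  assumes v: "continuous_on UNIV v" "\<And>y. \<bar>v y\<bar> \<le> V" and \<eta>: "0 < \<eta>"
  obtains \<beta> F FG FH where "continuous_on UNIV \<beta>" "\<And>z. 0 \<le> \<beta> z" "\<And>z. \<eta> \<le> norm z \<Longrightarrow> \<beta> z = 0"
    "(LBINT z. \<beta> z) = 1" "\<And>x. F x = (LBINT z. \<beta> z * v (x + z))"
    "has_hessian F FG FH" "continuous_on UNIV FH" "\<And>x i j. FH x $ i $ j = FH x $ j $ i"
proof -
  define b where "b z = bump 5 ((1 / \<eta>) *\<^sub>R (z - 0))" for z :: "real^'n"
  have supp: "1 \<le> norm ((1 / \<eta>) *\<^sub>R (z - 0))" if "\<eta> \<le> norm z" for z :: "real^'n"
    using that \<eta> by (simp add: field_simps)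
  have bc: "continuous_on UNIV b"
    unfolding b_def by (intro continuous_on_compose2[OF bump_continuous[of UNIV]] continuous_intros) auto
  have bi: "integrable lborel b"
    by (rule compact_support_integrable[OF bc, where R = \<eta>]) (unfold b_def, rule bump_eq_0[OF supp], auto)
  define I where "I = (LBINT z. b z)"
  \<comment> \<open>Normalisation requires positive mass: the bump is nonzero throughout the open
    ball of radius \<open>\<eta>\<close>, which is not a null set.\<close>
  have "I \<noteq> 0"
  proof
    assume "I = 0"
    moreover have "AE z in lborel. 0 \<le> b z" by (simp add: b_def bump_nonneg)
    ultimately have ae: "AE z in lborel. b z = 0"
      using integral_nonneg_eq_0_iff_AE[OF bi] by (simp add: I_def)
    have nz: "b z \<noteq> 0" if "z \<in> ball 0 \<eta>" for z
    proof -
      have "norm ((1 / \<eta>) *\<^sub>R z) < 1" using that \<eta> by (simp add: field_simps)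
      then have "(norm ((1 / \<eta>) *\<^sub>R z))^2 < 1^2" by (intro power_strict_mono) auto
      then show ?thesis unfolding b_def bump_def dot_square_norm by simp
    qed
    have "AE z in lborel. z \<notin> ball (0::real^'n) \<eta>" by (rule eventually_mono[OF ae]) (use nz in blast)
    then have "emeasure lborel (ball (0::real^'n) \<eta>) = 0"
      by (subst (asm) AE_iff_measurable[OF _ refl]) (auto simp: ball_def)
    then show False using \<eta> unit_ball_vol_pos[of "real CARD('n)"] by (auto simp: emeasure_ball)
  qed
  moreover have "0 \<le> I" unfolding I_def by (intro integral_nonneg_AE) (simp add: b_def bump_nonneg)
  ultimately have I: "0 < I" by simp
  define c where "c = 1 / I"
  define \<beta> where "\<beta> z = c * bump 5 ((1 / \<eta>) *\<^sub>R (z - 0))" for z :: "real^'n"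
  define \<beta>G where "\<beta>G z = (c * (1 / \<eta>)) *\<^sub>R bump_G ((1 / \<eta>) *\<^sub>R (z - 0))" for z :: "real^'n"
  define \<beta>H where "\<beta>H z = (c * (1 / \<eta>)^2) *\<^sub>R bump_H ((1 / \<eta>) *\<^sub>R (z - 0))" for z :: "real^'n"
  define \<beta>T where "\<beta>T z i j = (c * (1 / \<eta>)^2 * (1 / \<eta>)) *\<^sub>R bump_T ((1 / \<eta>) *\<^sub>R (z - 0)) i j" for z :: "real^'n" and i j
  have hb: "has_hessian \<beta> \<beta>G \<beta>H"
    unfolding \<beta>_def[abs_def] \<beta>G_def[abs_def] \<beta>H_def[abs_def] by (rule has_hessian_dilation[OF has_hessian_bump])
  have tb: "has_third \<beta>H \<beta>T"
    unfolding \<beta>H_def[abs_def] \<beta>T_def[abs_def] by (rule has_third_dilation[OF has_third_bump])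
  have b0: "\<beta> z = 0" "\<beta>G z = 0" "\<beta>H z = 0" "\<beta>T z i j = 0" if "\<eta> \<le> norm z" for z i j
    unfolding \<beta>_def \<beta>G_def \<beta>H_def \<beta>T_def using supp[OF that] by (simp_all only: bump_eq_0 bump_derivs_eq_0) auto
  have Tc: "continuous_on UNIV (\<lambda>z. \<beta>T z i j)" for i j
    unfolding \<beta>T_def
    by (rule continuous_on_scaleR[OF continuous_on_const continuous_on_compose2[OF bump_T_continuous]])
      (auto intro!: continuous_intros)
  obtain M1 where M10: "0 \<le> M1" and TM: "\<And>z i j. norm (\<beta>T z i j) \<le> M1"
    by (rule third_bounded_of_compact_support[where T = \<beta>T and R = \<eta>])
      (rule Tc, rule b0(4), assumption, rule that, assumption+)
  have Hc: "continuous_on UNIV \<beta>H" by (rule has_third_continuous[OF tb])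
  have "continuous_on UNIV (\<lambda>z. norm (\<beta>H z))" by (intro continuous_intros Hc)
  then obtain M2 where "0 \<le> M2" and M2: "\<And>z. \<bar>norm (\<beta>H z)\<bar> \<le> M2"
    by (rule bounded_of_compact_support[where R = \<eta>]) (use b0 in auto)
  let ?n = "real CARD('n)"
  have lipG: "norm (\<beta>G y - \<beta>G z) \<le> (?n * M2) * norm (y - z)" for y z
    by (rule lipschitz_vec[OF has_hessianD(2)[OF hb]])
      (rule order_trans[OF Finite_Cartesian_Product.norm_nth_le], use M2 in auto)
  have lipH: "norm (\<beta>H y $ i - \<beta>H z $ i) \<le> (?n * M1) * norm (y - z)" for y z i
    by (rule lipschitz_vec[of "\<lambda>z. \<beta>H z $ i" "\<lambda>z j. \<beta>T z i j"]) (use tb TM in \<open>auto simp: has_third_def\<close>)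
  define F where "F = conv v \<beta>"
  define FG where "FG x = (\<chi> i. conv v (\<lambda>z. \<beta>G z $ i) x)" for x
  define FH where "FH x = (\<chi> i j. conv v (\<lambda>z. \<beta>H z $ i $ j) x)" for x
  have h1: "GDERIV F x :> FG x" for x
    unfolding F_def FG_def
    by (rule GDERIV_conv[OF v has_hessianD(1)[OF hb] lipG, where R = \<eta>])
      (use b0 \<open>0 \<le> M2\<close> in auto)
  have h2: "GDERIV (\<lambda>x. FG x $ i) x :> FH x $ i" for x i
  proof -
    have "GDERIV (conv v (\<lambda>z. \<beta>G z $ i)) x :> (\<chi> j. conv v (\<lambda>z. \<beta>H z $ i $ j) x)"
      by (rule GDERIV_conv[OF v has_hessianD(2)[OF hb] lipH, where R = \<eta>])
        (use b0 M10 in auto)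
    then show ?thesis by (simp add: FG_def FH_def)
  qed
  have \<beta>c: "continuous_on UNIV \<beta>" using has_hessian_continuous(1)[OF hb] .
  show ?thesis
  proof (rule that[of \<beta> F FG FH])
    show "continuous_on UNIV \<beta>" by (rule \<beta>c)
    show "0 \<le> \<beta> z" for z using I by (simp add: \<beta>_def c_def bump_nonneg)
    show "\<beta> z = 0" if "\<eta> \<le> norm z" for z using b0 that by auto
    have "(LBINT z. \<beta> z) = c * I" unfolding \<beta>_def I_def b_def by (rule integral_mult_right_zero)
    then show "(LBINT z. \<beta> z) = 1" using I by (simp add: c_def)
    show "F x = (LBINT z. \<beta> z * v (x + z))" for x
      unfolding F_def by (rule conv_eq_average[OF v(1) \<beta>c]) (simp add: \<beta>_def bump_def)
    show "has_hessian F FG FH" unfolding has_hessian_def using h1 h2 by blast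
    have "continuous_on UNIV (conv v (\<lambda>z. \<beta>H z $ i $ j))" for i j
      by (rule conv_continuous[OF v, where L = M1 and R = \<eta>])
        (use tb TM b0 in \<open>auto simp: has_third_def intro!: GDERIV_bound_imp_lipschitz[where f = "\<lambda>z. \<beta>H z $ i $ j" and G = "\<lambda>z. \<beta>T z i j"]
          continuous_on_component Hc\<close>)
    then show "continuous_on UNIV FH" unfolding FH_def by (intro continuous_on_vec_lambda)
    have "(\<lambda>z. \<beta>H z $ i $ j) = (\<lambda>z. \<beta>H z $ j $ i)" for i j by (auto simp: \<beta>H_def bump_H_def)
    then show "FH x $ i $ j = FH x $ j $ i" for x i j by (simp add: FH_def)
  qed
qed

text \<open>Continuity of the Hessian traps the quotient between values within \<open>e / 2\<close>
  of the limit. It converts difference inequalities, which survive mollification, into bounds on the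
  Hessian.\<close>

lemma second_difference_tendsto:
  fixes F :: "real^'n \<Rightarrow> real"
  assumes hess: "has_hessian F FG FH" and cont: "continuous_on UNIV FH"
  shows "((\<lambda>r. (F (x + r *\<^sub>R h) + F (x - r *\<^sub>R h) - 2 * F x) / r^2) \<longlongrightarrow> h \<bullet> (FH x *v h)) (at_right 0)"
proof (rule tendstoI)
  fix e :: real assume e: "0 < e"
  let ?q = "\<lambda>y. h \<bullet> (FH y *v h)"
  have "continuous_on UNIV ?q"
    unfolding matrix_vector_mult_def inner_vec_def inner_real_def vec_lambda_beta
    by (intro continuous_intros continuous_on_component cont)
  then have "isCont ?q x" by (simp add: continuous_on_eq_continuous_at)
  then obtain d where d: "0 < d" "\<And>y. dist y x < d \<Longrightarrow> dist (?q y) (?q x) < e / 2"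
    using e unfolding continuous_at_eps_delta by (metis half_gt_zero)
  show "\<forall>\<^sub>F r in at_right 0. dist ((F (x + r *\<^sub>R h) + F (x - r *\<^sub>R h) - 2 * F x) / r^2) (?q x) < e"
    unfolding eventually_at_right_field
  proof (intro exI[of _ "d / (norm h + 1)"] conjI allI impI)
    have hn: "0 < norm h + 1" by (simp add: add_nonneg_pos)
    then show "0 < d / (norm h + 1)" using d(1) by simp
    fix r :: real assume r: "0 < r" "r < d / (norm h + 1)"
    have rh: "r * norm h < d"
    proof -
      have "r * norm h \<le> r * (norm h + 1)" using r by simp
      also have "\<dots> < d" using r(2) hn by (simp add: field_simps)
      finally show ?thesis .
    qed
    let ?s = "F (x + r *\<^sub>R h) + F (x - r *\<^sub>R h) - 2 * F x"
    have b: "r^2 * (?q x - e / 2) \<le> (r *\<^sub>R h) \<bullet> (FH (x + s *\<^sub>R (r *\<^sub>R h)) *v (r *\<^sub>R h)) \<and>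
       (r *\<^sub>R h) \<bullet> (FH (x + s *\<^sub>R (r *\<^sub>R h)) *v (r *\<^sub>R h)) \<le> r^2 * (?q x + e / 2)" if s: "\<bar>s\<bar> \<le> 1" for s
    proof -
      let ?y = "x + s *\<^sub>R (r *\<^sub>R h)"
      have "dist ?y x = \<bar>s\<bar> * (r * norm h)" using r by (simp add: dist_norm abs_mult)
      also have "\<dots> \<le> 1 * (r * norm h)" using s r by (intro mult_right_mono) auto
      finally have "\<bar>?q ?y - ?q x\<bar> < e / 2" using d(2)[of ?y] rh by (simp add: dist_real_def)
      then have "?q x - e / 2 \<le> ?q ?y" "?q ?y \<le> ?q x + e / 2" by linarith+
      moreover have "(r *\<^sub>R h) \<bullet> (FH ?y *v (r *\<^sub>R h)) = r^2 * ?q ?y"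
        by (simp add: matrix_vector_mult_scaleR power2_eq_square)
      ultimately show ?thesis by (simp only:) (intro conjI mult_left_mono, auto)
    qed
    have "r^2 * (?q x - e / 2) \<le> ?s" "?s \<le> r^2 * (?q x + e / 2)"
      using second_difference_bounds[OF hess b] by auto
    then have "?q x - e / 2 \<le> ?s / r^2" "?s / r^2 \<le> ?q x + e / 2"
      using r(1) by (auto simp: field_simps)
    then show "dist (?s / r^2) (?q x) < e" using e by (simp add: dist_real_def abs_le_iff)
  qed
qed

text \<open>Mollifying preserves semiconvexity, the Laplacian bound and the range
  [0, \<open>\<epsilon>\<close>]. Smallness of the gradient is interpolation between that range and
  semiconvexity. For the entries, the lower Hessian bound and the trace bound together control the
  diagonal, and the directions \<open>e_i + e_j\<close> and \<open>e_i - e_j\<close> control the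
  rest. The last conclusion localises: where \<open>p\<close> is touched on the whole ball,
  \<open>F\<close> at the centre averages \<open>p\<close> itself.\<close>

lemma smooth_semiconvex_envelope:
  fixes p :: "real^'n \<Rightarrow> real"
  assumes hess: "has_hessian p G H" and third: "has_third H T" "\<And>x i j. norm (T x i j) \<le> B"
    and p: "\<And>x. 0 \<le> p x" "\<And>x. p x \<le> \<epsilon>" and \<Lambda>: "0 \<le> \<Lambda>" and tr: "\<And>x. trace (H x) \<le> \<delta>"
    and \<eta>: "0 < \<eta>"
  obtains F FG FH where "has_hessian F FG FH" "continuous_on UNIV FH"
    "\<And>x. (norm (FG x))^2 \<le> 2 * (\<Lambda> + 1) * \<epsilon>" "\<And>x i j. \<bar>FH x $ i $ j\<bar> \<le> \<bar>\<delta>\<bar> + real CARD('n) * \<Lambda>"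
    "\<And>x. trace (FH x) \<le> \<delta>"
    "\<And>x c. \<forall>y\<in>ball x \<eta>. \<forall>h. p y + h \<bullet> G y - \<Lambda> / 2 * (norm h)^2 \<le> p (y + h) \<Longrightarrow>
       \<forall>y\<in>ball x \<eta>. trace (H y) \<le> c \<Longrightarrow> trace (FH x) \<le> c"
proof -
  obtain v where vc: "continuous_on UNIV v" and v0: "\<And>x. 0 \<le> v x" and vp: "\<And>x. v x \<le> p x"
    and conv: "convex_on UNIV (\<lambda>x. v x + \<Lambda> / 2 * (x \<bullet> x))"
    and lap: "\<And>x r. 0 \<le> r \<Longrightarrow> (\<Sum>i\<in>UNIV. v (x + r *\<^sub>R axis i 1) + v (x - r *\<^sub>R axis i 1) - 2 * v x)
       \<le> \<delta> * r^2 + real CARD('n) * B * r^3"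
    and touch: "\<And>x. (\<forall>h. p x + h \<bullet> G x - \<Lambda> / 2 * (norm h)^2 \<le> p (x + h)) \<Longrightarrow> v x = p x"
    by (rule semiconvex_envelope[OF hess third p(1) \<Lambda> tr]) (rule that, assumption+)
  have v\<epsilon>: "v x \<le> \<epsilon>" for x by (rule order_trans[OF vp p(2)])
  have "\<bar>v x\<bar> \<le> \<epsilon>" for x using v0[of x] v\<epsilon>[of x] by simp
  \<comment> \<open>Half of \<open>\<eta>\<close> goes to the mollifier; the other half is reserved
    for the difference steps, so that all points involved stay in the ball of radius
    \<open>\<eta>\<close>.\<close>
  moreover have "0 < \<eta> / 2" using \<eta> by simp
  ultimately obtain \<beta> F FG FH where \<beta>: "continuous_on UNIV \<beta>" "\<And>z. 0 \<le> \<beta> z" "\<And>z. \<eta> / 2 \<le> norm z \<Longrightarrow> \<beta> z = 0"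
    "(LBINT z. \<beta> z) = 1" and Fv: "\<And>x. F x = (LBINT z. \<beta> z * v (x + z))"
    and hF: "has_hessian F FG FH" and FHc: "continuous_on UNIV FH" and sym: "\<And>x i j. FH x $ i $ j = FH x $ j $ i"
    by (rule mollification[OF vc]) (rule that, assumption+)
  have bi: "integrable lborel (\<lambda>z. \<beta> z * w z)" if "continuous_on UNIV w" for w
    by (rule compact_support_integrable[where R = "\<eta> / 2"]) (use \<beta>(3) in \<open>auto intro!: continuous_intros \<beta>(1) that\<close>)
  have vs: "continuous_on UNIV (\<lambda>z. v (x + z))" for x
    by (intro continuous_on_compose2[OF vc] continuous_intros) auto
  have avg_const: "(LBINT z. \<beta> z * c) = c" for c using \<beta>(4) by simp
  have avg_le: "(LBINT z. \<beta> z * w z) \<le> c"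
    if "continuous_on UNIV w" "\<And>z. norm z < \<eta> / 2 \<Longrightarrow> w z \<le> c" for w c
  proof -
    have "(LBINT z. \<beta> z * w z) \<le> (LBINT z. \<beta> z * c)"
    proof (rule integral_mono[OF bi bi])
      fix z show "\<beta> z * w z \<le> \<beta> z * c"
        using that(2)[of z] \<beta>(2,3)[of z] by (cases "norm z < \<eta> / 2") (auto intro: mult_left_mono)
    qed (use that in auto)
    then show ?thesis by (simp only: avg_const)
  qed
  have avg_ge: "c \<le> (LBINT z. \<beta> z * w z)"
    if "continuous_on UNIV w" "\<And>z. norm z < \<eta> / 2 \<Longrightarrow> c \<le> w z" for w c
    using avg_le[of "\<lambda>z. - w z" "- c"] that by (auto intro: continuous_intros)
  have F0: "0 \<le> F x" "F x \<le> \<epsilon>" for x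
    unfolding Fv using avg_ge[OF vs] avg_le[OF vs] v0 v\<epsilon> by auto
  have sd: "F (x + k) + F (x - k) - 2 * F x = (LBINT z. \<beta> z * (v (x + z + k) + v (x + z - k) - 2 * v (x + z)))"
    for x k
  proof -
    have "\<beta> z * (v (x + z + k) + v (x + z - k) - 2 * v (x + z))
        = (\<beta> z * v (x + k + z) + \<beta> z * v (x - k + z)) - 2 * (\<beta> z * v (x + z))" for z
      by (simp add: algebra_simps)
    then show ?thesis
      using bi[OF vs[of x]] bi[OF vs[of "x + k"]] bi[OF vs[of "x - k"]] by (simp add: Fv)
  qed
  have sdc: "continuous_on UNIV (\<lambda>z. v (x + z + k) + v (x + z - k) - 2 * v (x + z))" for x k
    by (intro continuous_intros continuous_on_compose2[OF vc]) auto
  have mid: "- (\<Lambda> * (k \<bullet> k)) \<le> v (y + k) + v (y - k) - 2 * v y" for y k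
  proof -
    have y: "(1 - 1/2) *\<^sub>R (y + k) + (1/2) *\<^sub>R (y - k) = y"
      by (simp add: scaleR_add_right scaleR_diff_right)
    have "v y + \<Lambda> / 2 * (y \<bullet> y) \<le> (1 - 1/2) * (v (y + k) + \<Lambda> / 2 * ((y + k) \<bullet> (y + k))) + 1/2 * (v (y - k) + \<Lambda> / 2 * ((y - k) \<bullet> (y - k)))"
      using convex_onD[OF conv, of "1/2" "y + k" "y - k"] unfolding y by simp
    then show ?thesis by (simp add: inner_simps inner_commute algebra_simps)
  qed
  have quad: "- (\<Lambda> * (h \<bullet> h)) \<le> h \<bullet> (FH x *v h)" for x h
  proof (rule tendsto_lowerbound[OF second_difference_tendsto[OF hF FHc]])
    have "- (\<Lambda> * (h \<bullet> h)) \<le> (F (x + r *\<^sub>R h) + F (x - r *\<^sub>R h) - 2 * F x) / r^2" if r: "0 < r" for r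
    proof -
      have "- (\<Lambda> * ((r *\<^sub>R h) \<bullet> (r *\<^sub>R h))) \<le> F (x + r *\<^sub>R h) + F (x - r *\<^sub>R h) - 2 * F x"
        unfolding sd by (rule avg_ge[OF sdc mid])
      then show ?thesis using r by (simp add: field_simps power2_eq_square)
    qed
    then show "\<forall>\<^sub>F r in at_right 0. - (\<Lambda> * (h \<bullet> h)) \<le> (F (x + r *\<^sub>R h) + F (x - r *\<^sub>R h) - 2 * F x) / r^2"
      unfolding eventually_at_right_field by (intro exI[of _ 1]) auto
  qed simp
  have entry: "axis i 1 \<bullet> (A *v axis i 1) = A $ i $ i" for A :: "real^'n^'n" and i
    using quad_axis[of 1 i A] by simp
  have trace_le: "trace (FH x) \<le> c"
    if r1: "0 < r1" and *: "\<And>r z. 0 < r \<Longrightarrow> r < r1 \<Longrightarrow> norm z < \<eta> / 2 \<Longrightarrow>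
       (\<Sum>i\<in>UNIV. v (x + z + r *\<^sub>R axis i 1) + v (x + z - r *\<^sub>R axis i 1) - 2 * v (x + z)) \<le> c * r^2 + real CARD('n) * B * r^3"
    for x c r1
  proof (rule tendsto_le)
    show "((\<lambda>r. \<Sum>i\<in>UNIV. (F (x + r *\<^sub>R axis i 1) + F (x - r *\<^sub>R axis i 1) - 2 * F x) / r^2) \<longlongrightarrow> trace (FH x)) (at_right 0)"
      unfolding trace_def by (intro tendsto_sum) (use second_difference_tendsto[OF hF FHc, of x "axis _ 1"] in \<open>simp only: entry\<close>)
    show "((\<lambda>r. c + real CARD('n) * B * r) \<longlongrightarrow> c) (at_right 0)"
      by (rule tendsto_eq_intros | simp)+
    have "(\<Sum>i\<in>UNIV. (F (x + r *\<^sub>R axis i 1) + F (x - r *\<^sub>R axis i 1) - 2 * F x) / r^2) \<le> c + real CARD('n) * B * r"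
      if r: "0 < r" "r < r1" for r
    proof -
      have "(\<Sum>i\<in>UNIV. F (x + r *\<^sub>R axis i 1) + F (x - r *\<^sub>R axis i 1) - 2 * F x)
        = (LBINT z. \<beta> z * (\<Sum>i\<in>UNIV. v (x + z + r *\<^sub>R axis i 1) + v (x + z - r *\<^sub>R axis i 1) - 2 * v (x + z)))"
        unfolding sd sum_distrib_left by (rule Bochner_Integration.integral_sum[symmetric]) (rule bi[OF sdc])
      also have "\<dots> \<le> c * r^2 + real CARD('n) * B * r^3"
        by (rule avg_le) (auto intro!: continuous_on_sum sdc *[OF r])
      finally show ?thesis using r(1)
        by (simp add: sum_divide_distrib[symmetric] divide_le_eq algebra_simps power2_eq_square power3_eq_cube)
    qed
    then show "\<forall>\<^sub>F r in at_right 0. (\<Sum>i\<in>UNIV. (F (x + r *\<^sub>R axis i 1) + F (x - r *\<^sub>R axis i 1) - 2 * F x) / r^2) \<le> c + real CARD('n) * B * r"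
      unfolding eventually_at_right_field using r1 by (intro exI[of _ r1]) auto
  qed simp
  have tr\<delta>: "trace (FH x) \<le> \<delta>" for x
    by (rule trace_le[of 1]) (use lap in auto)
  show ?thesis
  proof (rule that[OF hF FHc])
    show "trace (FH x) \<le> \<delta>" for x by (rule tr\<delta>)
    fix x
    \<comment> \<open>A step of length \<open>t\<close> times the gradient, taken along the
      gradient. Since \<open>\<Lambda> * t \<le> 1\<close>, the quadratic loss eats at most half of
      the linear gain, and the total gain is at most \<open>\<epsilon>\<close>.\<close>
    define t where "t = 1 / (\<Lambda> + 1)"
    have T: "F x + (t *\<^sub>R FG x) \<bullet> FG x + - (\<Lambda> * ((t *\<^sub>R FG x) \<bullet> (t *\<^sub>R FG x))) / 2 \<le> F (x + t *\<^sub>R FG x)"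
      by (rule has_hessian_taylor_lower[OF hF]) (rule quad)
    have e: "(t *\<^sub>R FG x) \<bullet> FG x = t * (norm (FG x))^2"
      "(t *\<^sub>R FG x) \<bullet> (t *\<^sub>R FG x) = t^2 * (norm (FG x))^2"
      by (simp_all add: dot_square_norm power2_eq_square)
    have e': "\<Lambda> / 2 * t^2 * (norm (FG x))^2 = \<Lambda> * (t^2 * (norm (FG x))^2) / 2" by simp
    have "t * (norm (FG x))^2 - \<Lambda> / 2 * t^2 * (norm (FG x))^2 \<le> \<epsilon>"
      using F0(1)[of x] F0(2)[of "x + t *\<^sub>R FG x"] T unfolding e e' by linarith
    moreover have "t / 2 * (norm (FG x))^2 \<le> (t - \<Lambda> / 2 * t^2) * (norm (FG x))^2"
    proof (rule mult_right_mono)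
      have "\<Lambda> * t \<le> 1" "0 \<le> t" using \<Lambda> by (simp_all add: t_def)
      note mult_right_mono[OF this]
      moreover have "\<Lambda> / 2 * t^2 = \<Lambda> * t * t / 2" by (simp add: power2_eq_square)
      ultimately show "t / 2 \<le> t - \<Lambda> / 2 * t^2" by linarith
    qed simp
    ultimately have "t / 2 * (norm (FG x))^2 \<le> \<epsilon>" by (simp add: left_diff_distrib)
    then show "(norm (FG x))^2 \<le> 2 * (\<Lambda> + 1) * \<epsilon>" using \<Lambda> by (simp add: t_def field_simps)
  next
    fix x i j
    let ?n = "real CARD('n)"
    have d0: "- \<Lambda> \<le> FH x $ a $ a" for a using quad[of "axis a 1" x] by (simp add: entry)
    \<comment> \<open>One diagonal entry is the trace minus the others, each of which is at least
      \<open>- \<Lambda>\<close>.\<close>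
    have d1: "FH x $ a $ a \<le> \<bar>\<delta>\<bar> + (?n - 1) * \<Lambda>" for a
    proof -
      have "(\<Sum>b\<in>UNIV - {a}. - \<Lambda>) \<le> (\<Sum>b\<in>UNIV - {a}. FH x $ b $ b)" by (intro sum_mono d0)
      moreover have "trace (FH x) = FH x $ a $ a + (\<Sum>b\<in>UNIV - {a}. FH x $ b $ b)"
        unfolding trace_def by (rule sum.remove) auto
      ultimately show ?thesis using tr\<delta>[of x] by (simp add: card_Diff_singleton of_nat_diff algebra_simps)
    qed
    show "\<bar>FH x $ i $ j\<bar> \<le> \<bar>\<delta>\<bar> + ?n * \<Lambda>"
    proof (cases "i = j")
      case True
      have "\<Lambda> \<le> ?n * \<Lambda>" using \<Lambda> mult_right_mono[of 1 ?n \<Lambda>] by simp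
      then show ?thesis using True d0[of i] d1[of i] \<Lambda> by (simp add: abs_le_iff left_diff_distrib)
    next
      case False
      have q: "(axis i 1 + s *\<^sub>R axis j 1) \<bullet> (FH x *v (axis i 1 + s *\<^sub>R axis j 1))
         = FH x $ i $ i + 2 * s * FH x $ i $ j + s^2 * FH x $ j $ j"
        "(axis i 1 + s *\<^sub>R axis j 1) \<bullet> (axis i 1 + s *\<^sub>R axis j (1::real)) = 1 + s^2" for s
        using False sym[of x j i]
        by (simp_all add: matrix_vector_right_distrib matrix_vector_mult_scaleR inner_simps inner_axis' inner_axis_axis
            matrix_vector_mult_basis column_def power2_eq_square algebra_simps)
          (simp_all add: axis_def)
      have "- (\<Lambda> * 2) \<le> FH x $ i $ i + 2 * FH x $ i $ j + FH x $ j $ j"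
        "- (\<Lambda> * 2) \<le> FH x $ i $ i - 2 * FH x $ i $ j + FH x $ j $ j"
        using quad[of "axis i 1 + 1 *\<^sub>R axis j 1" x, unfolded q] quad[of "axis i 1 + (-1) *\<^sub>R axis j 1" x, unfolded q]
        by simp_all
      then show ?thesis using d1[of i] d1[of j] by (simp add: abs_le_iff left_diff_distrib)
    qed
  next
    fix x c assume t: "\<forall>y\<in>ball x \<eta>. \<forall>h. p y + h \<bullet> G y - \<Lambda> / 2 * (norm h)^2 \<le> p (y + h)"
      and c: "\<forall>y\<in>ball x \<eta>. trace (H y) \<le> c"
    show "trace (FH x) \<le> c"
    proof (rule trace_le[of "\<eta> / 2"])
      show "0 < \<eta> / 2" using \<eta> by simp
      fix r z assume r: "0 < r" "r < \<eta> / 2" and z: "norm (z::real^'n) < \<eta> / 2"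
      have b: "x + z + s *\<^sub>R axis i 1 \<in> ball x \<eta>" if "\<bar>s\<bar> \<le> r" for s and i :: 'n
      proof -
        have "norm (z + s *\<^sub>R axis i 1) \<le> norm z + \<bar>s\<bar>"
          using norm_triangle_ineq[of z "s *\<^sub>R axis i 1"] by (simp add: norm_axis_1)
        moreover have "dist x (x + z + s *\<^sub>R axis i 1) = norm (z + s *\<^sub>R axis i 1)"
          by (subst dist_commute) (simp add: dist_norm add.assoc)
        ultimately show ?thesis using that r z by simp
      qed
      have eq: "v y = p y" if "y \<in> ball x \<eta>" for y using touch[of y] t that by blast
      have "v (x + z + r *\<^sub>R axis i 1) = p (x + z + r *\<^sub>R axis i 1)"
        "v (x + z - r *\<^sub>R axis i 1) = p (x + z - r *\<^sub>R axis i 1)" "v (x + z) = p (x + z)" for i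
        using eq[OF b[of r i]] eq[OF b[of "- r" i]] eq[OF b[of 0 i]] r by auto
      then have "(\<Sum>i\<in>UNIV. v (x + z + r *\<^sub>R axis i 1) + v (x + z - r *\<^sub>R axis i 1) - 2 * v (x + z))
        = (\<Sum>i\<in>UNIV. p (x + z + r *\<^sub>R axis i 1) + p (x + z - r *\<^sub>R axis i 1) - 2 * p (x + z))" by simp
      also have "\<dots> \<le> trace (H (x + z)) * r^2 + real CARD('n) * B * r^3"
        using r by (intro discrete_laplacian_upper[OF hess third]) auto
      also have "\<dots> \<le> c * r^2 + real CARD('n) * B * r^3"
        using bspec[OF c b[of 0]] r by (intro add_right_mono mult_right_mono) auto
      finally show "(\<Sum>i\<in>UNIV. v (x + z + r *\<^sub>R axis i 1) + v (x + z - r *\<^sub>R axis i 1) - 2 * v (x + z))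
         \<le> c * r^2 + real CARD('n) * B * r^3" .
    qed
  qed
qed

section \<open>Balls on which a singular measure is large\<close>

text \<open>Otherwise the point dividing the segment from \<open>x\<close> to \<open>y\<close> in
  the ratio \<open>a : b\<close> lies in both balls.\<close>

lemma disjnt_cballs_imp_le_dist:
  fixes x y :: "'a::real_normed_vector"
  assumes "disjnt (cball x a) (cball y b)" "0 < a" "0 < b"
  shows "a + b \<le> dist x y"
proof (rule ccontr)
  assume "\<not> a + b \<le> dist x y"
  then have d: "norm (y - x) < a + b" by (simp add: dist_norm norm_minus_commute)
  let ?z = "x + (a / (a + b)) *\<^sub>R (y - x)"
  have "norm ((a / (a + b)) *\<^sub>R (y - x)) \<le> a"
    unfolding norm_scaleR using d assms mult_left_mono[of "norm (y - x)" "a + b" a] by (simp add: field_simps)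
  then have "?z \<in> cball x a" by (simp add: dist_norm)
  moreover have "y - ?z = (b / (a + b)) *\<^sub>R (y - x)"
  proof -
    have "b / (a + b) = 1 - a / (a + b)" using assms by (simp add: field_simps)
    then show ?thesis by (simp add: scaleR_diff_left)
  qed
  moreover have "norm ((b / (a + b)) *\<^sub>R (y - x)) \<le> b"
    unfolding norm_scaleR using d assms mult_left_mono[of "norm (y - x)" "a + b" b] by (simp add: field_simps)
  ultimately have "?z \<in> cball y b" by (simp add: dist_norm)
  with \<open>?z \<in> cball x a\<close> assms(1) show False by (auto simp: disjnt_def)
qed

lemma sum_measure_disjoint_le:
  assumes "finite_measure M" "finite F" "disjoint_family_on B F" "\<And>j. j \<in> F \<Longrightarrow> B j \<in> sets M"
  shows "(\<Sum>j\<in>F. measure M (B j)) \<le> measure M (space M)"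
proof -
  interpret finite_measure M by fact
  have "(\<Sum>j\<in>F. measure M (B j)) = measure M (\<Union>j\<in>F. B j)"
    using assms by (intro finite_measure_finite_Union[symmetric]) auto
  also have "\<dots> \<le> measure M (space M)" by (rule bounded_measure)
  finally show ?thesis .
qed

lemma finite_of_card_mult_bounded:
  fixes c b :: real
  assumes "0 < c" "\<And>F. F \<subseteq> C \<Longrightarrow> finite F \<Longrightarrow> real (card F) * c \<le> b"
  shows "finite C"
proof -
  have "card F \<le> nat \<lceil>b / c\<rceil>" if "F \<subseteq> C" "finite F" for F
  proof -
    have "real (card F) \<le> b / c" using assms(2)[OF that] assms(1) by (simp add: field_simps)
    then show ?thesis by linarith
  qed
  then show ?thesis using finite_if_finite_subsets_card_bdd[of C "nat \<lceil>b / c\<rceil>"] by blast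
qed

text \<open>The bounds express concentration: \<open>lam\<close> times the total volume factor stays
  above \<open>c\<close> while the factor itself is at most \<open>s\<close>. Mass is demanded on
  half balls because the negative Laplacian is available only up to 3/5 of the radius, less a margin
  for mollification.\<close>

definition ball_selection ::
  "(real^'n) measure \<Rightarrow> real \<Rightarrow> real \<Rightarrow> (real^'n) set \<Rightarrow> (real^'n \<Rightarrow> nat) \<Rightarrow> real \<Rightarrow> bool" where
  "ball_selection \<mu> c s J \<kappa> lam \<longleftrightarrow> finite J \<and>
    (\<forall>x\<in>J. \<forall>y\<in>J. x \<noteq> y \<longrightarrow> 2 * (1/2) ^ \<kappa> x + 2 * (1/2) ^ \<kappa> y \<le> dist x y) \<and> 0 < lam \<and>
    (\<forall>j\<in>J. lam * ((1/2) ^ \<kappa> j) ^ CARD('n) \<le> measure \<mu> (ball j ((1/2) ^ \<kappa> j / 2))) \<and>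
    c \<le> lam * (\<Sum>j\<in>J. ((1/2) ^ \<kappa> j) ^ CARD('n)) \<and> (\<Sum>j\<in>J. ((1/2) ^ \<kappa> j) ^ CARD('n)) \<le> s"

text \<open>A stopping-time selection: around a typical point of a null set charged by \<open>\<mu>\<close> the density
  \<open>\<mu> (ball x (r/2)) / r ^ n\<close> exceeds any level \<open>lam\<close>, and the radii are chosen maximal with this
  property, which makes \<open>\<mu>\<close> comparable to \<open>lam * r ^ n\<close> on the selected balls.\<close>

lemma singular_ball_selection:
  fixes \<mu> :: "(real^'n) measure"
  assumes fm: "finite_measure \<mu>" and sets: "sets \<mu> = sets borel"
    and sing: "\<not> absolutely_continuous lborel \<mu>"
  obtains c where "0 < c" "\<And>s. 0 < s \<Longrightarrow> \<exists>J \<kappa> lam. ball_selection \<mu> c s J \<kappa> lam"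
proof -
  interpret finite_measure \<mu> by fact
  let ?n = "CARD('n)" and ?\<omega> = "unit_ball_vol CARD('n)"
  have vol: "0 < ?\<omega>" by (rule unit_ball_vol_pos) simp
  then have vol0: "?\<omega> \<noteq> 0" by linarith
  have ms[simp]: "ball x r \<in> sets \<mu>" "cball x r \<in> sets \<mu>" for x r unfolding sets by auto
  obtain A where A: "A \<in> null_sets lborel" "A \<notin> null_sets \<mu>"
    using sing by (auto simp: absolutely_continuous_def)
  have Ab: "A \<in> sets borel" using A(1) by auto
  then have ne: "emeasure \<mu> A \<noteq> 0" using A(2) sets by (auto simp: null_sets_def)
  \<comment> \<open>The charged null set is replaced by a compact subset, which has a uniform
    neighbourhood inside any open superset; this supplies one starting scale \<open>k0\<close> for
    all points.\<close>
  have eq: "emeasure \<mu> A = (SUP K\<in>{K. K \<subseteq> A \<and> compact K}. emeasure \<mu> K)"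
    by (rule inner_regular[OF sets _ Ab]) (simp add: emeasure_finite)
  have sup0: "(SUP K\<in>{K. K \<subseteq> A \<and> compact K}. emeasure \<mu> K) \<le> 0"
    if "\<forall>K\<in>{K. K \<subseteq> A \<and> compact K}. emeasure \<mu> K = 0"
    using that by (intro SUP_least) auto
  have "\<not> (\<forall>K\<in>{K. K \<subseteq> A \<and> compact K}. emeasure \<mu> K = 0)"
  proof
    assume "\<forall>K\<in>{K. K \<subseteq> A \<and> compact K}. emeasure \<mu> K = 0"
    from sup0[OF this] show False using ne unfolding eq by simp
  qed
  then obtain K where K: "K \<subseteq> A" "compact K" "emeasure \<mu> K \<noteq> 0" by auto
  have Kb: "K \<in> sets borel" using K(2) by (simp add: compact_imp_closed borel_closed)
  have K0: "emeasure lborel K = 0"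
    using A(1) K(1) Kb by (metis emeasure_eq_0 null_setsD1 null_setsD2 sets_lborel)
  define a where "a = measure \<mu> K"
  have a: "0 < a" using K(3) unfolding a_def by (simp add: emeasure_eq_measure zero_less_measure_iff)
  define M where "M = measure \<mu> (space \<mu>)"
  have M: "0 \<le> M" by (simp add: M_def)
  show ?thesis
  proof (rule that[of "a / (2 * 32 ^ ?n)"])
    show "0 < a / (2 * 32 ^ ?n)" using a by simp
    fix s :: real assume s: "0 < s"
    \<comment> \<open>The first summand excludes radii of 1/32 or more, where the density exceeds
      what the total mass permits; the second makes the total volume factor at most
      \<open>M / lam \<le> s\<close>.\<close>
    define lam where "lam = (M + 1) * 32 ^ ?n + (M + 1) / s"
    have lam1: "M * 32 ^ ?n < lam" "M / s \<le> lam" "0 < lam"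
    proof -
      have "0 < (M + 1) / s" "M * 32 ^ ?n \<le> (M + 1) * 32 ^ ?n" "0 \<le> (M + 1) * 32 ^ ?n" "M / s \<le> (M + 1) / s"
        using M s by (auto simp: divide_right_mono)
      then show "M * 32 ^ ?n < lam" "M / s \<le> lam" "0 < lam" unfolding lam_def by linarith+
    qed
    \<comment> \<open>Calibrated so that points with low density at all scales up to
      \<open>k0\<close> carry at most half of the mass \<open>a\<close>.\<close>
    define e where "e = a * ?\<omega> / (2 * lam * 16 ^ ?n)"
    have e: "0 < e" using a lam1(3) by (simp add: e_def)
    obtain U where U: "open U" "K \<subseteq> U" "emeasure lborel (U - K) < ennreal e"
      using outer_regular_lborel[OF Kb e] by metis
    have Ub: "U \<in> sets borel" using U(1) by auto
    have "emeasure lborel U \<le> emeasure lborel (U - K) + emeasure lborel K"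
      using U(2) Ub Kb by (intro order_trans[OF emeasure_mono emeasure_subadditive]) auto
    then have Ue: "emeasure lborel U < ennreal e" using K0 U(3) by simp
    have Um: "measure lborel U \<le> e"
      unfolding measure_def using Ue e by (intro enn2real_leI) (auto intro: less_imp_le)
    have Uf: "U \<in> fmeasurable lborel" using Ue Ub by (intro fmeasurableI) (auto simp: less_top[symmetric])
    obtain d where d: "0 < d" "(\<Union>x\<in>K. cball x d) \<subseteq> U"
      using compact_subset_open_imp_cball_epsilon_subset[OF K(2) U(1,2)] by metis
    obtain k0 where k0: "(1/2::real) ^ k0 < d" using real_arch_pow_inv[OF d(1), of "1/2"] by auto
    define Q where "Q x k \<longleftrightarrow> lam * ((1/2) ^ k) ^ ?n \<le> measure \<mu> (ball x ((1/2) ^ k / 2))" for x k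
    define Z where "Z = {x\<in>K. \<forall>k\<le>k0. \<not> Q x k}"
    define K' where "K' = {x\<in>K. \<exists>k\<le>k0. Q x k}"
    have KZ: "K \<subseteq> Z \<union> K'" by (auto simp: Z_def K'_def)
    \<comment> \<open>The five-fold Vitali enlargement then fits into the half ball at scale
      \<open>k0\<close>, on which membership in \<open>Z\<close> bounds the mass.\<close>
    define \<rho> where "\<rho> = (1/2::real) ^ k0 / 16"
    have \<rho>: "0 < \<rho>" by (simp add: \<rho>_def)
    obtain C1 where C1: "countable C1" "C1 \<subseteq> Z" "pairwise (\<lambda>i j. disjnt (cball i \<rho>) (cball j \<rho>)) C1"
      and cov1: "\<And>i. i \<in> Z \<Longrightarrow> \<exists>j. j \<in> C1 \<and> \<not> disjnt (cball i \<rho>) (cball j \<rho>) \<and> cball i \<rho> \<subseteq> ball j (5 * \<rho>)"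
      by (rule Vitali_covering_lemma_cballs_balls[of Z "\<lambda>_. \<rho>" \<rho> "\<lambda>j. j"]) (use \<rho> in blast)+
    have cnt1: "real (card F) * (?\<omega> * \<rho> ^ ?n) \<le> e" if F: "F \<subseteq> C1" "finite F" for F
    proof -
      have "real (card F) * (?\<omega> * \<rho> ^ ?n) = (\<Sum>j\<in>F. measure lborel (cball j \<rho>))"
        using \<rho> by (simp add: content_cball)
      also have "\<dots> = measure lborel (\<Union>j\<in>F. cball j \<rho>)"
      proof (rule measure_finite_Union[symmetric])
        show "disjoint_family_on (\<lambda>j. cball j \<rho>) F"
          using C1(3) F(1) by (auto simp: disjoint_family_on_def pairwise_def disjnt_def)
      qed (use F emeasure_bounded_finite[of "cball _ \<rho>"] in \<open>auto simp: less_top[symmetric]\<close>)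
      also have "\<dots> \<le> measure lborel U"
      proof (rule measure_mono_fmeasurable[OF _ _ Uf])
        have "\<rho> \<le> d" using k0 d(1) unfolding \<rho>_def by linarith
        then have "cball j \<rho> \<subseteq> U" if "j \<in> F" for j
          using d(2) that F(1) C1(2) subset_cball[of \<rho> d j] unfolding Z_def by blast
        then show "(\<Union>j\<in>F. cball j \<rho>) \<subseteq> U" by blast
        show "(\<Union>j\<in>F. cball j \<rho>) \<in> sets lborel" using F(2) by (intro sets.finite_UN) auto
      qed
      finally show ?thesis using Um by simp
    qed
    have fin1: "finite C1"
      by (rule finite_of_card_mult_bounded[OF _ cnt1]) (use \<rho> in auto)
    have "measure \<mu> (\<Union>j\<in>C1. ball j (5 * \<rho>)) \<le> (\<Sum>j\<in>C1. measure \<mu> (ball j (5 * \<rho>)))"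
      by (intro finite_measure_subadditive_finite fin1) auto
    also have "\<dots> \<le> (\<Sum>j\<in>C1. lam * (16 ^ ?n * \<rho> ^ ?n))"
    proof (rule sum_mono)
      fix j assume "j \<in> C1"
      then have "\<not> Q j k0" using C1(2) by (auto simp: Z_def)
      moreover have "measure \<mu> (ball j (5 * \<rho>)) \<le> measure \<mu> (ball j ((1/2) ^ k0 / 2))"
        by (intro finite_measure_mono subset_ball) (auto simp: \<rho>_def)
      moreover have "((1/2) ^ k0) ^ ?n = 16 ^ ?n * \<rho> ^ ?n"
        by (simp add: \<rho>_def power_mult_distrib[symmetric])
      ultimately show "measure \<mu> (ball j (5 * \<rho>)) \<le> lam * (16 ^ ?n * \<rho> ^ ?n)" by (simp add: Q_def)
    qed
    also have "\<dots> = (lam * 16 ^ ?n / ?\<omega>) * (real (card C1) * (?\<omega> * \<rho> ^ ?n))"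
      by (simp add: vol0)
    also have "\<dots> \<le> (lam * 16 ^ ?n / ?\<omega>) * e"
      using lam1(3) by (intro mult_left_mono cnt1 fin1) auto
    also have "\<dots> = a / 2" using lam1(3) by (simp add: e_def vol0)
    finally have part1: "measure \<mu> (\<Union>j\<in>C1. ball j (5 * \<rho>)) \<le> a / 2" .

    \<comment> \<open>The least exponent is the largest dyadic radius with density at least
      \<open>lam\<close>, so the density condition fails at every coarser scale.\<close>
    define \<kappa> where "\<kappa> x = (LEAST k. Q x k)" for x
    define r where "r x = (1/2::real) ^ \<kappa> x" for x
    have r: "0 < r x" "2 * r x \<le> 2" for x by (auto simp: r_def power_le_one)
    have Q\<kappa>: "Q x (\<kappa> x)" "\<kappa> x \<le> k0" if x: "x \<in> K'" for x
    proof -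
      obtain k where "k \<le> k0" "Q x k" using x by (auto simp: K'_def)
      then show "Q x (\<kappa> x)" "\<kappa> x \<le> k0"
        unfolding \<kappa>_def using LeastI[of "Q x" k] Least_le[of "Q x" k] by auto
    qed
    obtain C2 where C2: "countable C2" "C2 \<subseteq> K'" "pairwise (\<lambda>i j. disjnt (cball i (2 * r i)) (cball j (2 * r j))) C2"
      and cov2: "\<And>i. i \<in> K' \<Longrightarrow> \<exists>j. j \<in> C2 \<and> \<not> disjnt (cball i (2 * r i)) (cball j (2 * r j)) \<and> cball i (2 * r i) \<subseteq> ball j (5 * (2 * r j))"
      by (rule Vitali_covering_lemma_cballs_balls[of K' "\<lambda>x. 2 * r x" 2 "\<lambda>j. j"]) (use r in force)+
    have sep: "2 * r i + 2 * r j \<le> dist i j" if "i \<in> C2" "j \<in> C2" "i \<noteq> j" for i j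
      using C2(3) that r by (intro disjnt_cballs_imp_le_dist) (auto simp: pairwise_def)
    have mass: "(\<Sum>j\<in>F. lam * r j ^ ?n) \<le> M" if F: "F \<subseteq> C2" "finite F" for F
    proof -
      have "(\<Sum>j\<in>F. lam * r j ^ ?n) \<le> (\<Sum>j\<in>F. measure \<mu> (ball j (r j / 2)))"
        using Q\<kappa>(1) F(1) C2(2) by (intro sum_mono) (auto simp: Q_def r_def)
      also have "\<dots> \<le> M"
        unfolding M_def
      proof (rule sum_measure_disjoint_le[OF fm F(2)])
        show "disjoint_family_on (\<lambda>j. ball j (r j / 2)) F"
          unfolding disjoint_family_on_def
        proof (intro ballI impI)
          fix i j assume "i \<in> F" "j \<in> F" "i \<noteq> j"
          then have "2 * r i + 2 * r j \<le> dist i j" using F(1) by (intro sep) auto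
          then show "ball i (r i / 2) \<inter> ball j (r j / 2) = {}"
            using r(1)[of i] r(1)[of j] by (intro disjoint_ballI) linarith
        qed
      qed auto
      finally show ?thesis .
    qed
    have fin2: "finite C2"
    proof (rule finite_of_card_mult_bounded)
      show "0 < lam * ((1/2) ^ k0) ^ ?n" using lam1(3) by simp
      fix F assume F: "F \<subseteq> C2" "finite F"
      have "real (card F) * (lam * ((1/2) ^ k0) ^ ?n) = (\<Sum>j\<in>F. lam * ((1/2) ^ k0) ^ ?n)" by simp
      also have "\<dots> \<le> (\<Sum>j\<in>F. lam * r j ^ ?n)"
        using lam1(3) Q\<kappa>(2) F(1) C2(2) unfolding r_def
        by (intro sum_mono mult_left_mono power_mono power_decreasing) auto
      also have "\<dots> \<le> M" by (rule mass[OF F])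
      finally show "real (card F) * (lam * ((1/2) ^ k0) ^ ?n) \<le> M" .
    qed
    have "measure \<mu> (\<Union>j\<in>C2. ball j (10 * r j)) \<le> (\<Sum>j\<in>C2. measure \<mu> (ball j (10 * r j)))"
      by (intro finite_measure_subadditive_finite fin2) auto
    also have "\<dots> \<le> (\<Sum>j\<in>C2. lam * (32 ^ ?n * r j ^ ?n))"
    proof (rule sum_mono)
      fix j assume "j \<in> C2"
      then have j: "j \<in> K'" using C2(2) by auto
      \<comment> \<open>This leaves room to go five scales up; a smaller exponent would put mass at
        least \<open>lam / 32 ^ n\<close>, more than \<open>M\<close>, in one ball.\<close>
      have "6 \<le> \<kappa> j"
      proof (rule ccontr)
        assume "\<not> 6 \<le> \<kappa> j"
        then have "(1/2) ^ 5 \<le> r j" unfolding r_def by (intro power_decreasing) auto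
        then have "((1/2) ^ 5) ^ ?n \<le> r j ^ ?n" by (intro power_mono) auto
        then have "lam * ((1/2) ^ 5) ^ ?n \<le> lam * r j ^ ?n" using lam1(3) by (intro mult_left_mono) auto
        also have "\<dots> \<le> M"
          using Q\<kappa>(1)[OF j] bounded_measure[of "ball j (r j / 2)"] by (simp add: Q_def r_def M_def)
        finally have "lam \<le> M * 32 ^ ?n" by (simp add: power_divide field_simps)
        then show False using lam1(1) by simp
      qed
      \<comment> \<open>Vitali for the doubled balls enlarges to radius 10 r. The dyadic radius 32 r
        is coarser than the stopping scale, and its half ball of radius 16 r contains the
        enlargement.\<close>
      then have r32: "(1/2) ^ (\<kappa> j - 5) = 32 * r j"
        unfolding r_def using power_add[of "1/2::real" "\<kappa> j - 5" 5] by (simp add: power_divide)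
      have "\<not> Q j (\<kappa> j - 5)"
        unfolding \<kappa>_def using \<open>6 \<le> \<kappa> j\<close> by (intro not_less_Least) (simp add: \<kappa>_def)
      then have "measure \<mu> (ball j (16 * r j)) \<le> lam * (32 ^ ?n * r j ^ ?n)"
        unfolding Q_def r32 by (simp add: power_mult_distrib)
      moreover have "measure \<mu> (ball j (10 * r j)) \<le> measure \<mu> (ball j (16 * r j))"
        using r(1)[of j] by (intro finite_measure_mono subset_ball) auto
      ultimately show "measure \<mu> (ball j (10 * r j)) \<le> lam * (32 ^ ?n * r j ^ ?n)" by linarith
    qed
    also have "\<dots> = 32 ^ ?n * (lam * (\<Sum>j\<in>C2. r j ^ ?n))"
      by (simp add: sum_distrib_left mult.left_commute)
    finally have part2: "measure \<mu> (\<Union>j\<in>C2. ball j (10 * r j)) \<le> 32 ^ ?n * (lam * (\<Sum>j\<in>C2. r j ^ ?n))" .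
    have "K \<subseteq> (\<Union>j\<in>C1. ball j (5 * \<rho>)) \<union> (\<Union>j\<in>C2. ball j (10 * r j))"
    proof
      fix x assume "x \<in> K"
      then consider "x \<in> Z" | "x \<in> K'" using KZ by blast
      then show "x \<in> (\<Union>j\<in>C1. ball j (5 * \<rho>)) \<union> (\<Union>j\<in>C2. ball j (10 * r j))"
      proof cases
        case 1
        have "x \<in> cball x \<rho>" using \<rho> by simp
        then show ?thesis using cov1[OF 1] by blast
      next
        case 2
        have "x \<in> cball x (2 * r x)" using r(1)[of x] by simp
        then obtain j where "j \<in> C2" "x \<in> ball j (5 * (2 * r j))" using cov2[OF 2] by blast
        then show ?thesis by auto
      qed
    qed
    then have "a \<le> measure \<mu> ((\<Union>j\<in>C1. ball j (5 * \<rho>)) \<union> (\<Union>j\<in>C2. ball j (10 * r j)))"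
      unfolding a_def using fin1 fin2 by (intro finite_measure_mono) (auto intro!: sets.Un sets.finite_UN)
    also have "\<dots> \<le> measure \<mu> (\<Union>j\<in>C1. ball j (5 * \<rho>)) + measure \<mu> (\<Union>j\<in>C2. ball j (10 * r j))"
      using fin1 fin2 by (intro measure_Un_le) (auto intro!: sets.finite_UN)
    finally have "a \<le> a / 2 + 32 ^ ?n * (lam * (\<Sum>j\<in>C2. r j ^ ?n))" using part1 part2 by linarith
    then have c: "a / (2 * 32 ^ ?n) \<le> lam * (\<Sum>j\<in>C2. r j ^ ?n)" by (simp add: field_simps)
    have "lam * (\<Sum>j\<in>C2. r j ^ ?n) \<le> M" using mass[OF order_refl fin2] by (simp add: sum_distrib_left)
    also have "\<dots> \<le> lam * s" using lam1(2) s by (simp add: field_simps)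
    finally have S: "(\<Sum>j\<in>C2. r j ^ ?n) \<le> s" using lam1(3) by simp
    show "\<exists>J \<kappa> lam. ball_selection \<mu> (a / (2 * 32 ^ ?n)) s J \<kappa> lam"
      unfolding ball_selection_def
      using fin2 sep lam1(3) Q\<kappa>(1) C2(2) c S
      by (intro exI[of _ C2] exI[of _ \<kappa>] exI[of _ lam]) (auto simp: r_def Q_def)
  qed
qed

section \<open>Perturbations of the identity\<close>

text \<open>One further factor adds a cross term of at most \<open>4 ^ m * t^2\<close> and at most
  doubles the old error, giving 3 times \<open>4 ^ m * t^2\<close>; the base 4 absorbs this.\<close>

lemma abs_prod_one_plus_le:
  fixes a :: "'a \<Rightarrow> real"
  assumes "finite I" "\<And>i. i \<in> I \<Longrightarrow> \<bar>a i\<bar> \<le> t" "0 \<le> t" "t \<le> 1"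
  shows "\<bar>(\<Prod>i\<in>I. 1 + a i) - 1 - (\<Sum>i\<in>I. a i)\<bar> \<le> 4 ^ card I * t^2"
  using assms(1,2)
proof (induction I rule: finite_induct)
  case empty then show ?case by simp
next
  case (insert x I)
  let ?P = "\<Prod>i\<in>I. 1 + a i" and ?S = "\<Sum>i\<in>I. a i" and ?m = "card I"
  have IH: "\<bar>?P - 1 - ?S\<bar> \<le> 4 ^ ?m * t^2" using insert by auto
  have x: "\<bar>a x\<bar> \<le> t" using insert.prems by auto
  have "\<bar>?S\<bar> \<le> (\<Sum>i\<in>I. \<bar>a i\<bar>)" by (rule sum_abs)
  also have "\<dots> \<le> real ?m * t" using insert.prems by (intro sum_bounded_above) auto
  also have "\<dots> \<le> 4 ^ ?m * t"
  proof (intro mult_right_mono assms)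
    have "?m \<le> 4 ^ ?m" by (induction ?m) auto
    then show "real ?m \<le> 4 ^ ?m" by (metis of_nat_le_iff of_nat_power of_nat_numeral)
  qed
  finally have S: "\<bar>?S\<bar> \<le> 4 ^ ?m * t" .
  have "\<bar>a x * ?S\<bar> \<le> t * (4 ^ ?m * t)"
    unfolding abs_mult using x S assms(3) by (intro mult_mono) auto
  moreover have "\<bar>(1 + a x) * (?P - 1 - ?S)\<bar> \<le> 2 * (4 ^ ?m * t^2)"
    unfolding abs_mult using x IH assms(4) by (intro mult_mono) auto
  moreover have "t * (4 ^ ?m * t) = 4 ^ ?m * t^2" by (simp add: power2_eq_square)
  ultimately have "\<bar>a x * ?S + (1 + a x) * (?P - 1 - ?S)\<bar> \<le> 3 * (4 ^ ?m * t^2)"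
    using abs_triangle_ineq[of "a x * ?S" "(1 + a x) * (?P - 1 - ?S)"] by linarith
  also have "\<dots> \<le> 4 ^ Suc ?m * t^2" by (simp add: mult_right_mono)
  finally show ?case using insert.hyps by (simp add: algebra_simps)
qed

text \<open>Only the identity permutation contributes at first order. Any other permutation moves at
  least two indices, so its product contains two off-diagonal factors of size at most
  \<open>t\<close>, and the other factors are at most 2.\<close>

lemma det_one_plus_le:
  fixes A :: "real^'n^'n"
  assumes A: "\<And>i j. \<bar>A $ i $ j\<bar> \<le> t" and t: "0 \<le> t" "t \<le> 1"
  shows "det (mat 1 + A) \<le> 1 + trace A + (4 ^ CARD('n) + fact CARD('n) * 2 ^ CARD('n)) * t^2"
proof -
  let ?U = "UNIV :: 'n set" and ?M = "mat 1 + A"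
  let ?PU = "{p. p permutes ?U}"
  let ?f = "\<lambda>p. of_int (sign p) * (\<Prod>i\<in>?U. ?M $ i $ p i)"
  have fP: "finite ?PU" by (rule finite_permutations) simp
  have idP: "id \<in> ?PU" by (simp add: permutes_id)
  have other: "\<bar>?f p\<bar> \<le> 2 ^ CARD('n) * t^2" if p: "p permutes ?U" "p \<noteq> id" for p
  proof -
    obtain i where i: "p i \<noteq> i" using p(2) by (auto simp: fun_eq_iff)
    \<comment> \<open>A moved index and its image are both moved and distinct, which provides the
      two small factors.\<close>
    define j where "j = p i"
    have j: "p j \<noteq> j" "j \<noteq> i"
      using i permutes_inj[OF p(1)] by (auto simp: j_def inj_def)
    have small: "\<bar>?M $ k $ p k\<bar> \<le> t" if "p k \<noteq> k" for k
      using A[of k "p k"] that by (simp add: mat_def)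
    have two: "\<bar>?M $ k $ p k\<bar> \<le> 2" for k
      using A[of k "p k"] t by (auto simp: mat_def)
    have "\<bar>?f p\<bar> = (\<Prod>k\<in>?U. \<bar>?M $ k $ p k\<bar>)"
      by (simp add: abs_mult sign_def abs_prod)
    also have "\<dots> = \<bar>?M $ i $ p i\<bar> * (\<bar>?M $ j $ p j\<bar> * (\<Prod>k\<in>?U - {i} - {j}. \<bar>?M $ k $ p k\<bar>))"
      using j(2) by (subst prod.remove[of _ i], simp, simp, subst prod.remove[of _ j]) auto
    also have "\<dots> \<le> t * (t * 2 ^ CARD('n))"
    proof (intro mult_mono small i j)
      have "(\<Prod>k\<in>?U - {i} - {j}. \<bar>?M $ k $ p k\<bar>) \<le> (\<Prod>k\<in>?U - {i} - {j}. 2)"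
        by (intro prod_mono conjI two) auto
      also have "\<dots> \<le> 2 ^ CARD('n)"
        unfolding prod_constant by (intro power_increasing card_mono) auto
      finally show "(\<Prod>k\<in>?U - {i} - {j}. \<bar>?M $ k $ p k\<bar>) \<le> 2 ^ CARD('n)" .
    qed (use t in \<open>auto intro!: mult_nonneg_nonneg prod_nonneg\<close>)
    finally show ?thesis by (simp add: power2_eq_square ac_simps)
  qed
  have "det ?M = ?f id + (\<Sum>p\<in>?PU - {id}. ?f p)"
    unfolding det_def using sum.remove[OF fP idP, of ?f] by simp
  also have "(\<Sum>p\<in>?PU - {id}. ?f p) \<le> (\<Sum>p\<in>?PU - {id}. 2 ^ CARD('n) * t^2)"
    by (intro sum_mono order_trans[OF abs_ge_self other]) auto
  also have "\<dots> \<le> fact CARD('n) * (2 ^ CARD('n) * t^2)"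
  proof -
    have "card (?PU - {id}) \<le> card ?PU" by (intro card_mono fP) auto
    also have "card ?PU = fact CARD('n)" by (rule card_permutations) auto
    finally have "real (card (?PU - {id})) \<le> fact CARD('n)"
      by (metis of_nat_fact of_nat_le_iff)
    then show ?thesis by (simp add: mult_right_mono)
  qed
  also have "?f id \<le> 1 + trace A + 4 ^ CARD('n) * t^2"
  proof -
    have "?f id = (\<Prod>i\<in>?U. 1 + A $ i $ i)" by (simp add: sign_id mat_def)
    then show ?thesis using abs_prod_one_plus_le[of ?U "\<lambda>i. A $ i $ i" t] A t by (simp add: trace_def)
  qed
  finally show ?thesis by (simp add: algebra_simps)
qed

lemma integrable_of_bounded_continuous:
  fixes f :: "'a::topological_space \<Rightarrow> real"
  assumes "finite_measure \<mu>" "sets \<mu> = sets borel" "continuous_on UNIV f" "\<And>x. \<bar>f x\<bar> \<le> B"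
  shows "integrable \<mu> f"
proof (rule finite_measure.integrable_const_bound[OF assms(1), where B = B])
  show "f \<in> borel_measurable \<mu>"
    using borel_measurable_continuous_onI[OF assms(3)] measurable_cong_sets[OF assms(2) refl] by blast
qed (use assms(4) in simp)

lemma integrable_trace:
  fixes A :: "'a::topological_space \<Rightarrow> real^'n^'n"
  assumes "finite_measure \<mu>" "sets \<mu> = sets borel" "continuous_on UNIV A" "\<And>x i j. \<bar>A x $ i $ j\<bar> \<le> C"
  shows "integrable \<mu> (\<lambda>x. trace (A x))"
proof (rule integrable_of_bounded_continuous[OF assms(1,2)])
  show "continuous_on UNIV (\<lambda>x. trace (A x))"
    unfolding trace_def by (intro continuous_intros assms(3))
  show "\<bar>trace (A x)\<bar> \<le> (\<Sum>i\<in>(UNIV::'n set). C)" for x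
    unfolding trace_def by (rule order_trans[OF sum_abs]) (intro sum_mono assms(4))
qed

definition potential ::
  "(real^'n) measure \<Rightarrow> real \<Rightarrow> real \<Rightarrow> real \<Rightarrow> (real^'n \<Rightarrow> real) \<Rightarrow> (real^'n \<Rightarrow> real^'n) \<Rightarrow>
     (real^'n \<Rightarrow> real^'n^'n) \<Rightarrow> bool" where
  "potential \<mu> C c \<epsilon> F FG FH \<longleftrightarrow> has_hessian F FG FH \<and> continuous_on UNIV FH \<and> (\<forall>x. norm (FG x) \<le> \<epsilon>) \<and>
       (\<forall>x i j. \<bar>FH x $ i $ j\<bar> \<le> C) \<and> (\<integral>x. trace (FH x) \<partial>\<mu>) \<le> - c"

text \<open>The point is the order of choice: the Hessian bound \<open>C\<close> depends only on the
  dimension and \<open>c\<close> only on \<open>\<mu>\<close>, while \<open>\<epsilon>\<close>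
  determines first the number \<open>M\<close> of coarse layers, then the volume \<open>s\<close>,
  and only then the balls.\<close>

lemma oscillating_potential:
  fixes \<mu> :: "(real^'n) measure"
  assumes fm: "finite_measure \<mu>" and sets: "sets \<mu> = sets borel"
    and sing: "\<not> absolutely_continuous lborel \<mu>"
  obtains C c where "1 \<le> C" "0 < c"
    "\<And>\<epsilon>. 0 < \<epsilon> \<Longrightarrow> \<exists>F FG FH. potential \<mu> C c \<epsilon> F FG FH"
proof -
  interpret finite_measure \<mu> by fact
  have sp: "space \<mu> = UNIV" using sets_eq_imp_space_eq[OF sets] by simp
  let ?n = "CARD('n)"
  obtain c where c: "0 < c" and sel: "\<And>s. 0 < s \<Longrightarrow> \<exists>J \<kappa> lam. ball_selection \<mu> c s J \<kappa> lam"
    by (rule singular_ball_selection[OF fm sets sing]) (rule that, assumption+)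
  obtain K1 where K1: "0 \<le> K1" "\<And>x::real^'n. \<bar>kern x\<bar> \<le> K1" "\<And>x::real^'n. norm (kern_G x) \<le> K1"
    "\<And>(x::real^'n) i j. norm (kern_T x i j) \<le> K1"
    by (rule kern_bounds) (rule that, assumption+)
  have "continuous_on UNIV (\<lambda>x::real^'n. norm (bump_H x))"
    by (intro continuous_intros has_third_continuous[OF has_third_bump])
  then obtain K2 where K2: "0 \<le> K2" "\<And>x::real^'n. \<bar>norm (bump_H x)\<bar> \<le> K2"
    by (rule bounded_of_compact_support[where R = 1]) (auto simp: bump_derivs_eq_0)
  define K where "K = max K1 K2"
  define A where "A = 2 ^ ?n * K"
  \<comment> \<open>Since \<open>Q \<ge> 1\<close>, this choice satisfies
    \<open>800 * 5 ^ n \<le> Q^2\<close> without a square root. The threshold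
    \<open>\<Lambda>1\<close> below then makes the inequality required by \<open>bad_small\<close>
    an equality, and \<open>\<Lambda>\<close> is the opening that \<open>good_touch\<close> yields
    for it.\<close>
  define Q :: real where "Q = 800 * 5 ^ ?n"
  define \<Lambda>1 where "\<Lambda>1 = A + (Q + 2 * A * K) / ((3/4) ^ 5 / 2 ^ ?n)"
  define \<Lambda> where "\<Lambda> = 24 * A + real (?n * ?n) * (\<Lambda>1 + 2 * A)"
  define C where "C = 1 + real ?n * \<Lambda>"
  define m where "m = measure \<mu> (space \<mu>)"
  have K: "0 \<le> K" using K1 by (simp add: K_def)
  have A: "0 \<le> A" using K by (simp add: A_def)
  have Q: "0 < Q" "800 * 5 ^ ?n \<le> Q^2"
  proof -
    show "0 < Q" by (simp add: Q_def)
    have "1 \<le> Q" unfolding Q_def using one_le_power[of "5::real" ?n] by linarith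
    then have "Q * 1 \<le> Q * Q" by (intro mult_left_mono) auto
    then show "800 * 5 ^ ?n \<le> Q^2" by (simp add: power2_eq_square Q_def)
  qed
  have \<Lambda>1: "0 \<le> \<Lambda>1" "Q + 2 * A * K \<le> (\<Lambda>1 - A) * ((3/4) ^ 5 / 2 ^ ?n)"
    using A K Q(1) by (auto simp: \<Lambda>1_def intro!: add_nonneg_nonneg divide_nonneg_nonneg mult_nonneg_nonneg)
  have \<Lambda>: "0 \<le> \<Lambda>" unfolding \<Lambda>_def using A \<Lambda>1 by (intro add_nonneg_nonneg mult_nonneg_nonneg) auto
  have m: "0 \<le> m" by (simp add: m_def)
  show ?thesis
  proof (rule that[of C "c / 4"])
    show "1 \<le> C" using \<Lambda> by (simp add: C_def)
    show "0 < c / 4" using c by simp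
    fix \<epsilon> :: real assume \<epsilon>: "0 < \<epsilon>"
    \<comment> \<open>The gradient of the envelope squared is at most
      \<open>2 * (\<Lambda> + 1)\<close> times the sup bound on the potential, so this gives exactly
      \<open>\<epsilon>^2\<close>.\<close>
    define \<epsilon>1 where "\<epsilon>1 = \<epsilon>^2 / (2 * (\<Lambda> + 1))"
    have \<epsilon>1: "0 < \<epsilon>1" using \<epsilon> \<Lambda> by (simp add: \<epsilon>1_def)
    obtain M where M: "2 * A * (1/4) ^ M \<le> \<epsilon>1 / 2"
    proof -
      obtain M where "(1/4::real) ^ M < \<epsilon>1 / 2 / (2 * A + 1)"
        using real_arch_pow_inv[of "\<epsilon>1 / 2 / (2 * A + 1)" "1/4"] \<epsilon>1 A by auto
      then have "(2 * A + 1) * (1/4) ^ M \<le> \<epsilon>1 / 2" using A by (simp add: field_simps)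
      moreover have "2 * A * (1/4) ^ M \<le> (2 * A + 1) * (1/4) ^ M" by (intro mult_right_mono) auto
      ultimately show ?thesis using that[of M] by linarith
    qed
    \<comment> \<open>The first bound gives \<open>10 * S \<le> 1\<close>, the summand 1 in
      \<open>C\<close>; the second keeps the global cost \<open>10 * S * m\<close> below
      \<open>c / 4\<close>; the third makes the coarse layers at most
      \<open>\<epsilon>1 / 2\<close>.\<close>
    define s where "s = Min {1/10, c / (40 * (m + 1)), \<epsilon>1 / (2 * (real M * K * 2 ^ (M * ?n) + 1))}"
    have MK: "0 \<le> real M * K * 2 ^ (M * ?n)" using K by simp
    have s: "0 < s" "s \<le> 1/10" "s \<le> c / (40 * (m + 1))" "s \<le> \<epsilon>1 / (2 * (real M * K * 2 ^ (M * ?n) + 1))"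
    proof -
      show "0 < s" using c m \<epsilon>1 MK by (auto simp: s_def)
      show "s \<le> 1/10" "s \<le> c / (40 * (m + 1))" "s \<le> \<epsilon>1 / (2 * (real M * K * 2 ^ (M * ?n) + 1))"
        unfolding s_def by (rule Min_le; simp)+
    qed
    obtain J \<kappa> lam where J: "finite J"
      "\<forall>x\<in>J. \<forall>y\<in>J. x \<noteq> y \<longrightarrow> 2 * (1/2) ^ \<kappa> x + 2 * (1/2) ^ \<kappa> y \<le> dist x y" "(0::real) < lam"
      "\<forall>j\<in>J. lam * ((1/2) ^ \<kappa> j) ^ CARD('n) \<le> measure \<mu> (ball j ((1/2) ^ \<kappa> j / 2))"
      "c \<le> lam * (\<Sum>j\<in>J. ((1/2) ^ \<kappa> j) ^ CARD('n))" "(\<Sum>j\<in>J. ((1/2) ^ \<kappa> (j::real^'n)) ^ CARD('n)) \<le> s"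
      using sel[OF s(1)] unfolding ball_selection_def by blast
    define N where "N = (\<Sum>j\<in>J. \<kappa> j)"
    interpret bf: ball_family J \<kappa> N K
    proof
      show "finite J" by (rule J)
      show "\<kappa> j \<le> N" if "j \<in> J" for j unfolding N_def using that J(1) by (intro member_le_sum) auto
      show "2 * (1/2) ^ \<kappa> x + 2 * (1/2) ^ \<kappa> y \<le> dist x y" if "x \<in> J" "y \<in> J" "x \<noteq> y" for x y
        using J(2) that by blast
      show "0 \<le> K" by (rule K)
      show "\<bar>kern x\<bar> \<le> K" "norm (kern_G x) \<le> K" "norm (kern_T x i j) \<le> K"
        "norm (bump_H x) \<le> K" for x :: "real^'n" and i j
        using K1(2-4)[of x] K2(2)[of x] unfolding K_def by (auto simp: le_max_iff_disj)
    qed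
    have Aeq: "bf.A = A" by (simp add: bf.A_def A_def)
    have S: "bf.S = (\<Sum>j\<in>J. ((1/2) ^ \<kappa> j) ^ ?n)" by (simp add: bf.S_def bf.rad_def)
    have Ss: "bf.S \<le> s" "c \<le> lam * bf.S" "bf.S \<le> 1" using J(5,6) s(2) by (auto simp: S)
    have p\<epsilon>: "bf.p N x \<le> \<epsilon>1" for x
    proof -
      have "real M * K * 2 ^ (M * ?n) * bf.S \<le> (real M * K * 2 ^ (M * ?n) + 1) * s"
        using MK Ss(1) bf.S_nonneg by (intro mult_mono) auto
      also have "\<dots> \<le> \<epsilon>1 / 2" using s(4) MK by (simp add: field_simps)
      finally show ?thesis using bf.p_small[of x M] M unfolding Aeq by linarith
    qed
    \<comment> \<open>At most a tenth of every radius, so an \<open>\<eta>\<close>-ball around a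
      point of a half ball stays within 3/5 of the radius, where both the touching and the negative
      Laplacian are known.\<close>
    define \<eta> where "\<eta> = (1/2::real) ^ N / 10"
    have \<eta>: "0 < \<eta>" by (simp add: \<eta>_def)
    have \<eta>r: "\<eta> \<le> bf.rad j / 10" if "j \<in> J" for j
      unfolding \<eta>_def bf.rad_def using bf.\<kappa>N[OF that] by (intro divide_right_mono power_decreasing) auto
    obtain F FG FH where F: "has_hessian F FG FH" "continuous_on UNIV FH"
      "\<And>x. (norm (FG x))^2 \<le> 2 * (\<Lambda> + 1) * \<epsilon>1" "\<And>x i j. \<bar>FH x $ i $ j\<bar> \<le> \<bar>10 * bf.S\<bar> + real ?n * \<Lambda>"
      "\<And>x. trace (FH x) \<le> 10 * bf.S"
      "\<And>x c. \<forall>y\<in>ball x \<eta>. \<forall>h. bf.p N y + h \<bullet> bf.pG N y - \<Lambda> / 2 * (norm h)^2 \<le> bf.p N (y + h) \<Longrightarrow>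
       \<forall>y\<in>ball x \<eta>. trace (bf.pH N y) \<le> c \<Longrightarrow> trace (FH x) \<le> c"
      by (rule smooth_semiconvex_envelope[OF bf.has_hessian_p bf.has_third_p bf.pT_bound bf.p_nonneg p\<epsilon> \<Lambda>
            bf.p_laplacian_bounds(1) \<eta>]) (rule that, assumption+)
    define Good where "Good = J - bf.bad \<Lambda>1"
    have finG: "finite Good" using J(1) by (simp add: Good_def)
    have good_sum: "bf.S / 2 \<le> (\<Sum>j\<in>Good. bf.rad j ^ ?n)"
    proof -
      have "bf.bad \<Lambda>1 \<subseteq> J" by (auto simp: bf.bad_def)
      then have "bf.S = (\<Sum>j\<in>Good. bf.rad j ^ ?n) + (\<Sum>j\<in>bf.bad \<Lambda>1. bf.rad j ^ ?n)"
        unfolding bf.S_def Good_def by (rule sum.subset_diff[OF _ J(1)])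
      moreover have "(\<Sum>j\<in>bf.bad \<Lambda>1. bf.rad j ^ ?n) \<le> bf.S / 2"
        by (rule bf.bad_small[OF Ss(3) Q(1) _ Q(2)]) (use \<Lambda>1(2) in \<open>simp add: Aeq\<close>)
      ultimately show ?thesis by simp
    qed
    let ?ind = "\<lambda>x. \<Sum>j\<in>Good. indicat_real (ball j (bf.rad j / 2)) x"
    have disj: "disjoint_family_on (\<lambda>j. ball j (bf.rad j / 2)) Good"
      using bf.balls_disjoint unfolding disjoint_family_on_def Good_def
      by (smt (verit) DiffD1 bf.rad_pos disjoint_iff field_sum_of_halves mem_ball)
    have trace_le: "trace (FH x) \<le> 10 * bf.S - ?ind x" for x
    proof (cases "\<exists>j\<in>Good. x \<in> ball j (bf.rad j / 2)")
      case True
      then obtain j where j: "j \<in> Good" "x \<in> ball j (bf.rad j / 2)" by blast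
      then have jJ: "j \<in> J" by (simp add: Good_def)
      have near: "dist j y \<le> 3/5 * bf.rad j" "y \<in> ball j (bf.rad j)" if "y \<in> ball x \<eta>" for y
      proof -
        have "dist j y \<le> dist j x + dist x y" by (rule dist_triangle)
        also have "\<dots> < bf.rad j / 2 + bf.rad j / 10"
          using j(2) that \<eta>r[OF jJ] by simp
        finally show "dist j y \<le> 3/5 * bf.rad j" "y \<in> ball j (bf.rad j)"
          using bf.rad_pos[of j] by auto
      qed
      have "trace (FH x) \<le> 10 * bf.S - 1"
      proof (rule F(6))
        show "\<forall>y\<in>ball x \<eta>. \<forall>h. bf.p N y + h \<bullet> bf.pG N y - \<Lambda> / 2 * (norm h)^2 \<le> bf.p N (y + h)"
          using bf.good_touch[of j \<Lambda>1] j(1) near(2) \<Lambda>1(1) unfolding Good_def \<Lambda>_def Aeq by blast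
        show "\<forall>y\<in>ball x \<eta>. trace (bf.pH N y) \<le> 10 * bf.S - 1"
          using bf.p_laplacian_bounds(3)[OF jJ near(1)] by blast
      qed
      then show ?thesis using sum_indicator_disjoint_le_1[OF finG disj, of x] by linarith
    next
      case False
      then have "?ind x = 0" by (intro sum.neutral) (auto simp: indicator_def)
      then show ?thesis using F(5)[of x] by simp
    qed
    have FHC: "\<bar>FH x $ i $ j\<bar> \<le> C" for x i j
      using F(4)[of x i j] Ss(1) s(2) bf.S_nonneg by (simp add: C_def)
    have ti: "integrable \<mu> (\<lambda>x. trace (FH x))" by (rule integrable_trace[OF fm sets F(2) FHC])
    have ii: "integrable \<mu> (indicat_real (ball j (bf.rad j / 2)))" for j
      by (rule integrable_real_indicator) (auto simp: sets emeasure_finite less_top[symmetric])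
    have isum: "integrable \<mu> ?ind" by (rule Bochner_Integration.integrable_sum) (rule ii)
    have "(\<integral>x. trace (FH x) \<partial>\<mu>) \<le> (\<integral>x. 10 * bf.S - ?ind x \<partial>\<mu>)"
      by (rule integral_mono[OF ti _ trace_le]) (intro Bochner_Integration.integrable_diff isum, simp)
    also have "\<dots> = 10 * bf.S * m - (\<Sum>j\<in>Good. measure \<mu> (ball j (bf.rad j / 2)))"
    proof -
      have "(\<integral>x. ?ind x \<partial>\<mu>) = (\<Sum>j\<in>Good. measure \<mu> (ball j (bf.rad j / 2)))"
        by (subst Bochner_Integration.integral_sum) (rule ii, simp add: sp)
      then show ?thesis using isum by (simp add: m_def mult.commute)
    qed
    also have "\<dots> \<le> 10 * bf.S * m - lam * (bf.S / 2)"
    proof -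
      have "lam * (bf.S / 2) \<le> lam * (\<Sum>j\<in>Good. bf.rad j ^ ?n)" using J(3) good_sum by (intro mult_left_mono) auto
      also have "\<dots> \<le> (\<Sum>j\<in>Good. measure \<mu> (ball j (bf.rad j / 2)))"
        unfolding sum_distrib_left using J(4) by (intro sum_mono) (auto simp: Good_def bf.rad_def)
      finally show ?thesis by simp
    qed
    \<comment> \<open>The good balls retain at least half of \<open>lam * S\<close>, a gain of
      \<open>c / 2\<close>, against a cost of at most \<open>c / 4\<close>.\<close>
    also have "\<dots> \<le> - (c / 4)"
    proof -
      have "bf.S * m \<le> s * (m + 1)" using Ss(1) m s(1) by (intro mult_mono) auto
      also have "\<dots> \<le> c / 40" using s(3) m by (simp add: field_simps)
      finally show ?thesis using Ss(2) by simp
    qed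
    finally have int: "(\<integral>x. trace (FH x) \<partial>\<mu>) \<le> - (c / 4)" .
    have "norm (FG x) \<le> \<epsilon>" for x
    proof (rule power2_le_imp_le)
      show "(norm (FG x))^2 \<le> \<epsilon>^2" using F(3)[of x] \<Lambda> by (simp add: \<epsilon>1_def)
    qed (use \<epsilon> in simp)
    with F(1,2) FHC int show "\<exists>F FG FH. potential \<mu> C (c / 4) \<epsilon> F FG FH"
      unfolding potential_def
      by blast
  qed
qed

text \<open>The entry bound makes \<open>FG\<close> Lipschitz with constant
  \<open>n * n * C\<close>, so the perturbation uses up at most the margin \<open>sqrt 2 - 1\<close>
  above the Lipschitz constant 1 of the identity.\<close>

lemma perturbed_identity:
  fixes F :: "real^'n \<Rightarrow> real"
  assumes F: "has_hessian F FG FH" "continuous_on UNIV FH" and C: "\<And>x i j. \<bar>FH x $ i $ j\<bar> \<le> C"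
    and \<tau>: "0 \<le> \<tau>" "\<tau> * (real CARD('n) * (real CARD('n) * C)) \<le> sqrt 2 - 1"
  shows "jacobian (\<lambda>x. x + \<tau> *\<^sub>R FG x) (at x) = mat 1 + \<tau> *\<^sub>R FH x"
    and "continuously_differentiable (\<lambda>x. x + \<tau> *\<^sub>R FG x)"
    and "(sqrt 2)-lipschitz_on UNIV (\<lambda>x. x + \<tau> *\<^sub>R FG x)"
proof -
  have d: "((\<lambda>x. x + \<tau> *\<^sub>R FG x) has_derivative (\<lambda>h. (mat 1 + \<tau> *\<^sub>R FH x) *v h)) (at x)" for x
  proof -
    have "((\<lambda>x. \<chi> i. FG x $ i) has_derivative (\<lambda>h. \<chi> i. h \<bullet> FH x $ i)) (at x)"
      using has_hessianD(2)[OF F(1)]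
      by (subst has_derivative_componentwise_within) (auto simp: Basis_vec_def inner_axis gderiv_def)
    then have "(FG has_derivative (\<lambda>h. FH x *v h)) (at x)"
      by (simp add: matrix_vector_mult_def inner_vec_def mult.commute)
    then have "((\<lambda>x. x + \<tau> *\<^sub>R FG x) has_derivative (\<lambda>h. h + \<tau> *\<^sub>R (FH x *v h))) (at x)"
      by (auto intro!: derivative_eq_intros)
    then show ?thesis
      by (simp add: matrix_vector_mult_add_rdistrib scaleR_matrix_vector_assoc)
  qed
  show jac: "jacobian (\<lambda>x. x + \<tau> *\<^sub>R FG x) (at x) = mat 1 + \<tau> *\<^sub>R FH x" for x
    by (simp add: jacobian_def frechet_derivative_at[OF d, symmetric] matrix_of_matrix_vector_mul)
  show "continuously_differentiable (\<lambda>x. x + \<tau> *\<^sub>R FG x)"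
    unfolding continuously_differentiable_def jac
    using d by (auto simp: differentiable_def intro!: continuous_intros F(2))
  show "(sqrt 2)-lipschitz_on UNIV (\<lambda>x. x + \<tau> *\<^sub>R FG x)"
    unfolding lipschitz_on_def
  proof (intro conjI ballI)
    fix x y :: "real^'n"
    let ?L = "real CARD('n) * (real CARD('n) * C)"
    have "norm (FH x $ i) \<le> real CARD('n) * C" for x i
    proof -
      have "norm (FH x $ i) \<le> (\<Sum>j\<in>UNIV. \<bar>FH x $ i $ j\<bar>)" by (rule norm_le_l1_cart)
      also have "\<dots> \<le> (\<Sum>j\<in>(UNIV::'n set). C)" by (intro sum_mono C)
      finally show ?thesis by simp
    qed
    then have "norm (FG x - FG y) \<le> ?L * norm (x - y)"
      by (rule lipschitz_vec[OF has_hessianD(2)[OF F(1)]])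
    then have "\<tau> * norm (FG x - FG y) \<le> \<tau> * (?L * norm (x - y))" using \<tau>(1) by (rule mult_left_mono)
    also have "\<dots> \<le> (sqrt 2 - 1) * norm (x - y)"
      using mult_right_mono[OF \<tau>(2), of "norm (x - y)"] by (simp add: mult.assoc)
    finally have "\<tau> * norm (FG x - FG y) \<le> (sqrt 2 - 1) * norm (x - y)" .
    moreover have "dist (x + \<tau> *\<^sub>R FG x) (y + \<tau> *\<^sub>R FG y) = norm ((x - y) + \<tau> *\<^sub>R (FG x - FG y))"
      by (simp add: dist_norm algebra_simps)
    moreover have "norm ((x - y) + \<tau> *\<^sub>R (FG x - FG y)) \<le> norm (x - y) + \<tau> * norm (FG x - FG y)"
      using norm_triangle_ineq[of "x - y" "\<tau> *\<^sub>R (FG x - FG y)"] \<tau>(1) by simp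
    ultimately show "dist (x + \<tau> *\<^sub>R FG x) (y + \<tau> *\<^sub>R FG y) \<le> sqrt 2 * dist x y"
      by (simp add: dist_norm algebra_simps)
  qed simp
qed

theorem theorem5p23:
  fixes \<mu> :: "(real ^ 'n) measure"
  assumes "finite_measure \<mu>"
    and "sets \<mu> = sets borel"
    and "\<not> absolutely_continuous lborel \<mu>"
  shows "\<exists>(g :: nat \<Rightarrow> real ^ 'n \<Rightarrow> real ^ 'n) (L :: real).
    (\<forall>k. continuously_differentiable (g k) \<and> (sqrt 2)-lipschitz_on UNIV (g k)) \<and>
    (\<forall>x. (\<lambda>k. g k x) \<longlonglongrightarrow> x) \<and>
    (\<lambda>k. \<integral>x. det (jacobian (g k) (at x)) \<partial>\<mu>) \<longlonglongrightarrow> L \<and>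
    L < measure \<mu> UNIV"
proof -
  interpret finite_measure \<mu> by fact
  have sp: "space \<mu> = UNIV" using sets_eq_imp_space_eq[OF assms(2)] by simp
  let ?n = "real CARD('n)"
  obtain C c where C: "1 \<le> C" "0 < c" and ex: "\<And>\<epsilon>. 0 < \<epsilon> \<Longrightarrow> \<exists>F FG FH. potential \<mu> C c \<epsilon> F FG FH"
    by (rule oscillating_potential[OF assms]) (rule that, assumption+)
  have "\<forall>k. \<exists>F FG FH. potential \<mu> C c (1 / real (Suc k)) F FG FH" using ex by simp
  then obtain F FG FH where "\<And>k. potential \<mu> C c (1 / real (Suc k)) (F k) (FG k) (FH k)" by metis
  then have F: "\<And>k. has_hessian (F k) (FG k) (FH k)" "\<And>k. continuous_on UNIV (FH k)"
    "\<And>k x. norm (FG k x) \<le> 1 / real (Suc k)" "\<And>k x i j. \<bar>FH k x $ i $ j\<bar> \<le> C" "\<And>k. (\<integral>x. trace (FH k x) \<partial>\<mu>) \<le> - c"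
    by (simp_all add: potential_def)
  define m where "m = measure \<mu> UNIV"
  define B :: real where "B = 4 ^ CARD('n) + fact CARD('n) * 2 ^ CARD('n)"
  \<comment> \<open>The three bounds serve the determinant expansion, which needs perturbation
    entries of size at most 1, the Lipschitz constant, and the quadratic error, which may consume at
    most half of the linear gain \<open>\<tau> * c\<close>. None depends on
    \<open>k\<close>.\<close>
  define \<tau> where "\<tau> = Min {1 / C, (sqrt 2 - 1) / (?n * (?n * C)), c / (2 * (B * C^2 * (m + 1)))}"
  have m: "0 \<le> m" by (simp add: m_def)
  have B: "0 < B" unfolding B_def by (intro add_pos_nonneg) auto
  have n: "0 < ?n * (?n * C)" using C(1) by simp
  have BC: "0 < B * C^2 * (m + 1)" using B C(1) m by (intro mult_pos_pos) auto
  have \<tau>: "0 < \<tau>" "\<tau> \<le> 1 / C" "\<tau> \<le> (sqrt 2 - 1) / (?n * (?n * C))" "\<tau> \<le> c / (2 * (B * C^2 * (m + 1)))"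
  proof -
    show "0 < \<tau>" using C n BC by (auto simp: \<tau>_def)
    show "\<tau> \<le> 1 / C" "\<tau> \<le> (sqrt 2 - 1) / (?n * (?n * C))" "\<tau> \<le> c / (2 * (B * C^2 * (m + 1)))"
      unfolding \<tau>_def by (rule Min_le; simp)+
  qed
  have \<tau>C: "\<tau> * C \<le> 1" using \<tau>(2) C(1) by (simp add: field_simps)
  have \<tau>L: "\<tau> * (?n * (?n * C)) \<le> sqrt 2 - 1" using \<tau>(3) n by (simp add: pos_le_divide_eq)
  define g where "g k x = x + \<tau> *\<^sub>R FG k x" for k x
  note pert = perturbed_identity[OF F(1,2,4) less_imp_le[OF \<tau>(1)] \<tau>L, folded g_def]
  define I where "I k = (\<integral>x. det (jacobian (g k) (at x)) \<partial>\<mu>)" for k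
  have dc: "continuous_on UNIV (\<lambda>x. det (jacobian (g k) (at x)))" for k
    unfolding pert(1) det_def
    by (intro continuous_intros continuous_on_component F(2))
  have det_bd: "\<bar>det (jacobian (g k) (at x))\<bar> \<le> fact CARD('n) * 2 ^ CARD('n)" for k x
  proof -
    let ?M = "mat 1 + \<tau> *\<^sub>R FH k x"
    have e: "\<bar>?M $ i $ j\<bar> \<le> 2" for i j
    proof -
      have "\<bar>\<tau> * FH k x $ i $ j\<bar> \<le> \<tau> * C"
        unfolding abs_mult using \<tau>(1) by (simp add: mult_left_mono F(4))
      then show ?thesis using \<tau>C by (auto simp: mat_def)
    qed
    have "\<bar>det ?M\<bar> \<le> (\<Sum>p\<in>{p. p permutes (UNIV::'n set)}. \<bar>of_int (sign p) * (\<Prod>i\<in>UNIV. ?M $ i $ p i)\<bar>)"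
      unfolding det_def by (rule sum_abs)
    also have "\<dots> \<le> (\<Sum>p\<in>{p. p permutes (UNIV::'n set)}. 2 ^ CARD('n))"
    proof (rule sum_mono)
      fix p :: "'n \<Rightarrow> 'n"
      have "\<bar>of_int (sign p) * (\<Prod>i\<in>UNIV. ?M $ i $ p i)\<bar> = (\<Prod>i\<in>UNIV. \<bar>?M $ i $ p i\<bar>)"
        by (simp add: abs_mult sign_def abs_prod)
      also have "\<dots> \<le> (\<Prod>i\<in>(UNIV::'n set). 2)" by (intro prod_mono conjI e) auto
      finally show "\<bar>of_int (sign p) * (\<Prod>i\<in>UNIV. ?M $ i $ p i)\<bar> \<le> 2 ^ CARD('n)" by simp
    qed
    also have "\<dots> = fact CARD('n) * 2 ^ CARD('n)" by (simp add: card_permutations)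
    finally show ?thesis unfolding pert(1) .
  qed
  have di: "integrable \<mu> (\<lambda>x. det (jacobian (g k) (at x)))" for k
    by (rule integrable_of_bounded_continuous[OF assms(1,2) dc det_bd])
  have I_abs: "\<bar>I k\<bar> \<le> fact CARD('n) * 2 ^ CARD('n) * m" for k
  proof -
    have "\<bar>I k\<bar> \<le> (\<integral>x. fact CARD('n) * 2 ^ CARD('n) \<partial>\<mu>)"
      unfolding I_def by (rule order_trans[OF integral_abs_bound integral_mono]) (use di det_bd in auto)
    then show ?thesis by (simp add: m_def sp ac_simps)
  qed
  have I_le: "I k \<le> m - \<tau> * c / 2" for k
  proof -
    have ti: "integrable \<mu> (\<lambda>x. trace (FH k x))" by (rule integrable_trace[OF assms(1,2) F(2,4)])
    have "I k \<le> (\<integral>x. 1 + \<tau> * trace (FH k x) + B * (\<tau> * C)^2 \<partial>\<mu>)"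
      unfolding I_def
    proof (rule integral_mono[OF di])
      show "integrable \<mu> (\<lambda>x. 1 + \<tau> * trace (FH k x) + B * (\<tau> * C)^2)"
        using ti by simp
      fix x
      have "\<bar>(\<tau> *\<^sub>R FH k x) $ i $ j\<bar> \<le> \<tau> * C" for i j
        using \<tau>(1) by (simp add: abs_mult mult_left_mono F(4))
      moreover have "0 \<le> \<tau> * C" using \<tau>(1) C(1) by simp
      ultimately have "det (mat 1 + \<tau> *\<^sub>R FH k x) \<le> 1 + trace (\<tau> *\<^sub>R FH k x) + B * (\<tau> * C)^2"
        unfolding B_def using \<tau>C by (intro det_one_plus_le)
      moreover have "trace (\<tau> *\<^sub>R FH k x) = \<tau> * trace (FH k x)" by (simp add: trace_def sum_distrib_left)
      ultimately show "det (jacobian (g k) (at x)) \<le> 1 + \<tau> * trace (FH k x) + B * (\<tau> * C)^2"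
        unfolding pert(1) by simp
    qed
    also have "\<dots> = m + \<tau> * (\<integral>x. trace (FH k x) \<partial>\<mu>) + B * (\<tau> * C)^2 * m"
      using ti by (simp add: m_def sp mult.commute)
    also have "\<dots> \<le> m + \<tau> * (- c) + B * (\<tau> * C)^2 * m"
      using mult_left_mono[OF F(5)[of k], of \<tau>] \<tau>(1) by simp
    also have "B * (\<tau> * C)^2 * m \<le> \<tau> * c / 2"
    proof -
      have "B * (\<tau> * C)^2 * m \<le> B * (\<tau> * C)^2 * (m + 1)" using B by (intro mult_left_mono mult_nonneg_nonneg) (auto simp: less_imp_le)
      also have "\<dots> = \<tau> * (\<tau> * (B * C^2 * (m + 1)))" by (simp add: power_mult_distrib power2_eq_square)
      also have "\<dots> \<le> \<tau> * (c / 2)"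
        using \<tau>(1,4) BC by (intro mult_left_mono) (auto simp: field_simps)
      finally show ?thesis by simp
    qed
    finally show ?thesis by simp
  qed
  \<comment> \<open>The integrals need not converge, so a convergent subsequence is extracted; the
    uniform gap \<open>\<tau> * c / 2\<close> keeps its limit strictly below the total mass, and the
    pointwise limit is unaffected.\<close>
  have "bounded (range I)"
    unfolding bounded_iff using I_abs by (intro exI[of _ "fact CARD('n) * 2 ^ CARD('n) * m"]) auto
  then obtain L r where r: "strict_mono r" and L: "(I \<circ> r) \<longlonglongrightarrow> L"
    using bounded_imp_convergent_subsequence by blast
  have "L \<le> m - \<tau> * c / 2"
    by (rule LIMSEQ_le_const2[OF L]) (use I_le in auto)
  then have "L < measure \<mu> UNIV" using mult_pos_pos[OF \<tau>(1) C(2)] unfolding m_def by linarith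
  moreover have "(\<lambda>k. g (r k) x) \<longlonglongrightarrow> x" for x
  proof -
    have "(\<lambda>k. FG k x) \<longlonglongrightarrow> 0"
    proof (rule Lim_null_comparison)
      show "\<forall>\<^sub>F k in sequentially. norm (FG k x) \<le> 1 / real (Suc k)" using F(3) by simp
      show "(\<lambda>k. 1 / real (Suc k)) \<longlonglongrightarrow> 0" using LIMSEQ_inverse_real_of_nat by (simp add: inverse_eq_divide)
    qed
    then have "(\<lambda>k. x + \<tau> *\<^sub>R FG k x) \<longlonglongrightarrow> x + \<tau> *\<^sub>R 0" by (intro tendsto_intros)
    then have "(\<lambda>k. g k x) \<longlonglongrightarrow> x" by (simp add: g_def)
    from LIMSEQ_subseq_LIMSEQ[OF this r] show ?thesis by (simp add: o_def)
  qed
  moreover have "(\<lambda>k. \<integral>x. det (jacobian (g (r k)) (at x)) \<partial>\<mu>) \<longlonglongrightarrow> L"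
    using L by (simp add: I_def o_def)
  ultimately show ?thesis
    using pert(2,3) by (intro exI[of _ "\<lambda>k. g (r k)"] exI[of _ L]) simp
qed

end
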